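(* Let $K$ be a number field, let $a,c\in K$ with $a\neq0$ and let $\phi=ax+a/x+c$. Let $\alpha\in K$, and suppose that there exists a prime $\mathfrak p$ of $K$ lying above $2$ such that one of the following holds: (1) $v_{\mathfrak p}(a)=0$ and $v_{\mathfrak p}(c)>0$; (2) $v_{\mathfrak p}(a)=0$, $h(a)>\log4$ and $c\equiv1\bmod\mathfrak p$. Then $[K^c_\infty(\phi,\alpha):K]<\infty$.
   Context: $v_{\mathfrak p}$ is the valuation associated to $\mathfrak p$, and $h$ is the absolute logarithmic Weil height. $\phi^{-\infty}(\alpha)=\{\gamma\in\overline K:\phi^n(\gamma)=\alpha\text{ for some }n\ge0\}$, and $K^c_\infty(\phi,\alpha)$ is the extension of $K$ generated by those $\gamma\in\phi^{-\infty}(\alpha)$ that lie in $K(\zeta_N)$ for some root of unity $\zeta_N$. *)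

theory Defs
  imports "HOL-Computational_Algebra.Polynomial" "HOL-Analysis.Analysis"
begin

text \<open>All number fields are realised as subfields of the complex numbers;
  the algebraic closure of K is taken inside the complex numbers.\<close>

definition subfield_C :: "complex set \<Rightarrow> bool" where
  "subfield_C F \<longleftrightarrow> 0 \<in> F \<and> 1 \<in> F \<and>
     (\<forall>x\<in>F. \<forall>y\<in>F. x + y \<in> F \<and> x * y \<in> F \<and> x - y \<in> F) \<and>
     (\<forall>x\<in>F. x \<noteq> 0 \<longrightarrow> inverse x \<in> F)"

definition fin_dim_over :: "complex set \<Rightarrow> complex set \<Rightarrow> bool" where
  "fin_dim_over F L \<longleftrightarrow> (\<exists>B. finite B \<and> B \<subseteq> L \<and>
     (\<forall>x\<in>L. \<exists>k. (\<forall>b\<in>B. k b \<in> F) \<and> x = (\<Sum>b\<in>B. k b * b)))"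

definition number_field :: "complex set \<Rightarrow> bool" where
  "number_field K \<longleftrightarrow> subfield_C K \<and> fin_dim_over \<rat> K"

definition gen_field :: "complex set \<Rightarrow> complex set" where
  "gen_field S = \<Inter>{F. subfield_C F \<and> S \<subseteq> F}"

definition alg_int :: "complex \<Rightarrow> bool" where
  "alg_int x \<longleftrightarrow> (\<exists>p :: int poly. lead_coeff p = 1 \<and> poly (map_poly of_int p) x = 0)"

definition ring_of_integers :: "complex set \<Rightarrow> complex set" where
  "ring_of_integers K = {x \<in> K. alg_int x}"

definition prime_of :: "complex set \<Rightarrow> complex set \<Rightarrow> bool" where
  "prime_of K P \<longleftrightarrow> (let R = ring_of_integers K in
     P \<subseteq> R \<and> 0 \<in> P \<and> (\<forall>x\<in>P. \<forall>y\<in>P. x + y \<in> P) \<and>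
     (\<forall>x\<in>P. \<forall>r\<in>R. r * x \<in> P) \<and>
     P \<noteq> {0} \<and> P \<noteq> R \<and>
     (\<forall>x\<in>R. \<forall>y\<in>R. x * y \<in> P \<longrightarrow> x \<in> P \<or> y \<in> P))"

definition lies_above :: "complex set \<Rightarrow> nat \<Rightarrow> bool" where
  "lies_above P p \<longleftrightarrow> of_nat p \<in> P"

definition ideal_prod :: "complex set \<Rightarrow> complex set \<Rightarrow> complex set" where
  "ideal_prod I J = {x. \<exists>(n::nat) f g. (\<forall>i<n. f i \<in> I \<and> g i \<in> J) \<and> x = (\<Sum>i<n. f i * g i)}"

primrec ideal_pow :: "complex set \<Rightarrow> complex set \<Rightarrow> nat \<Rightarrow> complex set" where
  "ideal_pow R P 0 = R"
| "ideal_pow R P (Suc n) = ideal_prod P (ideal_pow R P n)"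

definition ord_int :: "complex set \<Rightarrow> complex set \<Rightarrow> complex \<Rightarrow> int" where
  "ord_int K P y = int (GREATEST n. y \<in> ideal_pow (ring_of_integers K) P n)"

definition val :: "complex set \<Rightarrow> complex set \<Rightarrow> complex \<Rightarrow> int" where
  "val K P x = (SOME n. \<exists>y z. y \<in> ring_of_integers K \<and> z \<in> ring_of_integers K \<and>
       y \<noteq> 0 \<and> z \<noteq> 0 \<and> x = y / z \<and> n = ord_int K P y - ord_int K P z)"

definition ideal_norm :: "complex set \<Rightarrow> complex set \<Rightarrow> nat" where
  "ideal_norm K P = card ((\<lambda>x. {y \<in> ring_of_integers K. x - y \<in> P}) ` ring_of_integers K)"

definition embeddings :: "complex set \<Rightarrow> (complex \<Rightarrow> complex) set" where
  "embeddings K = {\<sigma>. (\<forall>x\<in>K. \<forall>y\<in>K. \<sigma> (x + y) = \<sigma> x + \<sigma> y \<and> \<sigma> (x * y) = \<sigma> x * \<sigma> y)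
      \<and> \<sigma> 1 = 1 \<and> (\<forall>x. x \<notin> K \<longrightarrow> \<sigma> x = 0)}"

text \<open>Absolute logarithmic Weil height of a nonzero element a of K, as a sum over
  the places of K: archimedean places via the [K:Q] embeddings (complex places
  counted twice = local degree 2), non-archimedean places P with
  log max(1, |a|_P) = max(0, -v_P(a)) log N(P).\<close>
definition weil_height :: "complex set \<Rightarrow> complex \<Rightarrow> real" where
  "weil_height K a =
     ((\<Sum>\<sigma>\<in>embeddings K. ln (max 1 (cmod (\<sigma> a)))) +
      (\<Sum>P\<in>{P. prime_of K P \<and> val K P a < 0}. real_of_int (- val K P a) * ln (real (ideal_norm K P))))
     / real (card (embeddings K))"

text \<open>The map phi(x) = a x + a/x + c, and the iterated preimage sets of alpha.
  A point gamma with gamma = 0 maps to infinity, which is fixed, so it never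
  reaches the finite point alpha; hence gamma must be nonzero at every stage.\<close>
definition phi :: "complex \<Rightarrow> complex \<Rightarrow> complex \<Rightarrow> complex" where
  "phi a c x = a * x + a / x + c"

primrec preimg :: "complex \<Rightarrow> complex \<Rightarrow> complex \<Rightarrow> nat \<Rightarrow> complex set" where
  "preimg a c \<alpha> 0 = {\<alpha>}"
| "preimg a c \<alpha> (Suc n) = {\<gamma>. \<gamma> \<noteq> 0 \<and> phi a c \<gamma> \<in> preimg a c \<alpha> n}"

definition backward_orbit :: "complex \<Rightarrow> complex \<Rightarrow> complex \<Rightarrow> complex set" where
  "backward_orbit a c \<alpha> = (\<Union>n. preimg a c \<alpha> n)"

definition cyclotomic_ext :: "complex set \<Rightarrow> nat \<Rightarrow> complex set" where
  "cyclotomic_ext K N = gen_field (insert (cis (2 * pi / real N)) K)"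

definition Kc_infty :: "complex set \<Rightarrow> complex \<Rightarrow> complex \<Rightarrow> complex \<Rightarrow> complex set" where
  "Kc_infty K a c \<alpha> = gen_field (K \<union>
     {\<gamma> \<in> backward_orbit a c \<alpha>. \<exists>N. N \<ge> 1 \<and> \<gamma> \<in> cyclotomic_ext K N})"

end

theory Submission
  imports Defs "HOL-Computational_Algebra.Computational_Algebra" "HOL-Number_Theory.Cong"
begin

text \<open>A point \<open>\<gamma>\<close> of the backward orbit of \<open>\<alpha>\<close> is reached by a path \<open>x\<^sub>0 = \<alpha>, \<dots>, x\<^sub>n = \<gamma>\<close> in which
  \<open>x\<^sub>i\<^sub>+\<^sub>1\<close> arises from \<open>x\<^sub>i\<close> by adjoining a square root of \<open>D = (u/2)\<^sup>2 - 1\<close>, \<open>u = (x\<^sub>i - c)/a\<close>. If \<open>\<gamma>\<close> lies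
  in some \<open>K(\<zeta>\<^sub>N)\<close> then so does the path, and it suffices to bound the least such \<open>N\<close>.

  Odd primes: since the steps have degree at most 2, Kummer theory shows that \<open>N\<close> is not divisible by
  \<open>q\<^sup>2\<close> for odd \<open>q\<close>. If \<open>q\<close> is unramified in \<open>K\<close> and divides \<open>N\<close> once, then a step that really needs
  \<open>\<zeta>\<^sub>q\<close> has \<open>D\<close> divisible by \<open>q\<close>; but the conjugates of a suitable integral multiple of \<open>D\<close> are bounded
  independently of the path, so this forces \<open>D = 0\<close> for large \<open>q\<close>.

  The prime 2: high enough in the tower of the \<open>K(\<zeta>\<^sub>Q, \<zeta>)\<close>, \<open>\<zeta>\<close> of order \<open>2\<^sup>e\<close>, every step is uniformly
  ramified at a place above \<open>\<pp>\<close>. A step of the path that raises \<open>e\<close> must be as ramified, hence has \<open>u\<close>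
  small at this place. In case (1) all later \<open>x\<^sub>i\<close> are units, so this happens at most once. In case (2)
  the map \<open>\<phi>\<close> contracts a neighbourhood of 1 that contains \<open>x\<^sub>i\<close> and all its predecessors, so a late
  such step would make \<open>x\<^sub>0 = x\<^sub>1\<close>.\<close>

section \<open>Valuation rings of the complex numbers\<close>

text \<open>Ramification and integrality are tested by valuation rings of all of C. One such ring
  restricts to every number field, so a single choice above the given prime serves the whole
  infinite tower and also square roots outside of it; algebraic integers are exactly the elements
  common to all such rings. In return the value group is unknown and possibly not archimedean, so
  discreteness has to be recovered on number fields: in a linear relation among powers of a nonunit
  two terms have equal value, which bounds the ramification by the dimension over Q. Conjugation of
  a quadratic layer of the 2-power tower need not preserve such a ring. Ramification of a layer is
  therefore phrased so that it forces conjugation to preserve the ring; taking norms then carries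
  the same measure \<open>m\<close> of ramification to the next layer. Independence of
  \<open>m\<close> from the level is what turns the level of a point into a count of small steps. In
  case (2) the contraction contradicts only paths whose first two points differ, so repetitions of a
  fixed point \<open>\<alpha>\<close> are removed from the start of a path.\<close>

locale valuation_ring =
  fixes V :: "complex set"
  assumes one_mem: "1 \<in> V"
    and diff_mem: "x \<in> V \<Longrightarrow> y \<in> V \<Longrightarrow> x - y \<in> V"
    and mult_mem: "x \<in> V \<Longrightarrow> y \<in> V \<Longrightarrow> x * y \<in> V"
    and total: "x \<in> V \<or> inverse x \<in> V"
begin

text \<open>The relation \<open>vle x y\<close> stands for \<open>\<bar>x\<bar> \<le> \<bar>y\<bar>\<close>, where \<open>\<bar>_\<bar>\<close> is the (not necessarily
  real-valued) non-archimedean absolute value with unit ball \<open>V\<close>.\<close>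

definition vle :: "complex \<Rightarrow> complex \<Rightarrow> bool" where
  "vle x y \<longleftrightarrow> (\<exists>v\<in>V. x = v * y)"

definition vlt :: "complex \<Rightarrow> complex \<Rightarrow> bool" where
  "vlt x y \<longleftrightarrow> \<not> vle y x"

definition veq :: "complex \<Rightarrow> complex \<Rightarrow> bool" where
  "veq x y \<longleftrightarrow> vle x y \<and> vle y x"

lemma zero_mem: "0 \<in> V"
  using diff_mem[OF one_mem one_mem] by simp

lemma uminus_mem: "x \<in> V \<Longrightarrow> - x \<in> V"
  using diff_mem[OF zero_mem] by simp

lemma add_mem: "x \<in> V \<Longrightarrow> y \<in> V \<Longrightarrow> x + y \<in> V"
  using diff_mem[OF _ uminus_mem] by simp

lemma vle_one_iff: "vle x 1 \<longleftrightarrow> x \<in> V"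
  by (auto simp: vle_def)

lemma vle_refl [simp]: "vle x x"
  using one_mem by (auto simp: vle_def intro!: bexI[of _ 1])

lemma vle_zero [simp]: "vle 0 x"
  using zero_mem by (auto simp: vle_def)

lemma vle_zero_iff [simp]: "vle x 0 \<longleftrightarrow> x = 0"
  using zero_mem by (auto simp: vle_def)

lemma vle_trans: "vle x y \<Longrightarrow> vle y z \<Longrightarrow> vle x z"
  unfolding vle_def by (metis mult.assoc mult_mem)

lemma vle_total: "vle x y \<or> vle y x"
proof (cases "x = 0 \<or> y = 0")
  case False
  with total[of "x / y"] show ?thesis
    unfolding vle_def by (auto intro: bexI[of _ "x / y"] bexI[of _ "y / x"])
qed auto

lemma vlt_imp_vle: "vlt x y \<Longrightarrow> vle x y"
  using vle_total vlt_def by blast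

lemma not_vle: "\<not> vle x y \<longleftrightarrow> vlt y x"
  by (simp add: vlt_def)

lemma not_vlt: "\<not> vlt x y \<longleftrightarrow> vle y x"
  by (simp add: vlt_def)

lemma vle_vlt_trans: "vle x y \<Longrightarrow> vlt y z \<Longrightarrow> vlt x z"
  unfolding vlt_def using vle_trans by blast

lemma vlt_vle_trans: "vlt x y \<Longrightarrow> vle y z \<Longrightarrow> vlt x z"
  unfolding vlt_def using vle_trans by blast

lemma vlt_irrefl [simp]: "\<not> vlt x x"
  by (simp add: vlt_def)

lemma vlt_zero_iff: "vlt 0 x \<longleftrightarrow> x \<noteq> 0"
  by (simp add: vlt_def)

lemma not_vlt_zero [simp]: "\<not> vlt x 0"
  by (simp add: vlt_def)

lemma vle_mult: "vle x y \<Longrightarrow> vle z w \<Longrightarrow> vle (x * z) (y * w)"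
  unfolding vle_def
proof (elim bexE)
  fix u v assume "u \<in> V" "v \<in> V" "x = u * y" "z = v * w"
  then show "\<exists>v\<in>V. x * z = v * (y * w)" using mult_mem by (auto intro!: bexI[of _ "u * v"])
qed

lemma vle_cancel: "z \<noteq> 0 \<Longrightarrow> vle (z * x) (z * y) \<longleftrightarrow> vle x y"
  unfolding vle_def by (auto simp: mult.left_commute)

lemma vlt_cancel: "z \<noteq> 0 \<Longrightarrow> vlt (z * x) (z * y) \<longleftrightarrow> vlt x y"
  unfolding vlt_def by (simp add: vle_cancel)

lemma vlt_mult: "vlt x y \<Longrightarrow> vle z w \<Longrightarrow> w \<noteq> 0 \<Longrightarrow> vlt (x * z) (y * w)"
  using vle_mult[of x x z w] vlt_cancel[of w x y] vle_vlt_trans[of "x * z" "x * w" "y * w"]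
  by (simp add: mult.commute)

lemma vle_add: "vle x z \<Longrightarrow> vle y z \<Longrightarrow> vle (x + y) z"
  unfolding vle_def by (metis add_mem distrib_right)

lemma vle_minus [simp]: "vle (- x) y \<longleftrightarrow> vle x y"
proof -
  have "vle (- x) y" if "vle x y" for x
    using that uminus_mem unfolding vle_def by (metis minus_mult_left)
  from this[of x] this[of "- x"] show ?thesis by auto
qed

lemma vle_minus_right [simp]: "vle x (- y) \<longleftrightarrow> vle x y"
proof -
  have "vle x (- y)" if "vle x y" for y
    using that uminus_mem unfolding vle_def by (metis minus_mult_minus)
  from this[of y] this[of "- y"] show ?thesis by auto
qed

lemma vlt_minus [simp]: "vlt (- x) y \<longleftrightarrow> vlt x y"
  by (simp add: vlt_def)

lemma vle_diff: "vle x z \<Longrightarrow> vle y z \<Longrightarrow> vle (x - y) z"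
  using vle_add[of x z "- y"] by simp

lemma vlt_add: "vlt x z \<Longrightarrow> vlt y z \<Longrightarrow> vlt (x + y) z"
  using vle_total[of x y] vle_add[of x y y] vle_add[of x x y]
    vle_vlt_trans[of "x + y" y z] vle_vlt_trans[of "x + y" x z] by auto

lemma vlt_diff: "vlt x z \<Longrightarrow> vlt y z \<Longrightarrow> vlt (x - y) z"
  using vlt_add[of x z "- y"] by simp

lemma vle_power: "vle x y \<Longrightarrow> vle (x ^ n) (y ^ n)"
  by (induction n) (auto intro: vle_mult)

lemma vlt_power:
  assumes "vlt x y" "n > 0" shows "vlt (x ^ n) (y ^ n)"
  using assms(2)
proof (induction n rule: nat_induct_non_zero)
  case (Suc n)
  have "y \<noteq> 0" using assms(1) by auto
  then show ?case using vlt_mult[OF assms(1) vlt_imp_vle[OF Suc.IH]] by simp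
qed (use assms in simp)

lemma vle_power_iff: "n > 0 \<Longrightarrow> vle (x ^ n) (y ^ n) \<longleftrightarrow> vle x y"
  using vle_power vlt_power not_vle not_vlt by metis

lemma vlt_power_iff: "n > 0 \<Longrightarrow> vlt (x ^ n) (y ^ n) \<longleftrightarrow> vlt x y"
  unfolding vlt_def by (simp add: vle_power_iff)

lemma vle_sum: "(\<And>i. i \<in> I \<Longrightarrow> vle (f i) z) \<Longrightarrow> vle (sum f I) z"
  by (induction I rule: infinite_finite_induct) (auto intro: vle_add)

lemma vlt_sum: "z \<noteq> 0 \<Longrightarrow> (\<And>i. i \<in> I \<Longrightarrow> vlt (f i) z) \<Longrightarrow> vlt (sum f I) z"
  by (induction I rule: infinite_finite_induct) (auto intro: vlt_add simp: vlt_zero_iff)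

lemma sum_mem: "(\<And>i. i \<in> I \<Longrightarrow> f i \<in> V) \<Longrightarrow> sum f I \<in> V"
  using vle_sum[of I f 1] by (simp add: vle_one_iff)

lemma power_mem: "x \<in> V \<Longrightarrow> x ^ n \<in> V"
  by (induction n) (auto intro: mult_mem one_mem)

lemma of_nat_mem [simp]: "of_nat n \<in> V"
  by (induction n) (auto intro: add_mem zero_mem one_mem)

lemma of_int_mem [simp]: "of_int n \<in> V"
proof (cases "n \<ge> 0")
  case True
  then show ?thesis using of_nat_mem[of "nat n"] by simp
next
  case False
  then show ?thesis using uminus_mem[OF of_nat_mem[of "nat (- n)"]] by simp
qed

lemma numeral_mem [simp]: "numeral n \<in> V"
  using of_nat_mem[of "numeral n"] by simp

lemma vle_mult_right: "vle x y \<Longrightarrow> z \<in> V \<Longrightarrow> vle (x * z) y"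
  using vle_mult[of x y z 1] by (simp add: vle_one_iff)

lemma vle_mult_left: "vle x y \<Longrightarrow> z \<in> V \<Longrightarrow> vle (z * x) y"
  using vle_mult_right[of x y z] by (simp add: mult.commute)

lemma vlt_mult_right: "vlt x y \<Longrightarrow> z \<in> V \<Longrightarrow> vlt (x * z) y"
  using vle_mult_right[of x x z] vle_vlt_trans by auto

lemma vlt_mult_left: "vlt x y \<Longrightarrow> z \<in> V \<Longrightarrow> vlt (z * x) y"
  using vlt_mult_right[of x y z] by (simp add: mult.commute)

lemma vle_divide_iff: "y \<noteq> 0 \<Longrightarrow> vle (x / y) z \<longleftrightarrow> vle x (y * z)"
  using vle_cancel[of y "x / y" z] by simp

lemma vle_iff_divide: "y \<noteq> 0 \<Longrightarrow> vle x y \<longleftrightarrow> x / y \<in> V"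
  using vle_divide_iff[of y x 1] by (simp add: vle_one_iff)

lemma vlt_iff_divide: "y \<noteq> 0 \<Longrightarrow> vlt x y \<longleftrightarrow> vlt (x / y) 1"
  using vlt_cancel[of y "x / y" 1] by simp

lemma vle_inverse: "x \<noteq> 0 \<Longrightarrow> vle x y \<Longrightarrow> vle (inverse y) (inverse x)"
  using vle_cancel[of "x * y" "inverse y" "inverse x"]
  by (cases "y = 0") (auto simp: field_simps)

lemma vlt_one_mem: "vlt x 1 \<Longrightarrow> x \<in> V"
  using vlt_imp_vle vle_one_iff by blast

lemma vlt_one_iff: "vlt x 1 \<longleftrightarrow> x = 0 \<or> inverse x \<notin> V"
  using vle_iff_divide[of x 1] by (cases "x = 0") (auto simp: vlt_def divide_inverse)

subsection \<open>Equality of absolute values\<close>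

lemma veq_refl [simp]: "veq x x"
  by (simp add: veq_def)

lemma veq_sym: "veq x y \<Longrightarrow> veq y x"
  by (simp add: veq_def)

lemma veq_trans: "veq x y \<Longrightarrow> veq y z \<Longrightarrow> veq x z"
  using vle_trans by (auto simp: veq_def)

lemma veq_mult: "veq x y \<Longrightarrow> veq z w \<Longrightarrow> veq (x * z) (y * w)"
  using vle_mult by (auto simp: veq_def)

lemma veq_power: "veq x y \<Longrightarrow> veq (x ^ n) (y ^ n)"
  using vle_power by (auto simp: veq_def)

lemma veq_power_iff: "n > 0 \<Longrightarrow> veq (x ^ n) (y ^ n) \<longleftrightarrow> veq x y"
  by (auto simp: veq_def vle_power_iff)

lemma veq_minus [simp]: "veq (- x) y \<longleftrightarrow> veq x y"
  by (simp add: veq_def)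

lemma veq_zero_iff [simp]: "veq x 0 \<longleftrightarrow> x = 0"
  by (auto simp: veq_def)

lemma veq_zero_iff' [simp]: "veq 0 x \<longleftrightarrow> x = 0"
  by (auto simp: veq_def)

lemma veq_cancel: "z \<noteq> 0 \<Longrightarrow> veq (z * x) (z * y) \<longleftrightarrow> veq x y"
  by (simp add: veq_def vle_cancel)

lemma veq_inverse: "veq x y \<Longrightarrow> veq (inverse x) (inverse y)"
  by (cases "x = 0"; cases "y = 0") (auto simp: veq_def vle_inverse)

text \<open>The isosceles principle: were \<open>x + y\<close> smaller than \<open>x\<close>, then
  so would be \<open>x = (x + y) - y\<close>.\<close>

lemma veq_add: "vlt y x \<Longrightarrow> veq (x + y) x"
proof -
  assume y: "vlt y x"
  have "vle x (x + y)"
  proof (rule ccontr)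
    assume "\<not> vle x (x + y)"
    then have "vlt ((x + y) - y) x" using y by (intro vlt_diff) (auto simp: not_vle)
    then show False by simp
  qed
  then show ?thesis using vle_add[of x x y] vlt_imp_vle[OF y] by (simp add: veq_def)
qed

lemma veq_vle1: "veq x y \<Longrightarrow> vle x z \<longleftrightarrow> vle y z"
  using vle_trans by (auto simp: veq_def)

lemma veq_vle2: "veq x y \<Longrightarrow> vle z x \<longleftrightarrow> vle z y"
  using vle_trans by (auto simp: veq_def)

lemma veq_vlt1: "veq x y \<Longrightarrow> vlt x z \<longleftrightarrow> vlt y z"
  by (simp add: vlt_def veq_vle2)

lemma veq_vlt2: "veq x y \<Longrightarrow> vlt z x \<longleftrightarrow> vlt z y"
  by (simp add: vlt_def veq_vle1)

lemma veq_one_iff: "veq x 1 \<longleftrightarrow> x \<in> V \<and> \<not> vlt x 1"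
  by (simp add: veq_def vle_one_iff not_vlt)

lemma veq_one_mult: "veq x 1 \<Longrightarrow> veq (x * y) y"
  using veq_mult[of x 1 y y] by simp

lemma veq_trichotomy: "vlt x y \<or> veq x y \<or> vlt y x"
  by (auto simp: veq_def vlt_def)

lemma vlt_not_veq: "vlt x y \<Longrightarrow> \<not> veq x y"
  by (auto simp: veq_def vlt_def)

text \<open>A strictly largest term cannot be cancelled, so the maximum is attained at least twice.
  This takes the place of Newton polygons.\<close>

lemma dominant_twice:
  assumes "finite I" "sum f I = 0" "i \<in> I" "f i \<noteq> 0"
  obtains j k where "j \<in> I" "k \<in> I" "j \<noteq> k" "f j \<noteq> 0" "veq (f j) (f k)"
    and "\<And>l. l \<in> I \<Longrightarrow> vle (f l) (f j)"
proof -
  have "finite I" "I \<noteq> {}" using assms by auto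
  then have "\<exists>j\<in>I. \<forall>l\<in>I. vle (f l) (f j)"
  proof (induction I rule: finite_ne_induct)
    case (insert x F)
    then obtain j where j: "j \<in> F" "\<forall>l\<in>F. vle (f l) (f j)" by auto
    show ?case
      using vle_total[of "f x" "f j"]
    proof
      assume "vle (f x) (f j)"
      then show ?thesis using j by (intro bexI[of _ j]) auto
    next
      assume "vle (f j) (f x)"
      then have "vle (f l) (f x)" if "l \<in> insert x F" for l
        using j that vle_trans[of "f l" "f j" "f x"] by (cases "l = x") auto
      then show ?thesis by blast
    qed
  qed auto
  then obtain j where j: "j \<in> I" "\<And>l. l \<in> I \<Longrightarrow> vle (f l) (f j)"
    by blast
  have nz: "f j \<noteq> 0" using j(2)[OF assms(3)] assms(4) by auto
  have "\<exists>k\<in>I. k \<noteq> j \<and> vle (f j) (f k)"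
  proof (rule ccontr)
    assume "\<not> ?thesis"
    then have "vlt (f k) (f j)" if "k \<in> I - {j}" for k using that by (auto simp: not_vle)
    then have "vlt (sum f (I - {j})) (f j)" using nz by (intro vlt_sum) auto
    then have "veq (sum f I) (f j)" using veq_add sum.remove[OF assms(1) j(1), of f] by simp
    then show False using nz assms(2) by simp
  qed
  then obtain k where k: "k \<in> I" "k \<noteq> j" "vle (f j) (f k)" by auto
  show ?thesis using that[of j k] j nz k by (auto simp: veq_def)
qed

end

section \<open>Subrings and Chevalley's extension theorem\<close>

definition subring_C :: "complex set \<Rightarrow> bool" where
  "subring_C A \<longleftrightarrow> 1 \<in> A \<and> (\<forall>x\<in>A. \<forall>y\<in>A. x - y \<in> A \<and> x * y \<in> A)"

lemma subring_CD:
  assumes "subring_C A"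
  shows subring_one: "1 \<in> A" and subring_zero: "0 \<in> A"
    and subring_diff: "x \<in> A \<Longrightarrow> y \<in> A \<Longrightarrow> x - y \<in> A"
    and subring_mult: "x \<in> A \<Longrightarrow> y \<in> A \<Longrightarrow> x * y \<in> A"
    and subring_uminus: "x \<in> A \<Longrightarrow> - x \<in> A"
    and subring_add: "x \<in> A \<Longrightarrow> y \<in> A \<Longrightarrow> x + y \<in> A"
proof -
  show 1: "1 \<in> A" and d: "x \<in> A \<Longrightarrow> y \<in> A \<Longrightarrow> x - y \<in> A" and "x \<in> A \<Longrightarrow> y \<in> A \<Longrightarrow> x * y \<in> A"
    for x y using assms by (auto simp: subring_C_def)
  show 0: "0 \<in> A" using d[OF 1 1] by simp
  show u: "x \<in> A \<Longrightarrow> - x \<in> A" for x using d[OF 0] by simp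
  show "x \<in> A \<Longrightarrow> y \<in> A \<Longrightarrow> x + y \<in> A" for x y using d[OF _ u] by simp
qed

lemma subring_sum: "subring_C A \<Longrightarrow> (\<And>i. i \<in> I \<Longrightarrow> f i \<in> A) \<Longrightarrow> sum f I \<in> A"
  by (induction I rule: infinite_finite_induct) (auto intro: subring_CD)

lemma subring_power: "subring_C A \<Longrightarrow> x \<in> A \<Longrightarrow> x ^ n \<in> A"
  by (induction n) (auto intro: subring_CD)

lemma subring_of_nat: "subring_C A \<Longrightarrow> of_nat n \<in> A"
  by (induction n) (auto intro: subring_CD)

lemma subring_of_int: "subring_C A \<Longrightarrow> of_int n \<in> A"
  using subring_of_nat[of A "nat n"] subring_uminus[OF _ subring_of_nat[of A "nat (- n)"]]
  by (cases "n \<ge> 0") auto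

section \<open>Polynomials over a subring and adjunction of an element\<close>

definition poly_over :: "complex set \<Rightarrow> complex poly \<Rightarrow> bool" where
  "poly_over A p \<longleftrightarrow> (\<forall>i. coeff p i \<in> A)"

definition adjoin :: "complex set \<Rightarrow> complex \<Rightarrow> complex set" where
  "adjoin A x = {poly p x | p. poly_over A p}"

lemma poly_over_coeff: "poly_over A p \<Longrightarrow> coeff p i \<in> A"
  by (simp add: poly_over_def)

lemma poly_over_mono: "poly_over A p \<Longrightarrow> A \<subseteq> B \<Longrightarrow> poly_over B p"
  by (auto simp: poly_over_def)

lemma poly_overI:
  assumes "subring_C A"
  shows poly_over_0: "poly_over A 0"
    and poly_over_const: "x \<in> A \<Longrightarrow> poly_over A [:x:]"
    and poly_over_1: "poly_over A 1"
    and poly_over_monom: "x \<in> A \<Longrightarrow> poly_over A (monom x n)"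
    and poly_over_pCons: "x \<in> A \<Longrightarrow> poly_over A p \<Longrightarrow> poly_over A (pCons x p)"
    and poly_over_add: "poly_over A p \<Longrightarrow> poly_over A q \<Longrightarrow> poly_over A (p + q)"
    and poly_over_diff: "poly_over A p \<Longrightarrow> poly_over A q \<Longrightarrow> poly_over A (p - q)"
    and poly_over_smult: "x \<in> A \<Longrightarrow> poly_over A p \<Longrightarrow> poly_over A (smult x p)"
    and poly_over_mult: "poly_over A p \<Longrightarrow> poly_over A q \<Longrightarrow> poly_over A (p * q)"
    and poly_over_pderiv: "poly_over A p \<Longrightarrow> poly_over A (pderiv p)"
  using assms
  by (auto simp: poly_over_def coeff_monom coeff_pCons coeff_mult coeff_pderiv
      intro!: subring_CD subring_sum subring_of_nat split: nat.splits)

lemma poly_mem: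
  assumes "subring_C A" "poly_over A p" "x \<in> A"
  shows "poly p x \<in> A"
  using assms by (auto simp: poly_altdef poly_over_def intro!: subring_sum subring_CD subring_power)

lemma adjoinI: "poly_over A p \<Longrightarrow> poly p x \<in> adjoin A x"
  by (auto simp: adjoin_def)

lemma adjoin_subset: "subring_C A \<Longrightarrow> A \<subseteq> adjoin A x"
  using adjoinI[OF poly_over_const, of A _ x] by auto

lemma adjoin_self: "subring_C A \<Longrightarrow> x \<in> adjoin A x"
  using adjoinI[of A "monom 1 1" x] poly_over_monom[of A 1 1] subring_one[of A] by (simp add: poly_monom)

lemma subring_adjoin:
  assumes "subring_C A" shows "subring_C (adjoin A x)"
  unfolding subring_C_def
proof (intro conjI ballI)
  show "1 \<in> adjoin A x" using adjoin_subset[OF assms] subring_one[OF assms] by blast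
next
  fix y z assume "y \<in> adjoin A x" "z \<in> adjoin A x"
  then obtain p q where pq: "poly_over A p" "poly_over A q" "y = poly p x" "z = poly q x"
    by (auto simp: adjoin_def)
  show "y - z \<in> adjoin A x" using adjoinI[OF poly_over_diff[OF assms pq(1,2)]] pq by simp
  show "y * z \<in> adjoin A x" using adjoinI[OF poly_over_mult[OF assms pq(1,2)]] pq by simp
qed

lemma adjoin_least: "subring_C B \<Longrightarrow> A \<subseteq> B \<Longrightarrow> x \<in> B \<Longrightarrow> adjoin A x \<subseteq> B"
  unfolding adjoin_def using poly_mem[of B _ x] poly_over_mono[of A _ B] by blast

text \<open>The ideal of \<open>B\<close> generated by \<open>I\<close>. Each membership involves
  only finitely many elements of \<open>B\<close>, and induction over it carries the chain argument
  in \<open>chevalley\<close>.\<close>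

inductive_set ideal_gen :: "complex set \<Rightarrow> complex set \<Rightarrow> complex set" for I B where
  ideal_gen_0: "0 \<in> ideal_gen I B"
| ideal_gen_step: "i \<in> I \<Longrightarrow> b \<in> B \<Longrightarrow> y \<in> ideal_gen I B \<Longrightarrow> i * b + y \<in> ideal_gen I B"

lemma ideal_gen_add: "x \<in> ideal_gen I B \<Longrightarrow> y \<in> ideal_gen I B \<Longrightarrow> x + y \<in> ideal_gen I B"
  by (induction rule: ideal_gen.induct) (auto simp: add.assoc intro: ideal_gen.intros)

lemma ideal_gen_mult:
  assumes "subring_C B" "y \<in> B"
  shows "x \<in> ideal_gen I B \<Longrightarrow> y * x \<in> ideal_gen I B"
proof (induction rule: ideal_gen.induct)
  case (ideal_gen_step i b z)
  then have "i * (y * b) + y * z \<in> ideal_gen I B"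
    using assms by (auto intro: ideal_gen.ideal_gen_step subring_mult)
  then show ?case by (simp add: algebra_simps)
qed (simp add: ideal_gen_0)

lemma ideal_gen_mono: "x \<in> ideal_gen I B \<Longrightarrow> B \<subseteq> B' \<Longrightarrow> x \<in> ideal_gen I B'"
  by (induction rule: ideal_gen.induct) (auto intro: ideal_gen.intros)

text \<open>A maximal ring among the subrings \<open>B \<supseteq> A\<close> with \<open>1 \<notin> I B\<close> is a valuation ring.\<close>

lemma maximal_ring_step:
  assumes B: "subring_C B" and J: "\<And>x y. x \<in> J \<Longrightarrow> y \<in> J \<Longrightarrow> x + y \<in> J" "0 \<in> J"
    "\<And>x y. x \<in> J \<Longrightarrow> y \<in> B \<Longrightarrow> y * x \<in> J" and "J \<subseteq> B" "1 \<notin> J"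
  shows "poly_over J p \<Longrightarrow> poly_over J r \<Longrightarrow> x \<noteq> 0 \<Longrightarrow> poly p x = 1 \<Longrightarrow> poly r (inverse x) = 1 \<Longrightarrow> False"
proof (induction "degree p + degree r" arbitrary: p r x rule: less_induct)
  case less
  have Jd: "x - y \<in> J" if "x \<in> J" "y \<in> J" for x y
    using J(1)[OF that(1) J(3)[OF that(2), of "- 1"]] subring_uminus[OF B subring_one[OF B]] by simp
  have Jsum: "sum f I \<in> J" if "\<And>i. i \<in> I \<Longrightarrow> f i \<in> J" for f and I :: "nat set"
    using that by (induction I rule: infinite_finite_induct) (auto intro: J)
  \<comment> \<open>The two relations are exchanged by passing from \<open>x\<close> to
    \<open>inverse x\<close>, so it suffices to shorten the one of larger degree.\<close>
  have wlog: False if "degree r \<le> degree p" and p: "poly_over J p" and r: "poly_over J r" and "x \<noteq> 0"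
    and px: "poly p x = 1" and rx: "poly r (inverse x) = 1"
    and IH: "\<And>p'. poly_over J p' \<Longrightarrow> poly p' x = 1 \<Longrightarrow> degree p' < degree p \<Longrightarrow> False"
    for p r x
  proof -
    define n m where "n = degree p" and "m = degree r"
    have n: "n > 0"
    proof (rule ccontr)
      assume "\<not> n > 0"
      then have "p = [:coeff p 0:]" by (simp add: n_def degree_0_id)
      then have "coeff p 0 = 1" using px by (metis poly_0_coeff_0 poly_pCons poly_0 mult_zero_right add_0_right)
      then show False using poly_over_coeff[OF p, of 0] \<open>1 \<notin> J\<close> by simp
    qed
    define r0 where "r0 = coeff r 0"
    \<comment> \<open>Multiply \<open>1 = poly p x\<close> by \<open>1 - r0\<close> and rewrite the
      top term: \<open>(1 - r0) * x ^ n\<close> is a combination of lower powers by the relation for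
      \<open>inverse x\<close>. The coefficients stay in \<open>J\<close> and the degree
      drops.\<close>
    define q where "q = monom r0 0 + smult (1 - r0) (\<Sum>i<n. monom (coeff p i) i)
       + (\<Sum>j=1..m. monom (coeff p n * coeff r j) (n - j))"
    have mn: "m \<le> n" using that by (simp add: n_def m_def)
    have r0: "r0 \<in> J" using r by (auto simp: r0_def poly_over_def)
    have pJ: "coeff p i \<in> J" for i using p by (auto simp: poly_over_def)
    have rJ: "coeff r i \<in> J" for i using r by (auto simp: poly_over_def)
    have "poly_over J q"
      unfolding poly_over_def
    proof
      fix i
      have "(1 - r0) \<in> B" using r0 \<open>J \<subseteq> B\<close> subring_one[OF B] subring_diff[OF B] by blast
      then show "coeff q i \<in> J"
        unfolding q_def using r0 pJ rJ J \<open>J \<subseteq> B\<close> subsetD[OF \<open>J \<subseteq> B\<close> pJ]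
        by (auto simp: coeff_sum coeff_monom intro!: J(1) Jsum J(3))
    qed
    moreover have "poly q x = 1"
    proof -
      have "1 - r0 = (\<Sum>j=1..m. coeff r j * inverse x ^ j)"
        using rx sum.atLeast_Suc_atMost[of 0 m "\<lambda>j. coeff r j * inverse x ^ j"]
        unfolding poly_altdef m_def[symmetric] r0_def by (simp add: atMost_atLeast0 algebra_simps)
      then have "(1 - r0) * x ^ n = (\<Sum>j=1..m. coeff r j * x ^ (n - j))"
        using mn \<open>x \<noteq> 0\<close> by (simp add: sum_distrib_right) (auto simp: power_diff field_simps intro!: sum.cong)
      then have "(\<Sum>j=1..m. coeff p n * coeff r j * x ^ (n - j)) = (1 - r0) * (coeff p n * x ^ n)"
        by (simp add: mult.assoc sum_distrib_left[symmetric])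
      moreover have "(\<Sum>i<n. coeff p i * x ^ i) + coeff p n * x ^ n = 1"
        using px unfolding poly_altdef n_def[symmetric] by (simp add: lessThan_Suc_atMost[symmetric])
      ultimately show ?thesis
      proof -
        assume 1: "(\<Sum>j=1..m. coeff p n * coeff r j * x ^ (n - j)) = (1 - r0) * (coeff p n * x ^ n)"
          and 2: "(\<Sum>i<n. coeff p i * x ^ i) + coeff p n * x ^ n = 1"
        have "poly q x = r0 + (1 - r0) * (\<Sum>i<n. coeff p i * x ^ i)
            + (\<Sum>j=1..m. coeff p n * coeff r j * x ^ (n - j))"
          by (simp add: q_def poly_monom poly_sum)
        also have "\<dots> = r0 + (1 - r0) * ((\<Sum>i<n. coeff p i * x ^ i) + coeff p n * x ^ n)"
          unfolding 1 by (simp add: distrib_left add.assoc)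
        finally show ?thesis unfolding 2 by simp
      qed
    qed
    moreover have "degree q < n"
      unfolding q_def using n
      by (intro degree_add_less degree_sum_less order.strict_trans1[OF degree_smult_le]
           order.strict_trans1[OF degree_monom_le]) auto
    ultimately show False using IH[of q] by (simp add: n_def)
  qed
  show False
  proof (cases "degree r \<le> degree p")
    case True
    show False
    proof (rule wlog[OF True less.prems])
      fix p' assume p': "poly_over J p'" "poly p' x = 1" "degree p' < degree p"
      show False by (rule less.hyps[of p' r x]) (use p' less.prems in auto)
    qed
  next
    case False
    show False
    proof (rule wlog[of p r "inverse x"])
      fix p' assume p': "poly_over J p'" "poly p' (inverse x) = 1" "degree p' < degree r"
      show False by (rule less.hyps[of p p' x]) (use p' less.prems in auto)
    qed (use less.prems False in auto)
  qed
qed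

text \<open>Zorn's lemma gives a ring \<open>B\<close> maximal among those in which \<open>I\<close>
  still generates a proper ideal. If neither \<open>x\<close> nor \<open>inverse x\<close> lay in
  \<open>B\<close>, then \<open>I\<close> would generate the unit ideal in both \<open>B[x]\<close>
  and \<open>B[1/x]\<close>, and the two resulting relations contradict
  \<open>maximal_ring_step\<close>.\<close>

theorem chevalley:
  assumes A: "subring_C A" and I: "I \<subseteq> A" and proper: "1 \<notin> ideal_gen I A"
  shows "\<exists>V. valuation_ring V \<and> A \<subseteq> V \<and> (\<forall>x\<in>I. valuation_ring.vlt V x 1)"
proof -
  define S where "S = {B. subring_C B \<and> A \<subseteq> B \<and> 1 \<notin> ideal_gen I B}"
  have "\<exists>M\<in>S. \<forall>X\<in>S. M \<subseteq> X \<longrightarrow> X = M"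
  proof (rule subset_Zorn_nonempty)
    show "S \<noteq> {}" using A proper by (auto simp: S_def)
  next
    fix C assume C: "C \<noteq> {}" "subset.chain S C"
    have CS: "B \<in> S" if "B \<in> C" for B using C that by (auto simp: subset.chain_def)
    have two: "\<exists>B\<in>C. x \<in> B \<and> y \<in> B" if "x \<in> \<Union>C" "y \<in> \<Union>C" for x y
      using that C(2) unfolding subset.chain_def by blast
    have "subring_C (\<Union>C)"
      unfolding subring_C_def
    proof (intro conjI ballI)
      show "1 \<in> \<Union>C" using C(1) CS by (auto simp: S_def dest: subring_one)
    next
      fix x y assume xy: "x \<in> \<Union>C" "y \<in> \<Union>C"
      then obtain B where B: "B \<in> C" "x \<in> B" "y \<in> B" using two by blast
      then have "subring_C B" using CS by (auto simp: S_def)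
      then show "x - y \<in> \<Union>C" "x * y \<in> \<Union>C" using B subring_diff subring_mult by blast+
    qed
    moreover have "\<exists>B\<in>C. y \<in> ideal_gen I B" if "y \<in> ideal_gen I (\<Union>C)" for y
      using that
    proof (induction rule: ideal_gen.induct)
      case ideal_gen_0
      then show ?case using C(1) by (auto intro: ideal_gen.intros)
    next
      case (ideal_gen_step i b y)
      then obtain B where B: "B \<in> C" "y \<in> ideal_gen I B" by blast
      obtain B' where B': "B' \<in> C" "b \<in> B'" using ideal_gen_step by blast
      have "B \<subseteq> B' \<or> B' \<subseteq> B" using B B' C(2) unfolding subset.chain_def by blast
      then show ?case
      proof
        assume "B \<subseteq> B'"
        then show ?thesis using B B' ideal_gen_step(1) ideal_gen_mono[of y I B B']
          by (intro bexI[of _ B'] ideal_gen.ideal_gen_step) auto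
      next
        assume "B' \<subseteq> B"
        then show ?thesis using B B' ideal_gen_step(1)
          by (intro bexI[of _ B] ideal_gen.ideal_gen_step) auto
      qed
    qed
    ultimately show "\<Union>C \<in> S" using C(1) CS by (auto simp: S_def)
  qed
  then obtain B where B: "subring_C B" "A \<subseteq> B" "1 \<notin> ideal_gen I B"
    and max: "\<And>X. subring_C X \<Longrightarrow> B \<subseteq> X \<Longrightarrow> 1 \<notin> ideal_gen I X \<Longrightarrow> X = B"
    unfolding S_def by auto
  define J where "J = ideal_gen I B"
  have IB: "I \<subseteq> B" using I B(2) by blast
  have JB: "y \<in> B" if "y \<in> ideal_gen I B" for y
    using that by (induction rule: ideal_gen.induct) (use IB B(1) in \<open>auto intro: subring_CD\<close>)
  have IJ: "i * b \<in> J" if "i \<in> I" "b \<in> B" for i b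
    using ideal_gen.ideal_gen_step[OF that ideal_gen.ideal_gen_0] by (simp add: J_def)
  have repr: "\<exists>p. poly_over J p \<and> poly p x = 1" if "x \<notin> B" for x
  proof -
    have "\<exists>p. poly_over J p \<and> poly p x = y" if "y \<in> ideal_gen I (adjoin B x)" for y
      using that
    proof (induction rule: ideal_gen.induct)
      case ideal_gen_0
      then show ?case by (intro exI[of _ 0]) (auto simp: poly_over_def J_def intro: ideal_gen.intros)
    next
      case (ideal_gen_step i b y)
      then obtain p where p: "poly_over J p" "poly p x = y" by blast
      obtain q where q: "poly_over B q" "b = poly q x" using ideal_gen_step by (auto simp: adjoin_def)
      have "poly_over J (smult i q + p)"
        using p q IJ[OF ideal_gen_step(1)] unfolding poly_over_def J_def by (auto intro: ideal_gen_add)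
      then show ?case using p q by (intro exI[of _ "smult i q + p"]) auto
    qed
    moreover have "1 \<in> ideal_gen I (adjoin B x)"
      using max[OF subring_adjoin[OF B(1)] adjoin_subset[OF B(1)], of x] adjoin_self[OF B(1), of x] that by auto
    ultimately show ?thesis by blast
  qed
  have val: "valuation_ring B"
  proof
    show "1 \<in> B" "\<And>x y. x \<in> B \<Longrightarrow> y \<in> B \<Longrightarrow> x - y \<in> B" "\<And>x y. x \<in> B \<Longrightarrow> y \<in> B \<Longrightarrow> x * y \<in> B"
      using B(1) by (auto intro: subring_CD)
    show "x \<in> B \<or> inverse x \<in> B" for x
    proof (rule ccontr)
      assume "\<not> ?thesis"
      then have x: "x \<notin> B" "inverse x \<notin> B" by auto
      then have "x \<noteq> 0" using subring_zero[OF B(1)] by auto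
      obtain p r where "poly_over J p" "poly p x = 1" "poly_over J r" "poly r (inverse x) = 1"
        using repr x by blast
      then show False using maximal_ring_step[OF B(1), of J p r x] \<open>x \<noteq> 0\<close> B(3) JB
        ideal_gen_mult[OF B(1)] by (auto simp: J_def ideal_gen_add ideal_gen.ideal_gen_0)
    qed
  qed
  moreover have "valuation_ring.vlt B x 1" if "x \<in> I" for x
  proof (rule ccontr)
    assume "\<not> ?thesis"
    then have "x \<noteq> 0" "inverse x \<in> B" using valuation_ring.vlt_one_iff[OF val] by auto
    then show False using IJ[OF that, of "inverse x"] B(3) by (simp add: J_def)
  qed
  ultimately show ?thesis using B(2) by blast
qed

section \<open>Algebraic integers\<close>

lemma (in valuation_ring) subring: "subring_C V"
  unfolding subring_C_def using one_mem diff_mem mult_mem by auto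

text \<open>If \<open>y\<close> were outside \<open>V\<close>, dividing the monic equation by
  \<open>y ^ (n - 1)\<close> would express \<open>y\<close> by powers of
  \<open>inverse y \<in> V\<close>.\<close>

lemma alg_int_mem:
  assumes "valuation_ring V" "alg_int y" shows "y \<in> V"
proof (rule ccontr)
  assume y: "y \<notin> V"
  interpret valuation_ring V by fact
  obtain p :: "int poly" where p: "lead_coeff p = 1" "poly (map_poly of_int p) y = 0"
    using assms by (auto simp: alg_int_def)
  define n where "n = degree p"
  have iy: "inverse y \<in> V" "y \<noteq> 0" using y total zero_mem by auto
  have "n > 0"
  proof (rule ccontr)
    assume "\<not> n > 0"
    then have "p = 1" using p(1) by (metis degree_0_id n_def not_gr_zero one_pCons)
    then show False using p(2) by simp
  qed
  have "(\<Sum>i<n. of_int (coeff p i) * y ^ i) + y ^ n = 0"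
    using p degree_map_poly[of "of_int :: int \<Rightarrow> complex" p] unfolding poly_altdef
    by (simp add: lessThan_Suc_atMost[symmetric] n_def coeff_map_poly)
  then have "y ^ n * inverse y ^ (n - 1) = - (\<Sum>i<n. of_int (coeff p i) * y ^ i) * inverse y ^ (n - 1)"
    by (metis add_eq_0_iff minus_minus)
  also have "\<dots> = - (\<Sum>i<n. of_int (coeff p i) * inverse y ^ (n - 1 - i))"
    unfolding minus_mult_left[symmetric] sum_distrib_right neg_equal_iff_equal
  proof (rule sum.cong[OF refl])
    fix i assume "i \<in> {..<n}"
    then have "inverse y ^ (n - 1) = inverse y ^ i * inverse y ^ (n - 1 - i)"
      by (simp add: power_add[symmetric])
    then show "of_int (coeff p i) * y ^ i * inverse y ^ (n - 1) = of_int (coeff p i) * inverse y ^ (n - 1 - i)"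
      using iy by (simp add: power_inverse)
  qed
  also have "y ^ n * inverse y ^ (n - 1) = y"
    using iy \<open>n > 0\<close> by (cases n) (auto simp: field_simps)
  finally have "y = - (\<Sum>i<n. of_int (coeff p i) * inverse y ^ (n - 1 - i))" .
  moreover have "- (\<Sum>i<n. of_int (coeff p i) * inverse y ^ (n - 1 - i)) \<in> V"
    using iy by (intro uminus_mem sum_mem mult_mem of_int_mem power_mem)
  ultimately show False using y by simp
qed

text \<open>If \<open>inverse y\<close> generated a proper ideal of \<open>Z[1/y]\<close>, then
  \<open>chevalley\<close> would give a valuation ring without \<open>y\<close>. So \<open>y\<close>
  itself is an integer polynomial in \<open>inverse y\<close>, and multiplying by a power of
  \<open>y\<close> gives a monic equation.\<close>

lemma alg_intI:
  assumes "\<And>V. valuation_ring V \<Longrightarrow> y \<in> V" shows "alg_int y"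
proof (cases "y = 0")
  case True
  then show ?thesis unfolding alg_int_def by (intro exI[of _ "[:0, 1:]"]) (simp add: map_poly_pCons)
next
  case False
  define A where "A = adjoin \<int> (inverse y)"
  have Z: "subring_C \<int>" by (auto simp: subring_C_def)
  note A = subring_adjoin[OF Z, of "inverse y", folded A_def]
  have iy: "inverse y \<in> A" using adjoin_self[OF Z] by (simp add: A_def)
  have "1 \<in> ideal_gen {inverse y} A"
  proof (rule ccontr)
    assume "1 \<notin> ideal_gen {inverse y} A"
    then obtain V where V: "valuation_ring V" "valuation_ring.vlt V (inverse y) 1"
      using chevalley[OF A, of "{inverse y}"] iy by auto
    then show False using assms[OF V(1)] False valuation_ring.vlt_one_iff[OF V(1)] by auto
  qed
  moreover have "\<exists>b\<in>A. z = inverse y * b" if "z \<in> ideal_gen {inverse y} A" for z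
    using that
  proof (induction rule: ideal_gen.induct)
    case ideal_gen_0
    show ?case using subring_zero[OF A] by auto
  next
    case (ideal_gen_step i b z)
    then obtain b' where "b' \<in> A" "z = inverse y * b'" by blast
    then show ?case using ideal_gen_step by (intro bexI[of _ "b + b'"]) (auto intro: subring_add[OF A] simp: algebra_simps)
  qed
  ultimately obtain b where "b \<in> A" "1 = inverse y * b" by blast
  then obtain q where q: "poly_over \<int> q" "poly q (inverse y) = y"
    using False by (auto simp: A_def adjoin_def field_simps)
  define n where "n = degree q"
  define f where "f i = (SOME k. coeff q i = of_int k)" for i
  have f: "coeff q i = of_int (f i)" for i
    unfolding f_def by (rule someI_ex) (use q in \<open>auto simp: poly_over_def elim: Ints_cases\<close>)
  define p :: "int poly" where "p = monom 1 (Suc n) - (\<Sum>i\<le>n. monom (f i) (n - i))"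
  have dlt: "degree (\<Sum>i\<le>n. monom (f i) (n - i)) < Suc n"
    by (intro degree_sum_less le_less_trans[OF degree_monom_le]) auto
  have deg: "degree p = Suc n"
    unfolding p_def using dlt degree_add_eq_left[of "- (\<Sum>i\<le>n. monom (f i) (n - i))" "monom 1 (Suc n)"]
    by (simp add: degree_monom_eq)
  have "lead_coeff p = 1" unfolding deg using coeff_eq_0[OF dlt] by (simp add: p_def)
  moreover have "poly (map_poly of_int p) y = 0"
  proof -
    have "y ^ Suc n = y ^ n * poly q (inverse y)" using q by simp
    also have "\<dots> = (\<Sum>i\<le>n. of_int (f i) * y ^ (n - i))"
      unfolding poly_altdef n_def[symmetric] f using False
      by (auto simp: sum_distrib_left power_diff field_simps intro!: sum.cong)
    finally have eq: "y ^ Suc n = (\<Sum>i\<le>n. of_int (f i) * y ^ (n - i))" .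
    have "map_poly (of_int :: int \<Rightarrow> complex) p
       = monom 1 (Suc n) - (\<Sum>i\<le>n. monom (of_int (f i)) (n - i))"
      by (rule poly_eqI) (auto simp: p_def coeff_map_poly coeff_sum coeff_monom intro!: sum.cong)
    then show ?thesis using eq by (simp add: poly_sum poly_monom)
  qed
  ultimately show ?thesis unfolding alg_int_def by blast
qed

lemma alg_int_iff: "alg_int y \<longleftrightarrow> (\<forall>V. valuation_ring V \<longrightarrow> y \<in> V)"
  using alg_int_mem alg_intI by blast

section \<open>Number fields\<close>

interpretation Q: vector_space "\<lambda>(r::rat) (x::complex). of_rat r * x"
  by standard (auto simp: algebra_simps of_rat_add of_rat_mult)

lemma subring_Rats: "subring_C \<rat>"
  by (auto simp: subring_C_def)

lemma subfield_CD:
  assumes "subfield_C F"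
  shows subfield_subring: "subring_C F" and subfield_inverse: "x \<in> F \<Longrightarrow> inverse x \<in> F"
    and subfield_divide: "x \<in> F \<Longrightarrow> y \<in> F \<Longrightarrow> x / y \<in> F"
    and subfield_Rats: "\<rat> \<subseteq> F"
proof -
  show s: "subring_C F" using assms by (auto simp: subfield_C_def subring_C_def)
  show i: "inverse x \<in> F" if "x \<in> F" for x
    using assms that by (cases "x = 0") (auto simp: subfield_C_def)
  show d: "x / y \<in> F" if "x \<in> F" "y \<in> F" for x y
    using subring_mult[OF s that(1) i[OF that(2)]] by (simp add: divide_inverse)
  show "\<rat> \<subseteq> F"
  proof
    fix x :: complex assume "x \<in> \<rat>"
    then obtain a b where "x = of_int a / of_int b" by (auto elim: Rats_cases')
    then show "x \<in> F" using d subring_of_int[OF s] by auto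
  qed
qed

lemma subfieldI:
  assumes "subring_C F" "\<And>x. x \<in> F \<Longrightarrow> x \<noteq> 0 \<Longrightarrow> inverse x \<in> F"
  shows "subfield_C F"
  using assms by (auto simp: subfield_C_def intro: subring_CD)

lemma number_field_subfield: "number_field F \<Longrightarrow> subfield_C F"
  by (simp add: number_field_def)

lemma number_field_subring: "number_field F \<Longrightarrow> subring_C F"
  using number_field_subfield subfield_subring by blast

text \<open>In \<open>fin_dim_over\<close> the spanning set has to lie in \<open>L\<close>, here it
  need not. A maximal independent subset of \<open>L\<close> is finite by comparison with
  \<open>B\<close>; this is what lets finite dimension pass to subsets.\<close>

lemma fin_dim_over_Rats_iff:
  "fin_dim_over \<rat> L \<longleftrightarrow> (\<exists>B. finite B \<and> L \<subseteq> Q.span B)"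
proof
  assume "fin_dim_over \<rat> L"
  then obtain B where B: "finite B" and s: "\<And>x. x \<in> L \<Longrightarrow> \<exists>k. (\<forall>b\<in>B. k b \<in> \<rat>) \<and> x = (\<Sum>b\<in>B. k b * b)"
    unfolding fin_dim_over_def by blast
  have "x \<in> Q.span B" if x: "x \<in> L" for x
  proof -
    obtain k where k: "\<And>b. b \<in> B \<Longrightarrow> k b \<in> \<rat>" "x = (\<Sum>b\<in>B. k b * b)" using s[OF x] by blast
    have "k b * b \<in> Q.span B" if "b \<in> B" for b
      using k(1)[OF that] Q.span_scale[OF Q.span_base[OF that]] by (auto elim!: Rats_cases)
    then show ?thesis unfolding k(2) by (intro Q.span_sum)
  qed
  then show "\<exists>B. finite B \<and> L \<subseteq> Q.span B" using B by blast
next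
  assume "\<exists>B. finite B \<and> L \<subseteq> Q.span B"
  then obtain B where B: "finite B" "L \<subseteq> Q.span B" by blast
  obtain C where C: "C \<subseteq> L" "Q.independent C" "L \<subseteq> Q.span C"
    using Q.maximal_independent_subset[of L] by blast
  have "finite C" using Q.independent_span_bound[OF B(1) C(2)] C B by blast
  show "fin_dim_over \<rat> L"
    unfolding fin_dim_over_def
  proof (intro exI[of _ C] conjI ballI)
    fix x assume "x \<in> L"
    then have "x \<in> Q.span C" using C by blast
    then obtain u where "x = (\<Sum>b\<in>C. of_rat (u b) * b)"
      unfolding Q.span_finite[OF \<open>finite C\<close>] by auto
    then show "\<exists>k. (\<forall>b\<in>C. k b \<in> \<rat>) \<and> x = (\<Sum>b\<in>C. k b * b)"
      by (intro exI[of _ "\<lambda>b. of_rat (u b)"]) auto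
  qed (use C \<open>finite C\<close> in auto)
qed

lemma number_field_span:
  assumes "number_field F" obtains B where "finite B" "F \<subseteq> Q.span B"
  using assms by (auto simp: number_field_def fin_dim_over_Rats_iff)

text \<open>Reduces the theorem to enclosing \<open>Kc_infty\<close> in one number field: rational
  coefficients are in particular coefficients in \<open>K\<close>.\<close>

lemma fin_dim_over_subset:
  assumes "number_field E" "subfield_C K" "L \<subseteq> E"
  shows "fin_dim_over K L"
proof -
  have "fin_dim_over \<rat> L"
    using assms by (auto simp: number_field_def fin_dim_over_Rats_iff)
  then obtain B where B: "finite B" "B \<subseteq> L"
      and s: "\<And>x. x \<in> L \<Longrightarrow> \<exists>k. (\<forall>b\<in>B. k b \<in> \<rat>) \<and> x = (\<Sum>b\<in>B. k b * b)"
    unfolding fin_dim_over_def by blast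
  show ?thesis
    unfolding fin_dim_over_def
  proof (intro exI[of _ B] conjI ballI)
    fix x assume "x \<in> L"
    then show "\<exists>k. (\<forall>b\<in>B. k b \<in> K) \<and> x = (\<Sum>b\<in>B. k b * b)"
      using s[of x] subfield_Rats[OF assms(2)] by (meson subsetD)
  qed (use B in auto)
qed

subsection \<open>Algebraic numbers\<close>

lemma power_dependence:
  assumes "finite B" "\<And>i. y ^ i \<in> Q.span B"
  shows "\<exists>p. poly_over \<rat> p \<and> p \<noteq> 0 \<and> degree p \<le> card B \<and> poly p y = 0"
\<comment> \<open>Dependence is a notion for sets, so coinciding powers are treated apart.\<close>
proof (cases "inj_on (\<lambda>i. y ^ i) {..card B}")
  case False
  then obtain i j where ij: "i \<le> card B" "j \<le> card B" "i \<noteq> j" "y ^ i = y ^ j"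
    by (auto simp: inj_on_def)
  let ?p = "monom 1 i - monom 1 j :: complex poly"
  have "coeff ?p i \<noteq> 0" using ij by (simp add: coeff_monom)
  then have "?p \<noteq> 0" by (metis coeff_0)
  moreover have "degree ?p \<le> card B" using ij by (intro degree_diff_le degree_monom_le[THEN order_trans])
  moreover have "poly_over \<rat> ?p" by (auto simp: poly_over_def coeff_monom)
  ultimately show ?thesis using ij by (intro exI[of _ ?p]) (simp add: poly_monom)
next
  case True
  let ?S = "(\<lambda>i. y ^ i) ` {..card B}"
  have "Q.dependent ?S"
  proof (rule ccontr)
    assume "\<not> Q.dependent ?S"
    then have "card ?S \<le> card B" using Q.independent_span_bound[OF assms(1)] assms(2) by blast
    then show False using card_image[OF True] by simp
  qed
  then obtain u k where u: "k \<le> card B" "u (y ^ k) \<noteq> 0" "(\<Sum>v\<in>?S. of_rat (u v) * v) = 0"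
    using Q.dependent_finite[of ?S] by auto
  let ?p = "\<Sum>i\<le>card B. monom (of_rat (u (y ^ i))) i :: complex poly"
  have c: "coeff ?p i = (if i \<le> card B then of_rat (u (y ^ i)) else 0)" for i
    by (simp add: coeff_sum coeff_monom)
  have "coeff ?p k \<noteq> 0" using u c by simp
  then have "?p \<noteq> 0" by (metis coeff_0)
  moreover have "poly_over \<rat> ?p" by (auto simp: poly_over_def c)
  moreover have "degree ?p \<le> card B" by (rule degree_le) (auto simp: c)
  moreover have "poly ?p y = 0"
    using u(3) sum.reindex[OF True, of "\<lambda>v. of_rat (u v) * v"] by (simp add: poly_sum poly_monom o_def)
  ultimately show ?thesis by blast
qed

definition algebraic_number :: "complex \<Rightarrow> bool" where
  "algebraic_number y \<longleftrightarrow> (\<exists>p. poly_over \<rat> p \<and> p \<noteq> 0 \<and> poly p y = 0)"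

lemma poly_nonzero_const:
  "poly_over A p \<Longrightarrow> p \<noteq> 0 \<Longrightarrow> poly p y = 0 \<Longrightarrow> y \<noteq> 0 \<Longrightarrow>
    \<exists>q. poly_over A q \<and> coeff q 0 \<noteq> 0 \<and> degree q \<le> degree p \<and> poly q y = 0"
proof (induction p)
  case (pCons a p)
  show ?case
  proof (cases "a = 0")
    case True
    then have "p \<noteq> 0" "poly p y = 0" "degree p \<le> degree (pCons a p)" using pCons.prems by auto
    moreover have "poly_over A p"
      unfolding poly_over_def
    proof
      fix i show "coeff p i \<in> A" using poly_over_coeff[OF pCons.prems(1), of "Suc i"] by simp
    qed
    ultimately show ?thesis using pCons.IH pCons.prems by fastforce
  next
    case False
    then show ?thesis using pCons.prems by (intro exI[of _ "pCons a p"]) auto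
  qed
qed auto

text \<open>A relation with nonzero constant term, divided by that term, exhibits the inverse as a
  rational polynomial in \<open>y\<close>. Hence a ring of algebraic numbers containing Q is a
  field.\<close>

lemma algebraic_inverse:
  assumes "algebraic_number y" "subring_C R" "\<rat> \<subseteq> R" "y \<in> R"
  shows "inverse y \<in> R"
proof (cases "y = 0")
  case False
  then obtain q where q: "poly_over \<rat> q" "coeff q 0 \<noteq> 0" "poly q y = 0"
    using assms(1) poly_nonzero_const unfolding algebraic_number_def by blast
  obtain a r where r: "q = pCons a r" by (cases q)
  have a: "a \<noteq> 0" "a \<in> R" using q(2) poly_over_coeff[OF q(1), of 0] r assms(3) by auto
  have ia: "- inverse a \<in> R"
    using poly_over_coeff[OF q(1), of 0] r assms(3) by auto
  have rR: "poly_over R r"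
    unfolding poly_over_def
  proof
    fix i show "coeff r i \<in> R" using poly_over_coeff[OF q(1), of "Suc i"] r assms(3) by auto
  qed
  have "inverse y = - inverse a * poly r y"
    using q(3) r a False by (simp add: field_simps) (metis add_eq_0_iff minus_minus mult.commute)
  then show ?thesis using subring_mult[OF assms(2) ia poly_mem[OF assms(2) rR assms(4)]] by simp
qed (use assms subring_zero in auto)

lemma number_field_algebraic:
  assumes "number_field F" "y \<in> F" shows "algebraic_number y"
proof -
  obtain B where B: "finite B" "F \<subseteq> Q.span B" using number_field_span[OF assms(1)] .
  have "y ^ i \<in> F" for i using subring_power[OF number_field_subring[OF assms(1)] assms(2)] .
  then show ?thesis using power_dependence[OF B(1), of y] subsetD[OF B(2)]
    unfolding algebraic_number_def by auto
qed

lemma number_fieldI: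
  assumes "subring_C R" "\<rat> \<subseteq> R" "finite B" "R \<subseteq> Q.span B"
  shows "number_field R"
proof -
  have "algebraic_number y" if "y \<in> R" for y
    using power_dependence[OF assms(3), of y] subring_power[OF assms(1) that] subsetD[OF assms(4)]
    unfolding algebraic_number_def by auto
  then have "subfield_C R" using algebraic_inverse[OF _ assms(1,2)] by (intro subfieldI[OF assms(1)]) blast
  then show ?thesis using assms by (auto simp: number_field_def fin_dim_over_Rats_iff)
qed

lemma algebraic_monic:
  assumes "algebraic_number y"
  obtains f where "poly_over \<rat> f" "lead_coeff f = 1" "poly f y = 0" "degree f > 0"
proof -
  obtain p where p: "poly_over \<rat> p" "p \<noteq> 0" "poly p y = 0" using assms by (auto simp: algebraic_number_def)
  let ?f = "smult (inverse (lead_coeff p)) p"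
  have d: "degree p > 0"
  proof (rule ccontr)
    assume "\<not> degree p > 0"
    then obtain a where "p = [:a:]" by (auto elim: degree_eq_zeroE)
    then show False using p by auto
  qed
  have "poly_over \<rat> ?f" using p by (auto simp: poly_over_def)
  then show ?thesis using p d by (intro that[of ?f]) auto
qed

subsection \<open>Adjoining a root of a monic polynomial\<close>

text \<open>The only coefficient that would have to be inverted is the leading one of
  \<open>h\<close>, so this works over rings such as \<open>F \<inter> V\<close> that are not
  fields.\<close>

lemma poly_division_monic:
  assumes A: "subring_C A" and h: "poly_over A h" "lead_coeff h = 1" "degree h > 0"
  shows "poly_over A p \<Longrightarrow> \<exists>k r. poly_over A k \<and> poly_over A r \<and> p = h * k + r \<and> degree r < degree h"
proof (induction "degree p" arbitrary: p rule: less_induct)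
  case less
  show ?case
  proof (cases "degree p < degree h")
    case True
    then show ?thesis using less.prems poly_over_0[OF A] by (intro exI[of _ 0] exI[of _ p]) auto
  next
    case False
    define m where "m = monom (lead_coeff p) (degree p - degree h)"
    define p' where "p' = p - h * m"
    have m: "poly_over A m" using less.prems A by (auto simp: m_def intro!: poly_over_monom poly_over_coeff)
    have p': "poly_over A p'" unfolding p'_def using A less.prems m h by (intro poly_over_diff poly_over_mult)
    have pn: "degree p > 0" using False h(3) by simp
    have "degree p' < degree p"
    proof -
      have hm: "degree (h * m) \<le> degree p"
        using degree_mult_le[of h m] degree_monom_le[of "lead_coeff p" "degree p - degree h"] False
        by (simp add: m_def)
      have "coeff (h * m) (degree p) = lead_coeff p"
        using False h(2) coeff_monom_mult[of "lead_coeff p" "degree p - degree h" h "degree p"]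
        unfolding m_def by (simp add: mult.commute[of h])
      then have "coeff p' (degree p) = 0" by (simp add: p'_def)
      moreover have "degree p' \<le> degree p" unfolding p'_def using hm by (intro degree_diff_le) auto
      ultimately show ?thesis using pn by (metis eq_zero_or_degree_less degree_0 le_neq_implies_less leading_coeff_0_iff)
    qed
    from less.hyps[OF this p'] obtain k r where "poly_over A k" "poly_over A r" "p' = h * k + r" "degree r < degree h"
      by blast
    then show ?thesis using m poly_over_add[OF A]
      by (intro exI[of _ "k + m"] exI[of _ r]) (auto simp: p'_def algebra_simps)
  qed
qed

lemma monic_root_degree_pos: "lead_coeff f = 1 \<Longrightarrow> poly f (x::complex) = 0 \<Longrightarrow> degree f > 0"
proof (rule ccontr)
  assume "lead_coeff f = 1" "poly f x = 0" "\<not> degree f > 0"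
  then show False by (auto elim!: degree_eq_zeroE)
qed

lemma adjoin_low_degree:
  assumes "subring_C A" "poly_over A f" "lead_coeff f = 1" "poly f x = 0" "y \<in> adjoin A x"
  obtains r where "poly_over A r" "degree r < degree f" "y = poly r x"
proof -
  obtain p where p: "poly_over A p" "y = poly p x" using assms(5) by (auto simp: adjoin_def)
  obtain k r where "poly_over A k" "poly_over A r" "p = f * k + r" "degree r < degree f"
    using poly_division_monic[OF assms(1-3) monic_root_degree_pos[OF assms(3,4)] p(1)] by blast
  then show ?thesis using that[of r] p assms(4) by simp
qed

lemma number_field_adjoin:
  assumes F: "number_field F" and f: "poly_over F f" "lead_coeff f = 1" "poly f x = 0"
  shows "number_field (adjoin F x)"
proof -
  note FR = number_field_subring[OF F]
  obtain B where B: "finite B" "F \<subseteq> Q.span B" using number_field_span[OF F] .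
  let ?C = "(\<lambda>(b, i). b * x ^ i) ` (B \<times> {..<degree f})"
  have sp: "u * x ^ i \<in> Q.span ?C" if "u \<in> F" "i < degree f" for u i
  proof -
    have "u \<in> Q.span B" using that B by blast
    then show ?thesis
    proof (induction rule: Q.span_induct_alt)
      case base
      then show ?case by (simp add: Q.span_zero)
    next
      case (step c b u)
      have "b * x ^ i \<in> Q.span ?C" using step that by (intro Q.span_base) auto
      then have "of_rat c * (b * x ^ i) + u * x ^ i \<in> Q.span ?C"
        using step by (intro Q.span_add Q.span_scale)
      then show ?case by (simp add: algebra_simps)
    qed
  qed
  show ?thesis
  proof (rule number_fieldI)
    show "subring_C (adjoin F x)" by (rule subring_adjoin[OF FR])
    show "\<rat> \<subseteq> adjoin F x"
      using adjoin_subset[OF FR] subfield_Rats[OF number_field_subfield[OF F]] by blast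
    show "finite ?C" using B by simp
    show "adjoin F x \<subseteq> Q.span ?C"
    proof
      fix y assume "y \<in> adjoin F x"
      then obtain r where r: "poly_over F r" "degree r < degree f" "y = poly r x"
        using adjoin_low_degree[OF FR f] by blast
      have "coeff r i * x ^ i \<in> Q.span ?C" if "i \<le> degree r" for i
        using sp[OF poly_over_coeff[OF r(1)]] r(2) that by simp
      then show "y \<in> Q.span ?C"
        unfolding r(3) poly_altdef by (intro Q.span_sum) auto
    qed
  qed
qed

lemma gen_field_insert_subset:
  assumes "subfield_C (adjoin F x)" "subring_C F"
  shows "gen_field (insert x F) = adjoin F x"
proof
  show "gen_field (insert x F) \<subseteq> adjoin F x"
    unfolding gen_field_def using assms adjoin_self[of F x] adjoin_subset[of F x] by blast
  show "adjoin F x \<subseteq> gen_field (insert x F)"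
    unfolding gen_field_def using adjoin_least[OF subfield_subring, of _ F x] by blast
qed

lemma gen_field_least: "subfield_C F \<Longrightarrow> S \<subseteq> F \<Longrightarrow> gen_field S \<subseteq> F"
  unfolding gen_field_def by blast

subsection \<open>Quadratic extensions\<close>

lemma adjoin_quadratic:
  assumes F: "subring_C F" and s: "s^2 \<in> F" and y: "y \<in> adjoin F s"
  obtains p q where "p \<in> F" "q \<in> F" "y = p + q * s"
proof -
  let ?f = "[:- (s^2), 0, 1:] :: complex poly"
  have "poly_over F ?f"
    using s F by (auto intro!: poly_over_pCons poly_over_0 subring_CD)
  then obtain r where r: "poly_over F r" "degree r < 2" "y = poly r s"
    using adjoin_low_degree[OF F, of ?f s y] y by (auto simp: power2_eq_square numeral_2_eq_2)
  have "r = [:coeff r 0, coeff r 1:]"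
  proof (rule poly_eqI)
    fix n
    show "coeff r n = coeff [:coeff r 0, coeff r 1:] n"
      using r(2) by (cases n; cases "n - 1") (auto simp: coeff_pCons coeff_eq_0 split: nat.splits)
  qed
  then have "y = coeff r 0 + coeff r 1 * s" using r(3) by (metis poly_pCons poly_0 mult_zero_right add_0_right mult.commute)
  then show ?thesis using that poly_over_coeff[OF r(1)] by blast
qed

lemma adjoinI_quadratic:
  assumes F: "subring_C F" and "p \<in> F" "q \<in> F" shows "p + q * s \<in> adjoin F s"
  using adjoin_subset[OF F] adjoin_self[OF F] assms subring_adjoin[OF F] by (meson subring_add subring_mult subsetD)

lemma quadratic_unique:
  assumes F: "subfield_C F" and s: "s \<notin> F" and m: "p \<in> F" "q \<in> F" "p' \<in> F" "q' \<in> F"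
    and eq: "p + q * s = p' + q' * s"
  shows "p = p'" "q = q'"
proof -
  have "q = q'"
  proof (rule ccontr)
    assume "q \<noteq> q'"
    then have "s = (p' - p) / (q - q')" using eq by (simp add: field_simps)
    then show False using s m subfield_divide[OF F] subring_diff[OF subfield_subring[OF F]] by auto
  qed
  then show "q = q'" "p = p'" using eq by auto
qed

lemma subfield_adjoin_quadratic:
  assumes F: "subfield_C F" and s: "s^2 \<in> F"
  shows "subfield_C (adjoin F s)"
proof (rule subfieldI)
  note FR = subfield_subring[OF F]
  show "subring_C (adjoin F s)" using subring_adjoin[OF FR] .
  fix x assume x: "x \<in> adjoin F s" "x \<noteq> 0"
  obtain p q where pq: "p \<in> F" "q \<in> F" "x = p + q * s" using adjoin_quadratic[OF FR s x(1)] .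
  show "inverse x \<in> adjoin F s"
  proof (cases "s \<in> F")
    case True
    then have "x \<in> F" using pq FR True by (auto intro: subring_CD)
    then show ?thesis using subfield_inverse[OF F] adjoin_subset[OF FR] by blast
  next
    case False
    define N where "N = p^2 - q^2 * s^2"
    have N: "N \<in> F" unfolding N_def using subring_power[OF FR] subring_diff[OF FR] subring_mult[OF FR] pq s by meson
    have Neq: "N = x * (p - q * s)" by (simp add: N_def pq power2_eq_square algebra_simps)
    have "p - q * s \<noteq> 0"
    proof
      assume "p - q * s = 0"
      then have "p + (- q) * s = 0 + 0 * s" by simp
      then have "p = 0" "- q = 0"
        using quadratic_unique[OF F False, of p "- q" 0 0] pq FR by (auto intro: subring_CD)
      then show False using x pq by simp
    qed
    then have "N \<noteq> 0" using Neq x by simp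
    have "inverse x = p / N + (- q / N) * s"
      using Neq \<open>N \<noteq> 0\<close> x(2) by (simp add: field_simps)
    moreover have "p / N \<in> F" "- q / N \<in> F"
      using pq N subfield_divide[OF F] subring_uminus[OF FR] by blast+
    ultimately show ?thesis using adjoinI_quadratic[OF FR] by metis
  qed
qed

subsection \<open>Odd prime degree Kummer extensions\<close>

text \<open>Irreducibility of \<open>X^q - \<beta>^q\<close>. The roots of a monic annihilator of
  least degree \<open>d\<close> are multiples of \<open>\<beta>\<close> by roots of unity in
  \<open>F\<close>, so its constant term shows \<open>\<beta>^d \<in> F\<close>. As \<open>d\<close>
  is prime to \<open>q\<close>, Bezout gives \<open>\<beta> \<in> F\<close>.\<close>

lemma kummer_power_mem:
  assumes F: "subfield_C F" and q: "prime q" and b: "\<beta>^q \<in> F" "\<beta> \<noteq> 0" "\<beta> \<notin> F"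
    and roots: "\<And>z. z^q = 1 \<Longrightarrow> z \<in> F"
  shows "poly_over F p \<Longrightarrow> poly p \<beta> = 0 \<Longrightarrow> degree p < q \<Longrightarrow> p = 0"
proof (rule ccontr)
  note FR = subfield_subring[OF F]
  define P where "P = (\<lambda>p. poly_over F p \<and> p \<noteq> 0 \<and> poly p \<beta> = 0)"
  assume "poly_over F p" "poly p \<beta> = 0" "degree p < q" "p \<noteq> 0"
  then have "P p" by (simp add: P_def)
  define g0 where "g0 = (ARG_MIN degree p. P p)"
  have g0: "P g0" "\<And>p. P p \<Longrightarrow> degree g0 \<le> degree p"
    unfolding g0_def using arg_min_nat_lemma[of P p degree] \<open>P p\<close> by auto
  define g where "g = smult (inverse (lead_coeff g0)) g0"
  have lc: "lead_coeff g0 \<noteq> 0" using g0 by (auto simp: P_def)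
  have g: "poly_over F g" "lead_coeff g = 1" "poly g \<beta> = 0" "degree g = degree g0"
    using g0(1) lc poly_over_smult[OF FR subfield_inverse[OF F poly_over_coeff]]
    by (auto simp: P_def g_def)
  have gpos: "degree g > 0" using monic_root_degree_pos[OF g(2,3)] .
  have gq: "degree g < q" using g0(2)[OF \<open>P p\<close>] g(4) \<open>degree p < q\<close> by simp
  let ?X = "monom 1 q - [:\<beta>^q:]"
  have "poly_over F ?X" using b FR by (intro poly_over_diff poly_over_monom poly_over_const subring_one)
  then obtain k r where kr: "poly_over F k" "poly_over F r" "?X = g * k + r" "degree r < degree g"
    using poly_division_monic[OF FR g(1,2) gpos] by blast
  have "poly r \<beta> = 0" using arg_cong[OF kr(3), of "\<lambda>p. poly p \<beta>"] g(3) by (simp add: poly_monom)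
  then have "r = 0" using g0(2)[of r] kr g(4) by (auto simp: P_def)
  have root: "z / \<beta> \<in> F" if "poly g z = 0" for z
  proof -
    have "z^q = \<beta>^q" using arg_cong[OF kr(3), of "\<lambda>p. poly p z"] that \<open>r = 0\<close> by (simp add: poly_monom)
    then show ?thesis using b by (intro roots) (simp add: power_divide)
  qed
  have g_nz: "g \<noteq> 0" using g by auto
  define Z where "Z = {z. poly g z = 0}"
  have fin: "finite Z" using poly_roots_finite[OF g_nz] by (simp add: Z_def)
  have dec: "g = (\<Prod>z\<in>Z. [:- z, 1:] ^ order z g)"
    using complex_poly_decompose[of g] g(2) by (simp add: Z_def)
  have deg: "degree g = (\<Sum>z\<in>Z. order z g)"
    by (subst dec, subst degree_prod_eq_sum_degree) (auto simp: degree_power_eq)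
  define C where "C = (\<Prod>z\<in>Z. (- (z / \<beta>)) ^ order z g)"
  have "poly g 0 = C * \<beta> ^ degree g" unfolding C_def
    unfolding deg power_sum prod.distrib[symmetric] power_mult_distrib[symmetric]
    by (subst dec) (use b in \<open>simp add: poly_prod\<close>)
  moreover have "C \<in> F - {0}"
  proof -
    have "0 \<notin> Z"
    proof
      assume "0 \<in> Z"
      then have "?X = g * k" "poly g 0 = 0" using kr \<open>r = 0\<close> by (auto simp: Z_def)
      then have "poly ?X 0 = 0" by simp
      then show False using b prime_gt_0_nat[OF q] by (simp add: poly_monom zero_power)
    qed
    have pr: "prod f Z \<in> F - {0}" if "\<And>z. z \<in> Z \<Longrightarrow> f z \<in> F - {0}" for f :: "complex \<Rightarrow> complex"
      using fin that by (induction Z) (auto intro: subring_CD[OF FR])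
    have fac: "(- (z / \<beta>)) ^ order z g \<in> F - {0}" if "z \<in> Z" for z
      using root[of z] that \<open>0 \<notin> Z\<close> b by (auto simp: Z_def intro!: subring_power[OF FR] subring_uminus[OF FR])
    show ?thesis unfolding C_def by (rule pr[OF fac])
  qed
  moreover have "poly g 0 \<in> F" using poly_mem[OF FR g(1) subring_zero[OF FR]] .
  ultimately have bd: "\<beta> ^ degree g \<in> F"
    using subfield_divide[OF F, of "poly g 0" C] by (auto simp: field_simps)
  have "\<not> q dvd degree g" using gpos gq by (simp add: nat_dvd_not_less)
  then have "gcd (degree g) q = 1" using prime_imp_coprime[OF q] by (simp add: gcd.commute)
  then obtain u v where "degree g * u = q * v + 1" using bezout_nat[of "degree g" q] gpos by auto
  then have "\<beta> * (\<beta>^q)^v = (\<beta> ^ degree g)^u" by (simp add: power_mult[symmetric] power_add)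
  then have "\<beta> = (\<beta> ^ degree g)^u / (\<beta>^q)^v" using b by (simp add: field_simps)
  moreover have "(\<beta> ^ degree g)^u / (\<beta>^q)^v \<in> F"
    using subfield_divide[OF F subring_power[OF FR bd, of u] subring_power[OF FR b(1), of v]] .
  ultimately show False using b(3) by metis
qed

text \<open>A Kummer extension of odd prime degree has no quadratic subfield. If
  \<open>\<beta> \<notin> F(s)\<close>, the powers of \<open>\<beta>\<close> below \<open>q\<close>
  stay independent over \<open>F(s)\<close>, and the expansion of \<open>s\<close> in them is
  constant. If \<open>\<beta> \<in> F(s)\<close>, its conjugate is \<open>\<rho> * \<beta>\<close>
  with \<open>\<rho>^q = 1\<close>, and comparing the coordinates at \<open>s\<close> gives
  \<open>\<rho> = - 1\<close>, impossible for odd \<open>q\<close>.\<close>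

lemma kummer_descent:
  assumes F: "subfield_C F" and q: "prime q" "odd q" and b: "\<beta>^q \<in> F" "\<beta> \<noteq> 0"
    and roots: "\<And>z. z^q = 1 \<Longrightarrow> z \<in> F"
    and s: "s^2 \<in> F" "s \<in> adjoin F \<beta>"
  shows "s \<in> F"
proof (rule ccontr)
  note FR = subfield_subring[OF F]
  assume sF: "s \<notin> F"
  let ?F' = "adjoin F s"
  have F': "subfield_C ?F'" using subfield_adjoin_quadratic[OF F s(1)] .
  note F'R = subfield_subring[OF F']
  have FF': "F \<subseteq> ?F'" using adjoin_subset[OF FR] .
  let ?X = "monom 1 q - [:\<beta>^q:]"
  have Xd: "degree ?X = q" "lead_coeff ?X = 1"
  proof -
    have "degree [:\<beta>^q:] < degree (monom 1 q :: complex poly)" using prime_gt_0_nat[OF q(1)] by (simp add: degree_monom_eq)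
    then show "degree ?X = q"
      using degree_add_eq_left[of "- [:\<beta>^q:]" "monom 1 q"] degree_minus[of "[:\<beta>^q:]"]
      unfolding diff_conv_add_uminus by (simp only: degree_monom_eq[OF one_neq_zero])
    then show "lead_coeff ?X = 1" using prime_gt_0_nat[OF q(1)] by (cases q) auto
  qed
  show False
  proof (cases "\<beta> \<in> ?F'")
    case False
    have "poly_over F ?X" using b FR by (intro poly_over_diff poly_over_monom poly_over_const subring_one)
    then obtain r where r: "poly_over F r" "degree r < q" "s = poly r \<beta>"
      using adjoin_low_degree[OF FR _ Xd(2) _ s(2)] Xd(1) by (auto simp: poly_monom)
    have "r - [:s:] = 0"
    proof (rule kummer_power_mem[OF F' q(1) _ b(2) False])
      show "\<beta>^q \<in> ?F'" using b FF' by blast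
      show "z \<in> ?F'" if "z^q = 1" for z using roots[OF that] FF' by blast
      show "poly_over ?F' (r - [:s:])"
        using poly_over_mono[OF r(1) FF'] adjoin_self[OF FR] by (intro poly_over_diff[OF F'R] poly_over_const[OF F'R])
      show "degree (r - [:s:]) < q" using r(2) prime_gt_0_nat[OF q(1)] by (intro degree_diff_less) auto
    qed (use r in simp)
    then have "coeff r 0 = s" by simp
    then show False using poly_over_coeff[OF r(1), of 0] sF by simp
  next
    case True
    then obtain p w where pw: "p \<in> F" "w \<in> F" "\<beta> = p + w * s" using adjoin_quadratic[OF FR s(1)] by blast
    \<comment> \<open>All that is needed of the automorphism \<open>s \<mapsto> - s\<close>: powers
      of conjugate elements are conjugate.\<close>
    have conj: "\<exists>P\<in>F. \<exists>W\<in>F. (p + w * s)^n = P + W * s \<and> (p - w * s)^n = P - W * s" for n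
    proof (induction n)
      case 0
      show ?case using subring_one[OF FR] subring_zero[OF FR] by (intro bexI[of _ 1] bexI[of _ 0]) auto
    next
      case (Suc n)
      then obtain P W where PW: "P \<in> F" "W \<in> F" "(p + w * s)^n = P + W * s" "(p - w * s)^n = P - W * s" by blast
      have "p * P + w * W * s^2 \<in> F" "p * W + w * P \<in> F"
        using PW(1,2) pw(1,2) s(1) subring_add[OF FR] subring_mult[OF FR] by simp_all
      moreover have "(p + w * s)^Suc n = p * P + w * W * s^2 + (p * W + w * P) * s"
        unfolding power_Suc PW(3) by (simp add: algebra_simps power2_eq_square)
      moreover have "(p - w * s)^Suc n = p * P + w * W * s^2 - (p * W + w * P) * s"
        unfolding power_Suc PW(4) by (simp add: algebra_simps power2_eq_square)
      ultimately show ?case by blast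
    qed
    obtain P W where PW: "P \<in> F" "W \<in> F" "(p + w * s)^q = P + W * s" "(p - w * s)^q = P - W * s"
      using conj[of q] by blast
    have "P + W * s = \<beta>^q + 0 * s" using PW(3) pw(3) by simp
    then have "W = 0" using quadratic_unique(2)[OF F sF PW(1,2) b(1) subring_zero[OF FR]] by blast
    then have eq: "(p - w * s)^q = \<beta>^q" using PW pw(3) by simp
    define \<rho> where "\<rho> = (p - w * s) / \<beta>"
    have r1: "\<rho>^q = 1" using eq b by (simp add: \<rho>_def power_divide)
    then have rF: "\<rho> \<in> F" using roots by blast
    have "p + (- w) * s = \<rho> * p + \<rho> * w * s"
    proof -
      have "p - w * s = \<rho> * \<beta>" using b(2) by (simp add: \<rho>_def)
      then show ?thesis unfolding pw(3) by (simp add: algebra_simps)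
    qed
    then have "- w = \<rho> * w"
      using quadratic_unique(2)[OF F sF pw(1) subring_uminus[OF FR pw(2)] subring_mult[OF FR rF pw(1)]
        subring_mult[OF FR rF pw(2)]] by simp
    have w: "w \<noteq> 0"
    proof
      assume "w = 0"
      then have "adjoin F \<beta> \<subseteq> F" using pw by (intro adjoin_least[OF FR]) auto
      then show False using s sF by blast
    qed
    have "(- 1) * w = \<rho> * w" using \<open>- w = \<rho> * w\<close> by simp
    then have "\<rho> = - 1" using w unfolding mult_cancel_right by simp
    then show False using r1 q(2) by simp
  qed
qed

section \<open>Valuations of number fields\<close>

lemma clear_denominators:
  "poly_over \<rat> p \<Longrightarrow> \<exists>N>0. poly_over \<int> (smult (of_nat N) p)"
proof (induction p)
  case 0
  then show ?case by (intro exI[of _ 1]) (auto simp: poly_over_def)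
next
  case (pCons a p)
  have "poly_over \<rat> p"
    unfolding poly_over_def
  proof
    fix i show "coeff p i \<in> \<rat>" using poly_over_coeff[OF pCons.prems, of "Suc i"] by simp
  qed
  then obtain N where N: "N > 0" "poly_over \<int> (smult (of_nat N) p)" using pCons.IH by blast
  have "a \<in> \<rat>" using poly_over_coeff[OF pCons.prems, of 0] by simp
  then obtain u v :: int where uv: "v > 0" "a = of_int u / of_int v" by (auto elim: Rats_cases')
  have "poly_over \<int> (smult (of_nat (nat v * N)) (pCons a p))"
    unfolding poly_over_def
  proof
    fix i
    show "coeff (smult (of_nat (nat v * N)) (pCons a p)) i \<in> \<int>"
    proof (cases i)
      case 0
      have "coeff (smult (of_nat (nat v * N)) (pCons a p)) i = of_nat N * of_int u"
        using uv 0 by (simp add: field_simps)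
      then show ?thesis by simp
    next
      case (Suc j)
      have "coeff (smult (of_nat (nat v * N)) (pCons a p)) i = of_nat (nat v) * coeff (smult (of_nat N) p) j"
        using Suc by simp
      then show ?thesis using poly_over_coeff[OF N(2), of j] by (simp only: Ints_mult Ints_of_nat)
    qed
  qed
  then show ?case using N uv by (intro exI[of _ "nat v * N"]) auto
qed

lemma algebraic_integer_poly:
  assumes "algebraic_number y" "y \<noteq> 0"
  obtains p where "poly_over \<int> p" "coeff p 0 \<noteq> 0" "poly p y = 0"
proof -
  obtain q where q: "poly_over \<rat> q" "coeff q 0 \<noteq> 0" "poly q y = 0"
    using assms poly_nonzero_const unfolding algebraic_number_def by blast
  obtain N where "N > 0" "poly_over \<int> (smult (of_nat N) q)" using clear_denominators[OF q(1)] by blast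
  then show ?thesis using q by (intro that[of "smult (of_nat N) q"]) auto
qed

context valuation_ring
begin

lemma Ints_subset: "\<int> \<subseteq> V"
  by (auto elim: Ints_cases)

lemma integral_mem:
  assumes "poly_over V f" "lead_coeff f = 1" "poly f x = 0"
  shows "x \<in> V"
proof (rule ccontr)
  assume "x \<notin> V"
  then have x: "vlt 1 x" by (auto simp: vlt_def vle_one_iff)
  then have x0: "x \<noteq> 0" by auto
  define n where "n = degree f"
  have "vlt (coeff f i * x ^ i) (x ^ n)" if "i < n" for i
  proof -
    have "vlt (1 * x ^ i) (x ^ (n - i) * x ^ i)"
      using vlt_power[OF x, of "n - i"] that x0 by (intro vlt_mult) auto
    then have "vlt (x ^ i) (x ^ n)" using that by (simp add: power_add[symmetric])
    then show ?thesis using vlt_mult_left poly_over_coeff[OF assms(1)] by blast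
  qed
  then have "vlt (\<Sum>i<n. coeff f i * x ^ i) (x ^ n)" using x0 by (intro vlt_sum) auto
  moreover have "(\<Sum>i<n. coeff f i * x ^ i) = - (x ^ n)"
    using assms(2,3) unfolding poly_altdef n_def
    by (simp add: lessThan_Suc_atMost[symmetric] eq_neg_iff_add_eq_0)
  ultimately show False by simp
qed

end

locale residue_char = valuation_ring +
  fixes q :: nat
  assumes q_prime: "prime q" and q_small: "vlt (of_nat q) 1"
begin

lemma q_nonzero: "(of_nat q :: complex) \<noteq> 0"
  using prime_gt_0_nat[OF q_prime] by simp

lemma coprime_unit: "\<not> int q dvd n \<Longrightarrow> veq (of_int n) 1"
proof (rule ccontr)
  assume n: "\<not> int q dvd n" and "\<not> veq (of_int n) 1"
  then have lt: "vlt (of_int n) 1" by (simp add: veq_one_iff)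
  have "coprime (int q) n" using n q_prime by (intro prime_imp_coprime) auto
  then obtain u v where "u * int q + v * n = 1" using bezout_int[of "int q" n] by auto
  then have "of_int u * of_nat q + of_int v * of_int n = (1 :: complex)"
    by (metis of_int_1 of_int_add of_int_mult of_int_of_nat_eq)
  moreover have "vlt (of_int u * of_nat q + of_int v * of_int n) 1"
    using lt q_small by (intro vlt_add vlt_mult_left) auto
  ultimately show False by simp
qed

lemma coprime_unit_nat: "\<not> q dvd n \<Longrightarrow> veq (of_nat n) 1"
  using coprime_unit[of "int n"] by simp

lemma int_veq_power: "n \<noteq> 0 \<Longrightarrow> \<exists>k. veq (of_int n) (of_nat q ^ k)"
proof -
  assume n: "n \<noteq> 0"
  obtain m where m: "n = int q ^ multiplicity (int q) n * m" "\<not> int q dvd m"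
    using multiplicity_decompose'[of n "int q"] n prime_gt_1_nat[OF q_prime] by auto
  have "veq (of_nat q ^ multiplicity (int q) n * of_int m) (of_nat q ^ multiplicity (int q) n * 1)"
    using coprime_unit[OF m(2)] by (intro veq_mult) auto
  then show ?thesis by (subst m(1)) auto
qed

lemma Rats_veq_powi: "c \<in> \<rat> \<Longrightarrow> c \<noteq> 0 \<Longrightarrow> \<exists>k. veq c (of_nat q powi k)"
proof -
  assume "c \<in> \<rat>" "c \<noteq> 0"
  obtain a b where ab': "b > 0" "c = of_int a / of_int b" using \<open>c \<in> \<rat>\<close> by (rule Rats_cases')
  then have ab: "a \<noteq> 0" "b \<noteq> 0" "c = of_int a / of_int b" using \<open>c \<noteq> 0\<close> by auto
  obtain k l where kl: "veq (of_int a) (of_nat q ^ k)" "veq (of_int b) (of_nat q ^ l)"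
    using int_veq_power ab by blast
  have "veq (of_int a * inverse (of_int b)) (of_nat q ^ k * inverse (of_nat q ^ l))"
    using kl by (intro veq_mult veq_inverse)
  moreover have "of_nat q ^ k * inverse (of_nat q ^ l :: complex) = of_nat q powi (int k - int l)"
    using q_nonzero by (simp add: power_int_diff divide_inverse)
  ultimately show ?thesis unfolding ab(3) divide_inverse by metis
qed

lemma powi_small:
  assumes "veq x (of_nat q powi k)" "vlt x 1" shows "vle x (of_nat q)"
proof -
  have "k > 0"
  proof (rule ccontr)
    assume "\<not> k > 0"
    then have "of_nat q powi k = inverse (of_nat q ^ nat (- k) :: complex)"
      by (cases "k = 0") (auto simp: power_int_def power_inverse)
    moreover have "vle (inverse 1) (inverse (of_nat q ^ nat (- k)))"
      using q_nonzero power_mem[of "of_nat q"] by (intro vle_inverse) (auto simp: vle_one_iff)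
    ultimately show False using assms veq_vlt1[OF assms(1)] by (simp add: vlt_def)
  qed
  then obtain m where "k = 1 + int m" by (auto dest!: zero_less_imp_eq_int simp: gr0_conv_Suc)
  then have "of_nat q powi k = of_nat q * (of_nat q ^ m :: complex)"
    using q_nonzero by (simp add: power_int_add)
  then show ?thesis
    using assms(1) veq_vle1[OF assms(1)] vle_mult_right[of "of_nat q" "of_nat q" "of_nat q ^ m"] power_mem[of "of_nat q" m] by simp
qed

text \<open>\<open>V\<close> may have nonzero elements below every power of \<open>q\<close>, but
  none of them is algebraic: for \<open>y \<in> V\<close> the constant term of an integer equation
  is a multiple of \<open>y\<close>, and its value is that of a power of \<open>q\<close>.\<close>

lemma algebraic_archimedean:
  assumes "algebraic_number y" "y \<noteq> 0" shows "\<exists>j. vlt (of_nat q ^ j) y"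
proof (cases "y \<in> V")
  case True
  obtain p where p: "poly_over \<int> p" "coeff p 0 \<noteq> 0" "poly p y = 0"
    using algebraic_integer_poly[OF assms] .
  obtain a r where r: "p = pCons a r" by (cases p)
  have "a \<in> \<int>" using poly_over_coeff[OF p(1), of 0] r by simp
  then obtain n where n: "a = of_int n" "n \<noteq> 0" using p(2) r by (auto elim!: Ints_cases)
  have "poly_over V r"
    unfolding poly_over_def
  proof
    fix i show "coeff r i \<in> V" using poly_over_coeff[OF p(1), of "Suc i"] r Ints_subset by auto
  qed
  then have "poly r y \<in> V" using poly_mem[OF subring _ True] by blast
  then have "vle (y * - poly r y) y" by (intro vle_mult_right uminus_mem) auto
  moreover have "a = y * - poly r y" using p(3) r by (simp add: add_eq_0_iff)
  ultimately have "vle (of_int n) y" using n by simp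
  moreover obtain k where "veq (of_int n) (of_nat q ^ k)" using int_veq_power[OF n(2)] by blast
  ultimately have "vle (of_nat q ^ k) y" using veq_vle1 by blast
  moreover have "vlt (of_nat q * of_nat q ^ k) (1 * of_nat q ^ k)"
    using q_small q_nonzero by (intro vlt_mult) auto
  ultimately show ?thesis using vlt_vle_trans by (intro exI[of _ "Suc k"]) auto
next
  case False
  then show ?thesis by (intro exI[of _ 0]) (auto simp: vlt_def vle_one_iff)
qed

text \<open>In a rational equation for \<open>g\<close> two terms have the same value, so some
  \<open>g ^ (k - j)\<close> has the value of a rational number, that is of a power of
  \<open>q\<close>. The exponents are bounded by the size of a spanning set, which makes
  \<open>n\<close> uniform: a bound for the ramification index.\<close>

lemma nonunit_power:
  assumes "number_field F"
  shows "\<exists>n>0. \<forall>g\<in>F. vlt g 1 \<longrightarrow> vle (g ^ n) (of_nat q)"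
proof -
  obtain B where B: "finite B" "F \<subseteq> Q.span B" using number_field_span[OF assms] .
  have "vle (g ^ Suc (card B)) (of_nat q)" if g: "g \<in> F" "vlt g 1" for g
  proof (cases "g = 0")
    case False
    have "g ^ i \<in> Q.span B" for i
      using subring_power[OF number_field_subring[OF assms] g(1)] B(2) by blast
    then obtain p where p: "poly_over \<rat> p" "p \<noteq> 0" "degree p \<le> card B" "poly p g = 0"
      using power_dependence[OF B(1)] by blast
    let ?f = "\<lambda>i. coeff p i * g ^ i"
    obtain j k where jk: "j \<le> degree p" "k \<le> degree p" "j \<noteq> k" "?f j \<noteq> 0" "veq (?f j) (?f k)"
    proof (rule dominant_twice[of "{..degree p}" ?f "degree p"])
      show "(\<Sum>i\<le>degree p. coeff p i * g ^ i) = 0" using p(4) by (simp add: poly_altdef)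
    qed (use p False in auto)
    have key: "vle (g ^ Suc (card B)) (of_nat q)"
      if "j < k" "k \<le> degree p" "coeff p j \<noteq> 0" "coeff p k \<noteq> 0" "veq (?f j) (?f k)" for j k
    proof -
      have "g ^ k = g ^ j * g ^ (k - j)" using that by (simp add: power_add[symmetric])
      then have "veq ((coeff p k * g ^ j) * (coeff p j / coeff p k)) ((coeff p k * g ^ j) * g ^ (k - j))"
        using that by (simp add: mult_ac)
      then have eq: "veq (coeff p j / coeff p k) (g ^ (k - j))"
        using that False by (subst (asm) veq_cancel) auto
      have "coeff p j / coeff p k \<in> \<rat>" "coeff p j / coeff p k \<noteq> 0"
        using that(3,4) poly_over_coeff[OF p(1)] by auto
      then obtain t where "veq (coeff p j / coeff p k) (of_nat q powi t)" using Rats_veq_powi by blast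
      then have "veq (g ^ (k - j)) (of_nat q powi t)" using eq veq_trans veq_sym by blast
      moreover have "vlt (g ^ (k - j)) 1" using vlt_power[OF g(2), of "k - j"] that by simp
      ultimately have 1: "vle (g ^ (k - j)) (of_nat q)" using powi_small by blast
      have "Suc (card B) = (k - j) + (Suc (card B) - (k - j))" using that p(3) by simp
      then have "g ^ Suc (card B) = g ^ (k - j) * g ^ (Suc (card B) - (k - j))" by (metis power_add)
      then show ?thesis using 1 vle_mult_right power_mem vlt_one_mem[OF g(2)] by simp
    qed
    have "coeff p j \<noteq> 0" using jk(4) by simp
    moreover have "?f k \<noteq> 0" using jk(4,5) veq_zero_iff by metis
    ultimately have "coeff p j \<noteq> 0" "coeff p k \<noteq> 0" by auto
    then show ?thesis using key[of j k] key[of k j] jk veq_sym False by (cases "j < k") auto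
  qed auto
  then show ?thesis by blast
qed

text \<open>Without a largest nonunit there is a growing sequence of nonunits. Each quotient of
  neighbours is a nonunit, so by \<open>nonunit_power\<close> each step enlarges the
  \<open>n\<close>-th power by at least the factor \<open>1/q\<close>. Starting at \<open>q\<close>,
  after \<open>n\<close> steps the \<open>n\<close>-th power would have reached 1.\<close>

lemma uniformizer:
  assumes F: "number_field F"
  shows "\<exists>p\<in>F. p \<noteq> 0 \<and> vlt p 1 \<and> (\<forall>x\<in>F. vlt x 1 \<longrightarrow> vle x p)"
proof (rule ccontr)
  note FR = number_field_subring[OF F] and FF = number_field_subfield[OF F]
  assume contr: "\<not> ?thesis"
  then have next_elt: "\<exists>x\<in>F. vlt x 1 \<and> vlt p x" if "p \<in> F" "p \<noteq> 0" "vlt p 1" for p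
    using that contr not_vle by blast
  obtain n where n: "n > 0" "\<And>g. g \<in> F \<Longrightarrow> vlt g 1 \<Longrightarrow> vle (g ^ n) (of_nat q)"
    using nonunit_power[OF F] by blast
  have "\<exists>p\<in>F. p \<noteq> 0 \<and> vlt p 1 \<and> vle (of_nat q ^ n) (p ^ n * of_nat q ^ j)" for j
  proof (induction j)
    case 0
    show ?case using subring_of_nat[OF FR] q_small q_nonzero by (intro bexI[of _ "of_nat q"]) auto
  next
    case (Suc j)
    then obtain p where p: "p \<in> F" "p \<noteq> 0" "vlt p 1" "vle (of_nat q ^ n) (p ^ n * of_nat q ^ j)" by blast
    obtain x where x: "x \<in> F" "vlt x 1" "vlt p x" using next_elt[OF p(1-3)] by blast
    have x0: "x \<noteq> 0" using x(3) by auto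
    have "vlt (p / x) 1" using x(3) vlt_iff_divide[OF x0] by blast
    then have "vle ((p / x) ^ n) (of_nat q)" using n(2) subfield_divide[OF FF p(1) x(1)] by blast
    then have "vle (p ^ n) (x ^ n * of_nat q)" using x0 by (simp add: power_divide vle_divide_iff)
    then have "vle (p ^ n * of_nat q ^ j) (x ^ n * of_nat q * of_nat q ^ j)" by (intro vle_mult) auto
    then have "vle (of_nat q ^ n) (x ^ n * of_nat q ^ Suc j)" using p(4) vle_trans by (simp add: mult_ac)
    then show ?case using x x0 by blast
  qed
  from this[of n] obtain p where p: "p \<noteq> 0" "vlt p 1" "vle (of_nat q ^ n) (p ^ n * of_nat q ^ n)" by blast
  have "vlt (p ^ n * of_nat q ^ n) (1 * of_nat q ^ n)"
    using vlt_power[OF p(2) n(1)] q_nonzero by (intro vlt_mult) auto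
  then show False using p(3) by (simp add: vlt_def)
qed

lemma scale_into_ring:
  assumes "number_field F" "poly_over F p"
  shows "\<exists>N. poly_over V (smult (of_nat q ^ N) p)"
  using assms(2)
proof (induction p)
  case 0
  then show ?case using zero_mem by (auto simp: poly_over_def)
next
  case (pCons a p)
  have "poly_over F p"
    unfolding poly_over_def
  proof
    fix i show "coeff p i \<in> F" using poly_over_coeff[OF pCons.prems, of "Suc i"] by simp
  qed
  then obtain N where N: "poly_over V (smult (of_nat q ^ N) p)" using pCons.IH by blast
  have aF: "a \<in> F" using poly_over_coeff[OF pCons.prems, of 0] by simp
  obtain M where M: "of_nat q ^ M * a \<in> V"
  proof (cases "a = 0")
    case True
    then show ?thesis using that zero_mem by auto
  next
    case False
    have "algebraic_number (inverse a)"
      using number_field_algebraic[OF assms(1)] subfield_inverse[OF number_field_subfield[OF assms(1)] aF] by blast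
    then obtain j where "vlt (of_nat q ^ j) (inverse a)"
      using algebraic_archimedean[of "inverse a"] False by auto
    then have "vle (of_nat q ^ j * a) (inverse a * a)" using vlt_imp_vle by (intro vle_mult) auto
    then show ?thesis using that[of j] False by (simp add: vle_one_iff)
  qed
  have "poly_over V (smult (of_nat q ^ (M + N)) (pCons a p))"
    unfolding poly_over_def
  proof
    fix i
    show "coeff (smult (of_nat q ^ (M + N)) (pCons a p)) i \<in> V"
    proof (cases i)
      case 0
      have "coeff (smult (of_nat q ^ (M + N)) (pCons a p)) i = of_nat q ^ N * (of_nat q ^ M * a)"
        using 0 by (simp add: power_add)
      then show ?thesis using M mult_mem power_mem of_nat_mem by metis
    next
      case (Suc j)
      have "coeff (smult (of_nat q ^ (M + N)) (pCons a p)) i = of_nat q ^ M * coeff (smult (of_nat q ^ N) p) j"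
        using Suc by (simp add: power_add)
      then show ?thesis using poly_over_coeff[OF N, of j] mult_mem power_mem of_nat_mem by metis
    qed
  qed
  then show ?case by blast
qed

text \<open>Adjoining a root of a monic integral polynomial that is separable at the root does not
  enlarge the value group: if \<open>h\<close> is a monic polynomial of least degree with \<open>\<bar>h(\<theta>)\<bar> < 1\<close>
  (a lift of the minimal polynomial in the residue field), then division of \<open>f\<close> by \<open>h\<close> shows
  that \<open>h(\<theta>)\<close> is divisible by a uniformizer of the ground field.\<close>

lemma etale_same_values:
  assumes F: "number_field F" and f: "poly_over (F \<inter> V) f" "lead_coeff f = 1" "poly f \<theta> = 0"
    and sep: "veq (poly (pderiv f) \<theta>) 1" and y: "y \<in> adjoin F \<theta>"
  shows "\<exists>c\<in>F. veq y c"
proof (cases "y = 0")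
  case True
  then show ?thesis using subring_zero[OF number_field_subring[OF F]] by auto
next
  case False
  note FR = number_field_subring[OF F] and FF = number_field_subfield[OF F]
  define R where "R = F \<inter> V"
  have OR: "subring_C R" using FR subring by (auto simp: R_def subring_C_def)
  have OV: "R \<subseteq> V" "R \<subseteq> F" by (auto simp: R_def)
  note fO = f(1)[folded R_def]
  have \<theta>: "\<theta> \<in> V" using integral_mem[OF poly_over_mono[OF fO OV(1)] f(2,3)] .
  have ev: "poly p \<theta> \<in> V" if "poly_over R p" for p
    using poly_mem[OF subring poly_over_mono[OF that OV(1)] \<theta>] .
  obtain \<pi> where \<pi>: "\<pi> \<in> F" "\<pi> \<noteq> 0" "vlt \<pi> 1" "\<And>x. x \<in> F \<Longrightarrow> vlt x 1 \<Longrightarrow> vle x \<pi>"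
    using uniformizer[OF F] by blast
  define P where "P = (\<lambda>h. poly_over R h \<and> lead_coeff h = 1 \<and> vlt (poly h \<theta>) 1)"
  have "P f" using fO f by (auto simp: P_def vlt_zero_iff)
  define h where "h = (ARG_MIN degree p. P p)"
  have h: "poly_over R h" "lead_coeff h = 1" "vlt (poly h \<theta>) 1"
    and hmin: "\<And>p. P p \<Longrightarrow> degree h \<le> degree p"
    unfolding h_def using arg_min_nat_lemma[of P f degree] \<open>P f\<close> by (auto simp: P_def)
  have hpos: "degree h > 0"
  proof (rule ccontr)
    assume "\<not> degree h > 0"
    then obtain a where "h = [:a:]" by (auto elim: degree_eq_zeroE)
    then have "poly h \<theta> = 1" using h(2) by auto
    then show False using h(3) by simp
  qed
  \<comment> \<open>Minimality of \<open>h\<close>: if the top coefficient of \<open>r\<close> were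
    a unit, normalising \<open>r\<close> would give a monic polynomial of smaller degree that is
    small at \<open>\<theta>\<close>. So the coefficients can be removed from the top.\<close>
  have small: "\<forall>i. vlt (coeff r i) 1"
    if "\<And>i. i \<ge> n \<Longrightarrow> coeff r i = 0" "poly_over R r" "vlt (poly r \<theta>) 1" "n \<le> degree h" for r n
    using that
  proof (induction n arbitrary: r)
    case 0
    then show ?case by (simp add: vlt_zero_iff)
  next
    case (Suc n)
    define c where "c = coeff r n"
    have cO: "c \<in> R" using Suc.prems poly_over_coeff by (simp add: c_def)
    show ?case
    proof (cases "vlt c 1")
      case True
      define r' where "r' = r - monom c n"
      have "\<forall>i. vlt (coeff r' i) 1"
      proof (rule Suc.IH)
        show "coeff r' i = 0" if "i \<ge> n" for i
          using that Suc.prems(1)[of i] by (cases "i = n") (auto simp: r'_def c_def)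
        show "poly_over R r'" unfolding r'_def using Suc.prems cO
          by (intro poly_over_diff[OF OR] poly_over_monom[OF OR])
        show "vlt (poly r' \<theta>) 1"
          unfolding r'_def using Suc.prems True power_mem[OF \<theta>]
          by (auto simp: poly_monom intro!: vlt_diff vlt_mult_right)
      qed (use Suc.prems in simp)
      moreover have "coeff r i = (if i = n then c else coeff r' i)" for i
        by (simp add: r'_def c_def)
      ultimately show ?thesis using True by simp
    next
      case False
      then have c0: "c \<noteq> 0" "vle 1 c" by (auto simp: not_vlt vlt_zero_iff)
      have "inverse c \<in> R"
        using c0 vle_inverse[of 1 c] subfield_inverse[OF FF] cO by (auto simp: R_def vle_one_iff)
      define g where "g = smult (inverse c) r"
      have "degree r = n" using c0 Suc.prems(1) by (intro antisym degree_le le_degree) (auto simp: c_def Suc_le_eq)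
      then have "degree g = n" "lead_coeff g = 1" using c0 by (auto simp: g_def c_def)
      moreover have "poly_over R g" unfolding g_def using Suc.prems \<open>inverse c \<in> R\<close>
        by (intro poly_over_smult[OF OR])
      moreover have "vlt (poly g \<theta>) 1"
        using vlt_mult_left[OF Suc.prems(3), of "inverse c"] \<open>inverse c \<in> R\<close> OV by (auto simp: g_def)
      ultimately have "degree h \<le> n" using hmin[of g] by (simp add: P_def)
      then show ?thesis using Suc.prems(4) by simp
    qed
  qed
  have divisible: "\<exists>r2. poly_over R r2 \<and> r = smult \<pi> r2"
    if r: "poly_over R r" "degree r < degree h" "vlt (poly r \<theta>) 1" for r
  proof -
    have "\<forall>i. vlt (coeff r i) 1"
      by (rule small[of "degree h"]) (use r in \<open>auto intro: coeff_eq_0\<close>)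
    then have "vle (coeff r i) \<pi>" for i using \<pi>(4) poly_over_coeff[OF r(1)] OV by blast
    then have "coeff r i / \<pi> \<in> R" for i
      using vle_iff_divide[OF \<pi>(2)] subfield_divide[OF FF _ \<pi>(1)] poly_over_coeff[OF r(1)] OV
      by (auto simp: R_def)
    then have "poly_over R (smult (inverse \<pi>) r)" by (simp add: poly_over_def divide_inverse mult.commute)
    then show ?thesis using \<pi>(2) by (intro exI[of _ "smult (inverse \<pi>) r"]) auto
  qed
  obtain k r where kr: "poly_over R k" "poly_over R r" "f = h * k + r" "degree r < degree h"
    using poly_division_monic[OF OR h(1,2) hpos fO] by blast
  have hk: "poly h \<theta> * poly k \<theta> = - poly r \<theta>"
    using arg_cong[OF kr(3), of "\<lambda>p. poly p \<theta>"] f(3) by (simp add: add_eq_0_iff)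
  have "vlt (poly r \<theta>) 1"
    using vlt_mult_right[OF h(3) ev[OF kr(1)]] unfolding hk by simp
  then obtain r2 where r2: "poly_over R r2" "r = smult \<pi> r2" using divisible[OF kr(2,4)] by blast
  \<comment> \<open>Differentiate \<open>f = h * k + \<pi> * r2\<close>. At \<open>\<theta>\<close>
    the derivative of \<open>f\<close> is a unit, while \<open>h\<close> and \<open>\<pi>\<close>
    are small, so \<open>k\<close> cannot be small. Hence \<open>h\<close> at
    \<open>\<theta>\<close> is \<open>\<pi>\<close> times an integral element.\<close>
  have k_unit: "veq (poly k \<theta>) 1"
  proof (rule ccontr)
    assume "\<not> ?thesis"
    then have "vlt (poly k \<theta>) 1" using ev[OF kr(1)] by (simp add: veq_one_iff)
    moreover have "poly (pderiv f) \<theta> = poly (pderiv h) \<theta> * poly k \<theta> + poly h \<theta> * poly (pderiv k) \<theta> + \<pi> * poly (pderiv r2) \<theta>"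
      unfolding kr(3) r2(2) by (simp add: pderiv_add pderiv_mult pderiv_smult algebra_simps)
    moreover have "vlt (poly h \<theta> * poly (pderiv k) \<theta>) 1" "vlt (\<pi> * poly (pderiv r2) \<theta>) 1"
      using h(3) \<pi>(3) ev poly_over_pderiv[OF OR] kr(1) r2(1) by (simp_all add: vlt_mult_right)
    moreover have "vlt (poly (pderiv h) \<theta> * poly k \<theta>) 1" if "vlt (poly k \<theta>) 1"
      using that ev poly_over_pderiv[OF OR] h(1) by (simp add: vlt_mult_left)
    ultimately have "vlt (poly (pderiv f) \<theta>) 1" by (simp add: vlt_add)
    then show False using sep vlt_not_veq by blast
  qed
  define k0 where "k0 = poly k \<theta>"
  \<comment> \<open>The unit \<open>k0\<close> is kept as a factor, since its inverse need not be
    the value at \<open>\<theta>\<close> of a polynomial over \<open>R\<close>.\<close>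
  have step: "\<exists>p2. poly_over R p2 \<and> k0 * poly p \<theta> = \<pi> * poly p2 \<theta>"
    if p: "poly_over R p" "vlt (poly p \<theta>) 1" for p
  proof -
    obtain k1 r1 where kr1: "poly_over R k1" "poly_over R r1" "p = h * k1 + r1" "degree r1 < degree h"
      using poly_division_monic[OF OR h(1,2) hpos p(1)] by blast
    have "poly r1 \<theta> = poly p \<theta> - poly h \<theta> * poly k1 \<theta>" using kr1(3) by simp
    then have "vlt (poly r1 \<theta>) 1" using p(2) h(3) ev[OF kr1(1)] by (auto intro!: vlt_diff vlt_mult_right)
    then obtain r3 where r3: "poly_over R r3" "r1 = smult \<pi> r3" using divisible[OF kr1(2,4)] by blast
    have "poly_over R (k * r3 - r2 * k1)"
      using kr kr1 r2 r3 by (intro poly_over_diff[OF OR] poly_over_mult[OF OR])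
    moreover have "k0 * poly p \<theta> = (poly h \<theta> * poly k \<theta>) * poly k1 \<theta> + k0 * poly r1 \<theta>"
      unfolding kr1(3) k0_def by (simp add: algebra_simps)
    then have "k0 * poly p \<theta> = \<pi> * poly (k * r3 - r2 * k1) \<theta>"
      unfolding hk r2(2) r3(2) k0_def by (simp add: algebra_simps)
    ultimately show ?thesis by blast
  qed
  \<comment> \<open>Otherwise \<open>\<pi>\<close> could be split off indefinitely, and the value
    would fall below every power of \<open>q\<close>, against
    \<open>algebraic_archimedean\<close>.\<close>
  have vals: "\<exists>j. veq (poly p \<theta>) (\<pi> ^ j)" if p: "poly_over R p" "poly p \<theta> \<noteq> 0" for p
  proof (rule ccontr)
    assume contr: "\<not> ?thesis"
    have *: "\<exists>p2. poly_over R p2 \<and> k0 ^ j * poly p \<theta> = \<pi> ^ j * poly p2 \<theta>" for j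
    proof (induction j)
      case 0
      then show ?case using p by auto
    next
      case (Suc j)
      then obtain p2 where p2: "poly_over R p2" "k0 ^ j * poly p \<theta> = \<pi> ^ j * poly p2 \<theta>" by blast
      have "veq (k0 ^ j * poly p \<theta>) (1 * poly p \<theta>)"
        using veq_power[OF k_unit, of j] unfolding k0_def by (intro veq_mult) auto
      then have 1: "veq (poly p \<theta>) (\<pi> ^ j * poly p2 \<theta>)" using p2(2) veq_sym by simp
      have "vlt (poly p2 \<theta>) 1"
      proof (rule ccontr)
        assume "\<not> ?thesis"
        then have "veq (poly p2 \<theta>) 1" using ev[OF p2(1)] by (simp add: veq_one_iff)
        then have "veq (\<pi> ^ j * poly p2 \<theta>) (\<pi> ^ j * 1)" by (intro veq_mult) auto
        then show False using contr 1 veq_trans by auto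
      qed
      then obtain p3 where p3: "poly_over R p3" "k0 * poly p2 \<theta> = \<pi> * poly p3 \<theta>" using step[OF p2(1)] by blast
      have "k0 ^ Suc j * poly p \<theta> = \<pi> ^ j * (k0 * poly p2 \<theta>)" using p2(2) by (simp add: mult_ac)
      then show ?case using p3 by (intro exI[of _ p3]) (simp add: mult_ac)
    qed
    have "number_field (adjoin F \<theta>)" using number_field_adjoin[OF F poly_over_mono[OF f(1)] f(2,3)] by auto
    then have "algebraic_number (poly p \<theta>)"
      using number_field_algebraic adjoinI[OF poly_over_mono[OF p(1) OV(2)]] by blast
    then obtain j where j: "vlt (of_nat q ^ j) (poly p \<theta>)" using algebraic_archimedean p(2) by blast
    obtain n where n: "n > 0" "\<And>g. g \<in> F \<Longrightarrow> vlt g 1 \<Longrightarrow> vle (g ^ n) (of_nat q)"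
      using nonunit_power[OF F] by blast
    obtain p2 where p2: "poly_over R p2" "k0 ^ (n * j) * poly p \<theta> = \<pi> ^ (n * j) * poly p2 \<theta>" using * by blast
    have "veq (k0 ^ (n * j) * poly p \<theta>) (1 * poly p \<theta>)"
      using veq_power[OF k_unit, of "n * j"] unfolding k0_def by (intro veq_mult) auto
    then have "vle (poly p \<theta>) (k0 ^ (n * j) * poly p \<theta>)" by (simp add: veq_def)
    also have "vle \<dots> (\<pi> ^ (n * j))" unfolding p2(2) using ev[OF p2(1)] by (intro vle_mult_right) auto
    finally (vle_trans) have "vle (poly p \<theta>) ((\<pi> ^ n) ^ j)" by (simp add: power_mult)
    moreover have "vle ((\<pi> ^ n) ^ j) (of_nat q ^ j)" using n(2)[OF \<pi>(1,3)] by (rule vle_power)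
    ultimately show False using j vle_trans unfolding vlt_def by blast
  qed
  obtain p where p: "poly_over F p" "y = poly p \<theta>" using y by (auto simp: adjoin_def)
  obtain N where N: "poly_over V (smult (of_nat q ^ N) p)" using scale_into_ring[OF F p(1)] by blast
  have "poly_over F (smult (of_nat q ^ N) p)"
    using p(1) by (intro poly_over_smult[OF FR] subring_power[OF FR] subring_of_nat[OF FR])
  then have "poly_over R (smult (of_nat q ^ N) p)" using N by (auto simp: poly_over_def R_def)
  moreover have yN: "poly (smult (of_nat q ^ N) p) \<theta> = of_nat q ^ N * y" using p by simp
  ultimately obtain j where j: "veq (of_nat q ^ N * y) (\<pi> ^ j)" using vals False q_nonzero by force
  have "veq (of_nat q ^ N * y * inverse (of_nat q ^ N)) (\<pi> ^ j * inverse (of_nat q ^ N))"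
    by (intro veq_mult j veq_refl)
  moreover have "of_nat q ^ N * y * inverse (of_nat q ^ N) = y" using q_nonzero by simp
  moreover have "\<pi> ^ j * inverse (of_nat q ^ N) \<in> F"
    by (intro subring_mult[OF FR] subring_power[OF FR] \<pi> subfield_inverse[OF FF] subring_of_nat[OF FR])
  ultimately show ?thesis by metis
qed

end

section \<open>Unramified primes\<close>

context residue_char
begin

text \<open>Refers only to the place of \<open>F\<close> under \<open>V\<close>: its value group is
  that of Q, with \<open>q\<close> as uniformizer.\<close>

definition unramified :: "complex set \<Rightarrow> bool" where
  "unramified F \<longleftrightarrow> (\<forall>x\<in>F. x \<noteq> 0 \<longrightarrow> (\<exists>k. veq x (of_nat q powi k)))"

lemma unramified_Rats: "unramified \<rat>"
  unfolding unramified_def using Rats_veq_powi by blast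

lemma unramified_subset: "unramified F \<Longrightarrow> E \<subseteq> F \<Longrightarrow> unramified E"
  unfolding unramified_def by blast

lemma unramified_etale:
  assumes "number_field F" "poly_over (F \<inter> V) f" "lead_coeff f = 1" "poly f \<theta> = 0"
    and "veq (poly (pderiv f) \<theta>) 1" "unramified F"
  shows "unramified (adjoin F \<theta>)"
  unfolding unramified_def
proof (intro ballI impI)
  fix y assume y: "y \<in> adjoin F \<theta>" "y \<noteq> 0"
  obtain c where c: "c \<in> F" "veq y c" using etale_same_values[OF assms(1-5) y(1)] by blast
  then have "c \<noteq> 0" using y(2) by auto
  then obtain k where "veq c (of_nat q powi k)" using assms(6) c(1) unfolding unramified_def by blast
  then show "\<exists>k. veq y (of_nat q powi k)" using c(2) veq_trans by blast
qed

section \<open>Roots of unity: no ramification for order prime to \<open>q\<close>, total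
  ramification for order \<open>q\<close>\<close>

lemma root_of_unity_unit:
  assumes "x ^ M = 1" "M > 0" shows "veq x 1"
proof -
  have "veq (x ^ M) (1 ^ M)" using assms(1) by simp
  then show ?thesis using veq_power_iff[OF assms(2)] by blast
qed

text \<open>\<open>X^M - 1\<close> is separable at \<open>V\<close>, because its derivative takes
  the value of \<open>M\<close>, a unit, at roots of unity.\<close>

lemma unramified_root_of_unity:
  assumes F: "number_field F" "unramified F" and z: "\<zeta> ^ M = 1" "M > 0" "\<not> q dvd M"
  shows "unramified (adjoin F \<zeta>)"
proof (rule unramified_etale[OF F(1) _ _ _ _ F(2)])
  let ?f = "monom 1 M - 1 :: complex poly"
  have "subring_C (F \<inter> V)" using number_field_subring[OF F(1)] subring by (auto simp: subring_C_def)
  then show "poly_over (F \<inter> V) ?f"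
    by (intro poly_over_diff poly_over_monom poly_over_1 subring_one)
  have "degree ?f \<le> M" by (intro degree_diff_le degree_monom_le) auto
  moreover have "coeff ?f M = 1" using z(2) by (cases M) auto
  ultimately show "lead_coeff ?f = 1" using le_degree[of ?f M] by (metis le_antisym zero_neq_one)
  show "poly ?f \<zeta> = 0" using z by (simp add: poly_monom)
  have "poly (pderiv ?f) \<zeta> = of_nat M * \<zeta> ^ (M - 1)"
    by (simp add: pderiv_diff pderiv_monom poly_monom)
  moreover have "veq (of_nat M * \<zeta> ^ (M - 1)) (1 * 1 ^ (M - 1))"
    by (intro veq_mult veq_power coprime_unit_nat root_of_unity_unit[OF z(1,2)] z(3))
  ultimately show "veq (poly (pderiv ?f) \<zeta>) 1" by simp
qed

lemma unramified_nonunit: "unramified F \<Longrightarrow> x \<in> F \<Longrightarrow> vlt x 1 \<Longrightarrow> vle x (of_nat q)"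
proof (cases "x = 0")
  case False
  assume "unramified F" "x \<in> F" "vlt x 1"
  then show ?thesis using powi_small False unfolding unramified_def by blast
qed simp

lemma q_powi_inj: "veq (of_nat q powi a) (of_nat q powi b) \<Longrightarrow> a = b"
proof -
  have "a \<le> b" if "veq (of_nat q powi a) (of_nat q powi b)" for a b
  proof (rule ccontr)
    assume "\<not> a \<le> b"
    then obtain m where m: "a = b + 1 + int m" by (metis add.assoc add.commute le_cases not_le zle_iff_zadd zless_imp_add1_zle)
    have "of_nat q powi a = of_nat q * (of_nat q ^ m * (of_nat q powi b :: complex))"
      unfolding m using q_nonzero by (simp add: power_int_add)
    moreover have "vlt (of_nat q * (of_nat q ^ m * of_nat q powi b)) (1 * of_nat q powi b)"
      using q_small q_nonzero power_mem[of "of_nat q"] by (intro vlt_mult vle_mult_left) auto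
    ultimately show False using that by (simp add: vlt_def veq_def)
  qed
  then show "veq (of_nat q powi a) (of_nat q powi b) \<Longrightarrow> a = b" using veq_sym by (meson antisym)
qed

text \<open>Put \<open>p = \<zeta> - 1\<close>. The inner binomial coefficients are divisible by
  \<open>q\<close>, so \<open>(1 + p)^q = 1\<close> becomes
  \<open>p^q = - q * p * (1 + p * R)\<close> with \<open>R\<close> integral, and the last factor
  turns out to be a unit.\<close>

lemma one_minus_root_of_unity:
  assumes z: "\<zeta> ^ q = 1" "\<zeta> \<noteq> 1"
  shows "veq ((1 - \<zeta>) ^ (q - 1)) (of_nat q)"
proof -
  define p where "p = \<zeta> - 1"
  have p0: "p \<noteq> 0" using z(2) by (simp add: p_def)
  have q1: "q > 1" using prime_gt_1_nat[OF q_prime] .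
  have "\<zeta> \<in> V" using root_of_unity_unit[OF z(1)] q1 by (simp add: veq_one_iff)
  then have pV: "p \<in> V" using one_mem by (simp add: p_def diff_mem)
  define c where "c i = (of_nat ((q choose i) div q) :: complex)" for i
  have c: "of_nat (q choose i) = of_nat q * c i" if "0 < i" "i < q" for i
    using dvd_choose_prime[of i q] q_prime that by (metis c_def dvd_mult_div_cancel of_nat_mult not_gr_zero not_less_iff_gr_or_eq nat_neq_iff)
  define R where "R = (\<Sum>i\<in>{2..<q}. c i * p ^ (i - 2))"
  have RV: "R \<in> V" unfolding R_def c_def using pV by (intro sum_mem mult_mem power_mem) auto
  have "1 = (p + 1) ^ q" using z(1) by (simp add: p_def)
  also have "\<dots> = (\<Sum>i\<le>q. of_nat (q choose i) * p ^ i)" by (simp add: binomial_ring)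
  also have "{..q} = insert 0 (insert 1 (insert q {2..<q}))" using q1 by auto
  also have "(\<Sum>i\<in>\<dots>. of_nat (q choose i) * p ^ i) = 1 + of_nat q * p + p ^ q + (\<Sum>i\<in>{2..<q}. of_nat (q choose i) * p ^ i)"
    using q1 by simp
  also have "(\<Sum>i\<in>{2..<q}. of_nat (q choose i) * p ^ i) = of_nat q * p * (p * R)"
    unfolding R_def sum_distrib_left
  proof (intro sum.cong refl)
    fix i assume "i \<in> {2..<q}"
    moreover have "p ^ i = p * p * p ^ (i - 2)" if "i \<ge> 2"
      using that by (metis le_add_diff_inverse power2_eq_square power_add)
    ultimately show "of_nat (q choose i) * p ^ i = of_nat q * p * (p * (c i * p ^ (i - 2)))"
      using c[of i] by simp
  qed
  finally have "p ^ q = - (of_nat q * p * (1 + p * R))" by (simp add: algebra_simps add_eq_0_iff)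
  moreover have "p ^ q = p ^ (q - 1) * p" using q1 by (metis power_minus_mult not_less_iff_gr_or_eq less_trans zero_less_one)
  ultimately have "p ^ (q - 1) * p = - (of_nat q * (1 + p * R)) * p" by (simp add: mult_ac)
  then have eq: "p ^ (q - 1) = - (of_nat q * (1 + p * R))" using p0 unfolding mult_cancel_right by simp
  have "vle (p ^ (q - 1)) (of_nat q)"
    unfolding eq using pV RV by (simp add: vle_mult_right add_mem mult_mem one_mem)
  then have "vlt (p ^ (q - 1)) (1 ^ (q - 1))" using vle_vlt_trans q_small by simp
  then have "vlt p 1" using vlt_power_iff[of "q - 1" p 1] q1 by simp
  then have "vlt (p * R) 1" using RV by (rule vlt_mult_right)
  then have "veq (of_nat q * (1 + p * R)) (of_nat q * 1)" by (intro veq_mult veq_add) auto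
  then have "veq (p ^ (q - 1)) (of_nat q)" unfolding eq by simp
  moreover have "veq ((1 - \<zeta>) ^ (q - 1)) (p ^ (q - 1))"
    using veq_minus[of p p] by (intro veq_power) (simp add: p_def)
  ultimately show ?thesis using veq_trans by blast
qed

text \<open>The \<open>m\<close>-th power of \<open>e * \<pi> ^ i\<close> has the value of
  \<open>q\<close> to the exponent \<open>a * m + i\<close>, and \<open>i < m\<close> is recovered
  modulo \<open>m\<close>. So different powers of \<open>\<pi>\<close> lie in different classes
  modulo the values of \<open>E\<close>.\<close>

lemma eisenstein_exponent:
  assumes E: "unramified E" and \<pi>: "veq (\<pi> ^ m) (of_nat q)" and ij: "i < m" "j < m"
    and e: "e \<in> E" "e' \<in> E" "e \<noteq> 0" "e' \<noteq> 0" and eq: "veq (e * \<pi> ^ i) (e' * \<pi> ^ j)"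
  shows "i = j"
proof -
  obtain a where a: "veq e (of_nat q powi a)" using E e unfolding unramified_def by blast
  obtain b where b: "veq e' (of_nat q powi b)" using E e unfolding unramified_def by blast
  have 1: "veq ((e * \<pi> ^ i) ^ m) (of_nat q powi (a * int m + int i))" if "veq e (of_nat q powi a)" for e i a
  proof -
    have "veq (e ^ m * (\<pi> ^ m) ^ i) ((of_nat q powi a) ^ m * of_nat q ^ i)"
      using that \<pi> by (intro veq_mult veq_power)
    moreover have "(e * \<pi> ^ i) ^ m = e ^ m * (\<pi> ^ m) ^ i" by (simp add: power_mult_distrib mult.commute flip: power_mult)
    moreover have "(of_nat q powi a) ^ m * of_nat q ^ i = (of_nat q powi (a * int m + int i) :: complex)"
      using q_nonzero by (simp add: power_int_add power_int_mult)
    ultimately show ?thesis by simp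
  qed
  have "a * int m + int i = b * int m + int j"
    using 1[OF a, of i] 1[OF b, of j] veq_power[OF eq, of m] q_powi_inj veq_trans veq_sym by blast
  then have "(a * int m + int i) mod int m = (b * int m + int j) mod int m" by simp
  then show ?thesis using ij by simp
qed

lemma eisenstein_value:
  assumes E: "unramified E" and \<pi>: "veq (\<pi> ^ m) (of_nat q)" and I: "I \<subseteq> {..<m}"
    and e: "\<And>i. i \<in> I \<Longrightarrow> e i \<in> E" and nz: "(\<Sum>i\<in>I. e i * \<pi> ^ i) \<noteq> 0"
  shows "\<exists>j\<in>I. e j \<noteq> 0 \<and> veq (\<Sum>i\<in>I. e i * \<pi> ^ i) (e j * \<pi> ^ j)"
proof -
  let ?S = "\<Sum>i\<in>I. e i * \<pi> ^ i"
  have fin: "finite I" using I finite_subset by blast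
  \<comment> \<open>Minus the sum itself becomes an extra term with the free index \<open>m\<close>,
    so that \<open>dominant_twice\<close> applies. Two terms from \<open>I\<close> cannot share a
    value, hence one of the two dominant terms is the sum.\<close>
  define f where "f i = (if i = m then - ?S else e i * \<pi> ^ i)" for i
  have m: "m \<notin> I" using I by auto
  have \<pi>0: "\<pi> \<noteq> 0 \<or> m = 0" using \<pi> q_nonzero by (cases m) auto
  have "sum f I = ?S" using m by (intro sum.cong) (auto simp: f_def)
  moreover have "f m = - ?S" by (simp add: f_def)
  ultimately have "sum f (insert m I) = 0" using fin m by simp
  moreover have "f m \<noteq> 0" using nz by (simp add: f_def)
  ultimately obtain j k where jk: "j \<in> insert m I" "k \<in> insert m I" "j \<noteq> k" "f j \<noteq> 0" "veq (f j) (f k)"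
    using dominant_twice[of "insert m I" f m] fin by (metis finite_insert insertI1)
  then have fk: "f k \<noteq> 0" using veq_zero_iff by metis
  consider "j = m" "k \<in> I" | "k = m" "j \<in> I" | "j \<in> I" "k \<in> I" using jk by auto
  then show ?thesis
  proof cases
    case 1
    then show ?thesis using jk fk m by (intro bexI[of _ k]; cases "k = m") (auto simp: f_def)
  next
    case 2
    then show ?thesis using jk fk m veq_sym[OF jk(5)] by (intro bexI[of _ j]; cases "j = m") (auto simp: f_def)
  next
    case 3
    then have "j \<noteq> m" "k \<noteq> m" using m by auto
    then have "e j \<noteq> 0" "e k \<noteq> 0" "veq (e j * \<pi> ^ j) (e k * \<pi> ^ k)" using jk fk by (auto simp: f_def)
    then have "j = k" using eisenstein_exponent[OF E \<pi>, of j k "e j" "e k"] 3 I e by auto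
    then show ?thesis using jk by simp
  qed
qed

lemma poly_over_pcompose:
  "subring_C A \<Longrightarrow> poly_over A p \<Longrightarrow> poly_over A r \<Longrightarrow> poly_over A (pcompose p r)"
proof (induction p)
  case (pCons a p)
  have "poly_over A p"
    unfolding poly_over_def
  proof
    fix i show "coeff p i \<in> A" using poly_over_coeff[OF pCons.prems(2), of "Suc i"] by simp
  qed
  then have "poly_over A (pcompose p r)" using pCons by blast
  moreover have "a \<in> A" using poly_over_coeff[OF pCons.prems(2), of 0] by simp
  ultimately show ?case unfolding pcompose_pCons using pCons.prems
    by (intro poly_over_add poly_over_mult poly_over_const)
qed simp

text \<open>The extension \<open>E(\<zeta>)\<close> is totally ramified, so a square root of a unit of \<open>E\<close> in it is
  congruent to an element of \<open>E\<close>, and the difference would have a value outside the value group.\<close>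

lemma unramified_sqrt_descent:
  assumes E: "number_field E" "unramified E" and q: "odd q" and z: "\<zeta> ^ q = 1" "\<zeta> \<noteq> 1"
    and s: "s \<in> adjoin E \<zeta>" "s^2 \<in> E" "veq (s^2) 1"
  shows "s \<in> E"
proof -
  note ER = number_field_subring[OF E(1)]
  have q2: "q > 2" using prime_ge_2_nat[OF q_prime] q by (cases "q = 2") auto
  define \<pi> where "\<pi> = 1 - \<zeta>"
  have \<pi>: "veq (\<pi> ^ (q - 1)) (of_nat q)" using one_minus_root_of_unity[OF z] by (simp add: \<pi>_def)
  let ?f = "\<Sum>i<q. monom 1 i :: complex poly"
  have fc: "coeff ?f i = (if i < q then 1 else 0)" for i by (simp add: coeff_sum)
  have fd: "degree ?f = q - 1" using q2 by (intro antisym degree_le le_degree) (auto simp: fc)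
  have "poly ?f \<zeta> = 0"
    using z geometric_sum[of \<zeta> q] by (simp add: poly_sum poly_monom)
  moreover have "poly_over E ?f" using subring_one[OF ER] subring_zero[OF ER] by (auto simp: poly_over_def fc)
  moreover have "lead_coeff ?f = 1" using q2 by (simp add: fd fc)
  ultimately obtain r where r: "poly_over E r" "degree r < q - 1" "s = poly r \<zeta>"
    using adjoin_low_degree[OF ER _ _ _ s(1), of ?f] fd by metis
  \<comment> \<open>Re-expands \<open>s\<close> in powers of \<open>\<pi> = 1 - \<zeta>\<close>,
    where the values of the terms are known to differ.\<close>
  define g where "g = pcompose r [:1, - 1:]"
  have gE: "poly_over E g" unfolding g_def using r ER
    by (intro poly_over_pcompose poly_over_pCons poly_over_0 subring_one subring_uminus)
  have "degree g < q - 1" unfolding g_def using degree_pcompose_le[of r "[:1, - 1:]"] r(2) by simp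
  then have "poly g \<pi> = (\<Sum>i<q - 1. coeff g i * \<pi> ^ i)"
    unfolding poly_altdef by (intro sum.mono_neutral_left) (auto simp: coeff_eq_0)
  moreover have "poly g \<pi> = s" by (simp add: g_def \<pi>_def poly_pcompose r(3))
  ultimately have sg: "s = (\<Sum>i<q - 1. coeff g i * \<pi> ^ i)" by simp
  define e0 where "e0 = coeff g 0"
  define t where "t = (\<Sum>i\<in>{1..<q - 1}. coeff g i * \<pi> ^ i)"
  have "{..<q - 1} = insert 0 {1..<q - 1}" using q2 by auto
  then have st: "s = e0 + t" by (simp add: sg e0_def t_def)
  have s1: "veq s 1" using s(3) veq_power_iff[of 2 s 1] by simp
  have zeroE: "1 \<in> E" using subring_one[OF ER] .
  have sval: "veq s 1 \<Longrightarrow> veq e0 1"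
  proof -
    have "(\<Sum>i<q - 1. coeff g i * \<pi> ^ i) \<noteq> 0" using s1 sg by auto
    from eisenstein_value[OF E(2) \<pi> order_refl poly_over_coeff[OF gE] this]
    obtain j where j: "j < q - 1" "coeff g j \<noteq> 0" "veq s (coeff g j * \<pi> ^ j)"
      unfolding sg[symmetric] by blast
    then have eq: "veq (coeff g j * \<pi> ^ j) (1 * \<pi> ^ 0)" using veq_trans[OF veq_sym s1] by simp
    then have "j = 0" using eisenstein_exponent[OF E(2) \<pi> j(1) _ poly_over_coeff[OF gE] zeroE j(2) _ eq] q2 by simp
    then show "veq e0 1" using eq by (simp add: e0_def)
  qed
  have "t = 0"
  proof (rule ccontr)
    assume t0: "t \<noteq> 0"
    have "{1..<q - 1} \<subseteq> {..<q - 1}" by auto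
    from eisenstein_value[OF E(2) \<pi> this poly_over_coeff[OF gE] t0[unfolded t_def]]
    obtain j where j: "j \<in> {1..<q - 1}" "coeff g j \<noteq> 0" "veq t (coeff g j * \<pi> ^ j)"
      unfolding t_def by blast
    have noval: False if d: "d \<in> E" "veq t d" for d
    proof -
      have "d \<noteq> 0" using d t0 by auto
      have "veq (coeff g j * \<pi> ^ j) (d * \<pi> ^ 0)" using veq_trans[OF veq_sym[OF j(3)] d(2)] by simp
      from eisenstein_exponent[OF E(2) \<pi> _ _ poly_over_coeff[OF gE] d(1) j(2) \<open>d \<noteq> 0\<close> this]
      show False using j(1) q2 by simp
    qed
    have e01: "veq e0 1" using sval s1 .
    have "t \<in> V" using st s1 e01 diff_mem[of s e0] by (simp add: veq_one_iff)
    then have tlt: "vlt t 1" using noval[OF zeroE] by (auto simp: veq_one_iff)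
    \<comment> \<open>Here \<open>q\<close> odd enters: \<open>2 * e0 + t\<close> is a unit, so
      \<open>t\<close> has the value of \<open>s^2 - e0^2 \<in> E\<close>. But \<open>t\<close> has
      no term with \<open>\<pi> ^ 0\<close>, so no element of \<open>E\<close> has its
      value.\<close>
    have two: "veq 2 1" using coprime_unit_nat[of 2] q2 by (simp add: nat_dvd_not_less)
    have "veq (2 * e0) (1 * 1)" using two e01 by (rule veq_mult)
    then have "veq (2 * e0 + t) (2 * e0)" using tlt veq_vlt2[of "2 * e0" 1] by (intro veq_add) simp
    then have "veq (2 * e0 + t) 1" using \<open>veq (2 * e0) (1 * 1)\<close> veq_trans by simp
    then have "veq ((2 * e0 + t) * t) (1 * t)" by (intro veq_mult) auto
    moreover have "(2 * e0 + t) * t = s^2 - e0^2" by (simp add: st power2_eq_square algebra_simps)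
    moreover have "s^2 - e0^2 \<in> E" unfolding e0_def
      using subring_diff[OF ER s(2) subring_power[OF ER poly_over_coeff[OF gE]]] .
    ultimately show False using noval[of "s^2 - e0^2"] veq_sym by simp
  qed
  then show ?thesis using st poly_over_coeff[OF gE] by (simp add: e0_def)
qed

text \<open>A square root of a unit descends by \<open>unramified_sqrt_descent\<close>. If
  \<open>A^2 - 1\<close> has a pole, then so has \<open>A\<close>, and the square
  \<open>1 - 1/A^2\<close> of \<open>s / A\<close> is a unit, so \<open>s / A\<close> and hence
  \<open>s\<close> descend. What remains is that \<open>A^2 - 1\<close> is small, which in the
  unramified field \<open>E\<close> means divisible by \<open>q\<close>.\<close>

lemma sqrt_step_descent:
  assumes E: "number_field E" "unramified E" and q: "odd q" and z: "\<zeta> ^ q = 1" "\<zeta> \<noteq> 1"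
    and A: "A \<in> E" and s: "s \<in> adjoin E \<zeta>" "s^2 = A^2 - 1" "s \<notin> E"
  shows "vle (A^2 - 1) (of_nat q)"
proof -
  note ER = number_field_subring[OF E(1)] and EF = number_field_subfield[OF E(1)]
  have DE: "A^2 - 1 \<in> E" using A ER by (intro subring_diff subring_power subring_one)
  have Anz: "\<not> vlt 1 (A^2 - 1)"
  proof
    assume lt: "vlt 1 (A^2 - 1)"
    have A1: "vlt 1 A"
    proof (rule ccontr)
      assume "\<not> vlt 1 A"
      then have "A^2 - 1 \<in> V" by (intro diff_mem one_mem power_mem) (simp add: not_vlt vle_one_iff)
      then show False using lt by (simp add: vlt_def vle_one_iff)
    qed
    then have A0: "A \<noteq> 0" by auto
    have sq: "(s / A)^2 = 1 - (1 / A)^2" using s(2) A0 by (simp add: field_simps)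
    have "vlt (1 / A) 1" using A1 vlt_iff_divide[OF A0] by blast
    then have "vlt ((1 / A)^2) 1" using vlt_power[of "1 / A" 1 2] by simp
    then have "veq ((s / A)^2) 1" unfolding sq using veq_add[of "- ((1 / A)^2)" 1] by simp
    moreover have "s / A \<in> adjoin E \<zeta>"
      using subring_mult[OF subring_adjoin[OF ER] s(1)] adjoin_subset[OF ER] subfield_inverse[OF EF A]
      by (auto simp: divide_inverse)
    moreover have "(s / A)^2 \<in> E"
      using DE A s(2) subfield_divide[OF EF] subring_power[OF ER] by (simp add: power_divide)
    ultimately have "s / A \<in> E" using unramified_sqrt_descent[OF E q z] by blast
    then have "s / A * A \<in> E" using A subring_mult[OF ER] by blast
    then show False using s(3) A0 by simp
  qed
  have "\<not> veq (A^2 - 1) 1" using unramified_sqrt_descent[OF E q z s(1)] s(2,3) DE by auto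
  then have "vlt (A^2 - 1) 1" using Anz veq_trichotomy veq_sym by blast
  then show ?thesis using unramified_nonunit[OF E(2) DE] by blast
qed

end

subsection \<open>Almost all primes are unramified\<close>

text \<open>The leading coefficient of an integer equation is a unit at all larger primes.\<close>

lemma algebraic_almost_integral:
  assumes "algebraic_number y"
  shows "\<forall>\<^sub>F q in sequentially. \<forall>V. residue_char V q \<longrightarrow> y \<in> V"
proof (cases "y = 0")
  case True
  then show ?thesis by (auto simp: residue_char_def valuation_ring.zero_mem)
next
  case False
  obtain p where p: "poly_over \<int> p" "coeff p 0 \<noteq> 0" "poly p y = 0"
    using algebraic_integer_poly[OF assms False] .
  have "lead_coeff p \<in> \<int>" "lead_coeff p \<noteq> 0" using p poly_over_coeff by auto
  then obtain n where n: "lead_coeff p = of_int n" "n \<noteq> 0" by (metis Ints_cases of_int_0)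
  have *: "y \<in> V" if q: "q > nat \<bar>n\<bar>" "residue_char V q" for q V
  proof -
    interpret residue_char V q by fact
    have "\<not> int q dvd n" using q(1) n(2) by (auto dest: dvd_imp_le_int)
    then have "veq (of_int n) 1" by (rule coprime_unit)
    then have "vle 1 (of_int n)" by (simp add: veq_def)
    then have iV: "inverse (of_int n) \<in> V" using vle_inverse[of 1 "of_int n"] by (simp add: vle_one_iff)
    show ?thesis
    proof (rule integral_mem)
      show "poly_over V (smult (inverse (of_int n)) p)"
        using p(1) Ints_subset iV mult_mem by (auto simp: poly_over_def)
      show "lead_coeff (smult (inverse (of_int n)) p) = 1" using n by simp
    qed (use p in simp)
  qed
  show ?thesis unfolding eventually_sequentially
  proof (intro exI[of _ "Suc (nat \<bar>n\<bar>)"] allI impI)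
    fix q V assume "Suc (nat \<bar>n\<bar>) \<le> q" "residue_char V q"
    then show "y \<in> V" by (intro *[of q V]) auto
  qed
qed

text \<open>The annihilating polynomial \<open>f\<close> has least degree over Q, so its derivative
  does not vanish at \<open>b\<close>. At almost all primes the coefficients of \<open>f\<close> are
  integral and this derivative is a unit, as both it and its inverse are integral there; then
  \<open>unramified_etale\<close> applies.\<close>

lemma almost_unramified_adjoin:
  assumes F: "number_field F" "\<forall>\<^sub>F q in sequentially. \<forall>V. residue_char V q \<longrightarrow> residue_char.unramified V q F"
    and b: "algebraic_number b"
  shows "number_field (adjoin F b) \<and>
    (\<forall>\<^sub>F q in sequentially. \<forall>V. residue_char V q \<longrightarrow> residue_char.unramified V q (adjoin F b))"
proof
  note QF = subfield_Rats[OF number_field_subfield[OF F(1)]]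
  define P where "P = (\<lambda>f. poly_over \<rat> f \<and> lead_coeff f = 1 \<and> poly f b = 0)"
  obtain f0 where "P f0" using algebraic_monic[OF b] unfolding P_def by metis
  define f where "f = (ARG_MIN degree f. P f)"
  have f: "poly_over \<rat> f" "lead_coeff f = 1" "poly f b = 0" and fmin: "\<And>g. P g \<Longrightarrow> degree f \<le> degree g"
    unfolding f_def using arg_min_nat_lemma[of P f0 degree] \<open>P f0\<close> by (auto simp: P_def)
  have fF: "poly_over F f" using poly_over_mono[OF f(1) QF] .
  show nf: "number_field (adjoin F b)" using number_field_adjoin[OF F(1) fF f(2,3)] .
  have fpos: "degree f > 0" using monic_root_degree_pos[OF f(2,3)] .
  have "poly (pderiv f) b \<noteq> 0"
  proof
    assume 0: "poly (pderiv f) b = 0"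
    have nz: "pderiv f \<noteq> 0" using fpos by (simp add: pderiv_eq_0_iff)
    let ?g = "smult (inverse (lead_coeff (pderiv f))) (pderiv f)"
    have "poly_over \<rat> (pderiv f)" using poly_over_pderiv[OF subring_Rats f(1)] .
    then have "P ?g" unfolding P_def using 0 nz by (auto simp: poly_over_def)
    then have "degree f \<le> degree (pderiv f)" using fmin[of ?g] nz by simp
    then show False using fpos by (simp add: degree_pderiv)
  qed
  moreover have d: "poly (pderiv f) b \<in> adjoin F b"
    using adjoinI[OF poly_over_pderiv[OF number_field_subring[OF F(1)] fF]] .
  ultimately have d': "algebraic_number (poly (pderiv f) b)" "algebraic_number (inverse (poly (pderiv f) b))"
    using number_field_algebraic[OF nf] subfield_inverse[OF number_field_subfield[OF nf]] by blast+
  have coeffs: "\<forall>\<^sub>F q in sequentially. \<forall>i\<in>{..degree f}. \<forall>V. residue_char V q \<longrightarrow> coeff f i \<in> V"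
  proof (intro eventually_ball_finite ballI)
    fix i
    have "coeff f i \<in> F" using poly_over_coeff[OF fF] .
    then show "\<forall>\<^sub>F q in sequentially. \<forall>V. residue_char V q \<longrightarrow> coeff f i \<in> V"
      using algebraic_almost_integral number_field_algebraic[OF F(1)] by blast
  qed auto
  show "\<forall>\<^sub>F q in sequentially. \<forall>V. residue_char V q \<longrightarrow> residue_char.unramified V q (adjoin F b)"
    using F(2) coeffs algebraic_almost_integral[OF d'(1)] algebraic_almost_integral[OF d'(2)]
  proof eventually_elim
    case (elim q)
    show ?case
    proof (intro allI impI)
      fix V assume rc: "residue_char V q"
      interpret residue_char V q by fact
      let ?d = "poly (pderiv f) b"
      have "coeff f i \<in> F \<inter> V" for i
        using elim(2) rc poly_over_coeff[OF fF, of i] zero_mem by (cases "i \<le> degree f") (auto simp: coeff_eq_0)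
      then have fV: "poly_over (F \<inter> V) f" by (simp add: poly_over_def)
      have "?d \<in> V" "inverse ?d \<in> V" using elim rc by auto
      then have "veq ?d 1" using \<open>?d \<noteq> 0\<close> by (simp add: veq_one_iff vlt_one_iff)
      then show "unramified (adjoin F b)"
        using unramified_etale[OF F(1) fV f(2,3)] elim(1) rc by blast
    qed
  qed
qed

lemma number_field_Rats: "number_field \<rat>"
proof (rule number_fieldI[OF subring_Rats order_refl, of "{1}"])
  show "\<rat> \<subseteq> Q.span {1}"
  proof
    fix x :: complex assume "x \<in> \<rat>"
    then obtain r where "x = of_rat r" by (auto elim: Rats_cases)
    then show "x \<in> Q.span {1}" using Q.span_scale[OF Q.span_base[of 1 "{1}"], of r] by simp
  qed
qed simp

theorem almost_all_primes_unramified: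
  assumes K: "number_field K"
  shows "\<forall>\<^sub>F q in sequentially. \<forall>V. residue_char V q \<longrightarrow> residue_char.unramified V q K"
proof -
  obtain B where B: "finite B" "B \<subseteq> K"
      and span: "\<And>x. x \<in> K \<Longrightarrow> \<exists>k. (\<forall>b\<in>B. k b \<in> \<rat>) \<and> x = (\<Sum>b\<in>B. k b * b)"
    using K unfolding number_field_def fin_dim_over_def by blast
  have "\<exists>F. number_field F \<and> B \<subseteq> F \<and>
      (\<forall>\<^sub>F q in sequentially. \<forall>V. residue_char V q \<longrightarrow> residue_char.unramified V q F)"
    using B
  proof (induction B rule: finite_induct)
    case empty
    show ?case using number_field_Rats residue_char.unramified_Rats by (intro exI[of _ "\<rat>"]) auto
  next
    case (insert b B)
    then obtain F where F: "number_field F" "B \<subseteq> F"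
      "\<forall>\<^sub>F q in sequentially. \<forall>V. residue_char V q \<longrightarrow> residue_char.unramified V q F" by auto
    have "algebraic_number b" using number_field_algebraic[OF K] insert by auto
    then show ?case
      using almost_unramified_adjoin[OF F(1,3)] F(2) adjoin_self[OF number_field_subring[OF F(1)], of b]
        adjoin_subset[OF number_field_subring[OF F(1)], of b]
      by (intro exI[of _ "adjoin F b"]) auto
  qed
  then obtain F where F: "number_field F" "B \<subseteq> F"
      "\<forall>\<^sub>F q in sequentially. \<forall>V. residue_char V q \<longrightarrow> residue_char.unramified V q F" by blast
  have "K \<subseteq> F"
  proof
    fix x assume "x \<in> K"
    then obtain k where k: "\<forall>b\<in>B. k b \<in> \<rat>" "x = (\<Sum>b\<in>B. k b * b)" using span by blast
    then show "x \<in> F" using F(2) subfield_Rats[OF number_field_subfield[OF F(1)]]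
      unfolding k(2) by (intro subring_sum subring_mult number_field_subring[OF F(1)]) auto
  qed
  show ?thesis
    using F(3) by eventually_elim (use \<open>K \<subseteq> F\<close> residue_char.unramified_subset in blast)
qed

section \<open>House bounds\<close>

text \<open>The coordinates of the powers of \<open>y\<close> in a finite rational spanning set grow at most like
  \<open>M ^ n\<close>. This says that all conjugates of \<open>y\<close> are bounded by \<open>M\<close> (up to an arbitrarily small
  enlargement), but does not refer to embeddings.\<close>

definition rat_bounded :: "complex set \<Rightarrow> real \<Rightarrow> complex \<Rightarrow> bool" where
  "rat_bounded B C x \<longleftrightarrow> (\<exists>k. x = (\<Sum>b\<in>B. of_rat (k b) * b) \<and> (\<forall>b\<in>B. \<bar>of_rat (k b)\<bar> \<le> C))"

definition house_le :: "complex \<Rightarrow> real \<Rightarrow> bool" where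
  "house_le y M \<longleftrightarrow> (\<exists>B C. finite B \<and> (\<forall>n. rat_bounded B (C * M ^ n) (y ^ n)))"

lemma rat_bounded_mono: "rat_bounded B C x \<Longrightarrow> C \<le> D \<Longrightarrow> rat_bounded B D x"
  unfolding rat_bounded_def by (elim exE conjE, rule exI, rule conjI) (auto intro: order_trans)

lemma rat_bounded_0: "C \<ge> 0 \<Longrightarrow> rat_bounded B C 0"
  unfolding rat_bounded_def by (intro exI[of _ "\<lambda>_. 0"]) auto

lemma rat_bounded_add: "rat_bounded B C x \<Longrightarrow> rat_bounded B D y \<Longrightarrow> rat_bounded B (C + D) (x + y)"
  unfolding rat_bounded_def
proof (elim exE conjE)
  fix k l
  assume "x = (\<Sum>b\<in>B. of_rat (k b) * b)" "\<forall>b\<in>B. \<bar>of_rat (k b)\<bar> \<le> C"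
    "y = (\<Sum>b\<in>B. of_rat (l b) * b)" "\<forall>b\<in>B. \<bar>of_rat (l b)\<bar> \<le> D"
  then show "\<exists>k. x + y = (\<Sum>b\<in>B. of_rat (k b) * b) \<and> (\<forall>b\<in>B. \<bar>of_rat (k b)\<bar> \<le> C + D)"
    by (intro exI[of _ "\<lambda>b. k b + l b"])
      (auto simp: of_rat_add distrib_right sum.distrib intro!: order_trans[OF abs_triangle_ineq] add_mono)
qed

lemma rat_bounded_sum:
  "(\<And>i. i \<in> I \<Longrightarrow> rat_bounded B (C i) (x i)) \<Longrightarrow> finite I \<Longrightarrow> rat_bounded B (sum C I) (sum x I)"
  by (rotate_tac, induction I rule: finite_induct) (auto intro: rat_bounded_0 rat_bounded_add)

lemma rat_bounded_scale:
  assumes "rat_bounded B C x" shows "rat_bounded B (\<bar>of_rat r\<bar> * C) (of_rat r * x)"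
proof -
  obtain k where k: "x = (\<Sum>b\<in>B. of_rat (k b) * b)" "\<And>b. b \<in> B \<Longrightarrow> \<bar>of_rat (k b)\<bar> \<le> C"
    using assms unfolding rat_bounded_def by blast
  have "of_rat r * x = (\<Sum>b\<in>B. of_rat (r * k b) * b)"
    unfolding k(1) sum_distrib_left by (intro sum.cong) (auto simp: of_rat_mult)
  moreover have "\<bar>of_rat (r * k b)\<bar> \<le> \<bar>of_rat r\<bar> * C" if "b \<in> B" for b
    unfolding of_rat_mult abs_mult using k(2)[OF that] by (intro mult_left_mono) auto
  ultimately show ?thesis unfolding rat_bounded_def by (intro exI[of _ "\<lambda>b. r * k b"]) auto
qed

lemma rat_bounded_base:
  assumes "finite B" "b \<in> B" "\<bar>of_rat r\<bar> \<le> C" shows "rat_bounded B C (of_rat r * b)"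
  unfolding rat_bounded_def
proof (intro exI[of _ "\<lambda>d. if d = b then r else 0"] conjI ballI)
  have "(\<Sum>d\<in>B. of_rat (if d = b then r else 0) * d) = (\<Sum>d\<in>B. if d = b then of_rat r * b else 0)"
    by (intro sum.cong) auto
  then show "of_rat r * b = (\<Sum>d\<in>B. of_rat (if d = b then r else 0) * d)" using assms by simp
qed (use assms order_trans[OF abs_ge_zero assms(3)] in auto)

lemma rat_bounded_span: "finite B \<Longrightarrow> x \<in> Q.span B \<Longrightarrow> \<exists>C\<ge>0. rat_bounded B C x"
proof -
  assume B: "finite B" "x \<in> Q.span B"
  then obtain k where k: "x = (\<Sum>b\<in>B. of_rat (k b) * b)"
    unfolding Q.span_finite[OF B(1)] by auto
  have "\<bar>of_rat (k b)\<bar> \<le> (\<Sum>b\<in>B. \<bar>of_rat (k b)\<bar> :: real)" if "b \<in> B" for b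
    using member_le_sum[of b B "\<lambda>b. \<bar>of_rat (k b)\<bar> :: real"] B(1) that by auto
  then show ?thesis unfolding rat_bounded_def using k
    by (intro exI[of _ "\<Sum>b\<in>B. \<bar>of_rat (k b)\<bar>"]) (auto simp: sum_nonneg)
qed

lemma rat_bounded_mult:
  assumes B: "finite B" "finite B'" and x: "rat_bounded B C x" and y: "rat_bounded B' D y"
    and C: "C \<ge> 0"
  shows "rat_bounded ((\<lambda>(b, c). b * c) ` (B \<times> B')) (real (card B * card B') * (C * D)) (x * y)"
proof -
  let ?S = "(\<lambda>(b, c). b * c) ` (B \<times> B')"
  obtain k where k: "x = (\<Sum>b\<in>B. of_rat (k b) * b)" "\<And>b. b \<in> B \<Longrightarrow> \<bar>of_rat (k b)\<bar> \<le> C"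
    using x unfolding rat_bounded_def by blast
  obtain l where l: "y = (\<Sum>b\<in>B'. of_rat (l b) * b)" "\<And>b. b \<in> B' \<Longrightarrow> \<bar>of_rat (l b)\<bar> \<le> D"
    using y unfolding rat_bounded_def by blast
  have "x * y = (\<Sum>p\<in>B \<times> B'. of_rat (k (fst p) * l (snd p)) * (fst p * snd p))"
    unfolding k(1) l(1) sum_product sum.cartesian_product
    by (intro sum.cong) (auto simp: of_rat_mult)
  moreover have "rat_bounded ?S (\<Sum>p\<in>B \<times> B'. C * D) (\<Sum>p\<in>B \<times> B'. of_rat (k (fst p) * l (snd p)) * (fst p * snd p))"
  proof (rule rat_bounded_sum)
    fix p assume p: "p \<in> B \<times> B'"
    then show "rat_bounded ?S (C * D) (of_rat (k (fst p) * l (snd p)) * (fst p * snd p))"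
      using B k(2)[of "fst p"] l(2)[of "snd p"] C
      by (intro rat_bounded_base) (auto simp: of_rat_mult abs_mult intro!: mult_mono)
  qed (use B in auto)
  ultimately show ?thesis by (simp add: card_cartesian_product)
qed

lemma rat_bounded_nonneg: "rat_bounded B C x \<Longrightarrow> B \<noteq> {} \<Longrightarrow> C \<ge> 0"
  unfolding rat_bounded_def by (meson abs_ge_zero all_not_in_conv order_trans)

lemma house_leE:
  assumes "house_le y M"
  obtains B C where "finite B" "C \<ge> 0" "\<And>n. rat_bounded B (C * M ^ n) (y ^ n)"
proof -
  obtain B C where BC: "finite B" "\<And>n. rat_bounded B (C * M ^ n) (y ^ n)"
    using assms unfolding house_le_def by blast
  have "B \<noteq> {}" using BC(2)[of 0] by (auto simp: rat_bounded_def)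
  then have "C \<ge> 0" using rat_bounded_nonneg[OF BC(2)[of 0]] by simp
  then show thesis using that BC by blast
qed

lemma house_mono: "house_le y M \<Longrightarrow> 0 \<le> M \<Longrightarrow> M \<le> N \<Longrightarrow> house_le y N"
proof -
  assume y: "house_le y M" and M: "0 \<le> M" "M \<le> N"
  obtain B C where B: "finite B" "C \<ge> 0" "\<And>n. rat_bounded B (C * M ^ n) (y ^ n)"
    using y by (rule house_leE) blast
  have "rat_bounded B (C * N ^ n) (y ^ n)" for n
    using B(2) M by (intro rat_bounded_mono[OF B(3)] mult_left_mono power_mono)
  then show ?thesis unfolding house_le_def using B(1) by (intro exI[of _ B] exI[of _ C]) simp
qed

lemma house_mult:
  assumes "house_le x M" "house_le y N" "M \<ge> 0"
  shows "house_le (x * y) (M * N)"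
proof -
  obtain B C where B: "finite B" "C \<ge> 0" "\<And>n. rat_bounded B (C * M ^ n) (x ^ n)"
    using assms(1) by (rule house_leE) blast
  obtain B' C' where B': "finite B'" "C' \<ge> 0" "\<And>n. rat_bounded B' (C' * N ^ n) (y ^ n)"
    using assms(2) by (rule house_leE) blast
  let ?S = "(\<lambda>(b, c). b * c) ` (B \<times> B')" and ?c = "real (card B * card B')"
  have "rat_bounded ?S (?c * (C * C') * (M * N) ^ n) ((x * y) ^ n)" for n
  proof -
    have 1: "?c * (C * C') * (M * N) ^ n = ?c * ((C * M ^ n) * (C' * N ^ n))"
      by (simp add: power_mult_distrib)
    have "0 \<le> C * M ^ n" using B(2) assms(3) by simp
    then show ?thesis unfolding 1 power_mult_distrib[of x y]
      by (rule rat_bounded_mult[OF B(1) B'(1) B(3)[of n] B'(3)[of n]])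
  qed
  moreover have "finite ?S" using B(1) B'(1) by simp
  ultimately show ?thesis unfolding house_le_def
    by (intro exI[of _ ?S] exI[of _ "?c * (C * C')"] conjI allI)
qed

lemma house_add:
  assumes "house_le x M" "house_le y N" "M \<ge> 0"
  shows "house_le (x + y) (M + N)"
proof -
  obtain B C where B: "finite B" "C \<ge> 0" "\<And>n. rat_bounded B (C * M ^ n) (x ^ n)"
    using assms(1) by (rule house_leE) blast
  obtain B' C' where B': "finite B'" "C' \<ge> 0" "\<And>n. rat_bounded B' (C' * N ^ n) (y ^ n)"
    using assms(2) by (rule house_leE) blast
  let ?S = "(\<lambda>(b, c). b * c) ` (B \<times> B')" and ?c = "real (card B * card B')"
  have "rat_bounded ?S (?c * (C * C') * (M + N) ^ n) ((x + y) ^ n)" for n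
  proof -
    have "rat_bounded ?S (\<Sum>i\<le>n. \<bar>of_rat (of_nat (n choose i))\<bar> * (?c * ((C * M ^ i) * (C' * N ^ (n - i)))))
        (\<Sum>i\<le>n. of_rat (of_nat (n choose i)) * (x ^ i * y ^ (n - i)))"
      using B B' assms(3) by (intro rat_bounded_sum rat_bounded_scale rat_bounded_mult) auto
    moreover have "(\<Sum>i\<le>n. of_rat (of_nat (n choose i)) * (x ^ i * y ^ (n - i))) = (x + y) ^ n"
      unfolding binomial_ring by (simp add: mult.assoc)
    moreover have "(\<Sum>i\<le>n. \<bar>of_rat (of_nat (n choose i))\<bar> * (?c * ((C * M ^ i) * (C' * N ^ (n - i))))) = ?c * (C * C') * (M + N) ^ n"
      unfolding binomial_ring sum_distrib_left by (intro sum.cong) (auto simp: mult_ac)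
    ultimately show ?thesis by simp
  qed
  moreover have "finite ?S" using B(1) B'(1) by simp
  ultimately show ?thesis unfolding house_le_def
    by (intro exI[of _ ?S] exI[of _ "?c * (C * C')"] conjI allI)
qed

text \<open>Even powers of \<open>y\<close> are powers of \<open>y^2\<close>. For odd powers one
  factor \<open>y\<close> is left over and is put into the spanning set; the factor
  \<open>1 + 1 / M\<close> pays for the missing \<open>M\<close> when the exponent is even.\<close>

lemma house_sqrt:
  assumes "house_le (y\<^sup>2) (M\<^sup>2)" "M > 0"
  shows "house_le y M"
proof -
  obtain B C where B: "finite B" "C \<ge> 0" "\<And>n. rat_bounded B (C * (M\<^sup>2) ^ n) ((y\<^sup>2) ^ n)"
    using assms(1) by (rule house_leE) blast
  let ?S = "(\<lambda>(b, c). b * c) ` (B \<times> {1, y})" and ?c = "real (card B * card {1, y})"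
  have "rat_bounded ?S (?c * C * (1 + 1 / M) * M ^ n) (y ^ n)" for n
  proof -
    have y: "rat_bounded {1, y} 1 (y ^ (n mod 2))"
      using rat_bounded_base[of "{1, y}" 1 1 1] rat_bounded_base[of "{1, y}" y 1 1]
      by (cases "even n") (auto simp: odd_iff_mod_2_eq_one)
    have "y ^ n = (y\<^sup>2) ^ (n div 2) * y ^ (n mod 2)"
      by (simp flip: power_mult power_add)
    then have 1: "rat_bounded ?S (?c * ((C * (M\<^sup>2) ^ (n div 2)) * 1)) (y ^ n)"
      using rat_bounded_mult[OF B(1) _ B(3)[of "n div 2"] y] B(2) by simp
    have "(M\<^sup>2) ^ (n div 2) * M ^ (n mod 2) = M ^ n"
      by (simp flip: power_mult power_add)
    moreover have "1 \<le> (1 + 1 / M) * M ^ (n mod 2)"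
      using assms(2) by (cases "even n") (auto simp: odd_iff_mod_2_eq_one field_simps)
    ultimately have "(M\<^sup>2) ^ (n div 2) \<le> (1 + 1 / M) * M ^ n"
      using mult_left_mono[of 1 "(1 + 1 / M) * M ^ (n mod 2)" "(M\<^sup>2) ^ (n div 2)"] assms(2)
      by (simp add: mult_ac)
    then have "?c * ((C * (M\<^sup>2) ^ (n div 2)) * 1) \<le> ?c * (C * ((1 + 1 / M) * M ^ n))"
      using B(2) by (simp add: mult_left_mono)
    then show ?thesis using rat_bounded_mono[OF 1] by (simp add: mult_ac)
  qed
  moreover have "finite ?S" using B(1) by simp
  ultimately show ?thesis unfolding house_le_def
    by (intro exI[of _ ?S] exI[of _ "?c * C * (1 + 1 / M)"] conjI allI)
qed

lemma house_rat: "house_le (of_rat r) \<bar>of_rat r\<bar>"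
  unfolding house_le_def
proof (intro exI[of _ "{1}"] exI[of _ 1] conjI allI)
  fix n
  show "rat_bounded {1} (1 * \<bar>of_rat r\<bar> ^ n) (of_rat r ^ n)"
    using rat_bounded_base[of "{1}" 1 "r ^ n" "\<bar>of_rat r\<bar> ^ n"] by (simp add: of_rat_power power_abs)
qed simp

lemma house_diff:
  assumes "house_le x M" "house_le y N" "M \<ge> 0" shows "house_le (x - y) (M + N)"
proof -
  have "house_le (of_rat (- 1) * y) (1 * N)" using house_mult[OF house_rat[of "- 1"] assms(2)] by simp
  then show ?thesis using house_add[OF assms(1) _ assms(3), of "- y" N] by simp
qed

text \<open>In a rational basis, multiplication by \<open>y\<close> enlarges coordinates at most by
  the sum of the bounds for the images of the basis vectors.\<close>

lemma house_exists:
  assumes F: "number_field F" "y \<in> F" shows "\<exists>M\<ge>0. house_le y M"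
proof -
  obtain A where A: "finite A" "F \<subseteq> Q.span A" using number_field_span[OF F(1)] .
  obtain B where B: "B \<subseteq> F" "Q.independent B" "F \<subseteq> Q.span B"
    using Q.maximal_independent_subset[of F] by blast
  have fin: "finite B" using Q.independent_span_bound[OF A(1) B(2)] A B by blast
  have "\<exists>C\<ge>0. rat_bounded B C (y * b)" if "b \<in> B" for b
    using subring_mult[OF number_field_subring[OF F(1)] F(2)] that B rat_bounded_span[OF fin] by blast
  then obtain c where c: "\<And>b. b \<in> B \<Longrightarrow> c b \<ge> 0 \<and> rat_bounded B (c b) (y * b)" by metis
  define M where "M = sum c B"
  have step: "rat_bounded B (D * M) (y * x)" if x: "rat_bounded B D x" for D x
  proof -
    obtain k where k: "x = (\<Sum>b\<in>B. of_rat (k b) * b)" "\<And>b. b \<in> B \<Longrightarrow> \<bar>of_rat (k b)\<bar> \<le> D"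
      using x unfolding rat_bounded_def by blast
    have "rat_bounded B (\<Sum>b\<in>B. D * c b) (\<Sum>b\<in>B. of_rat (k b) * (y * b))"
    proof (rule rat_bounded_sum[OF _ fin])
      fix b assume b: "b \<in> B"
      show "rat_bounded B (D * c b) (of_rat (k b) * (y * b))"
        by (rule rat_bounded_mono[OF rat_bounded_scale mult_right_mono]) (use c[OF b] k(2)[OF b] in auto)
    qed
    moreover have "(\<Sum>b\<in>B. of_rat (k b) * (y * b)) = y * x"
      unfolding k(1) sum_distrib_left by (intro sum.cong) auto
    ultimately show ?thesis by (simp add: M_def sum_distrib_left)
  qed
  obtain C where C: "rat_bounded B C 1"
    using rat_bounded_span[OF fin] B(3) subring_one[OF number_field_subring[OF F(1)]] by blast
  have "rat_bounded B (C * M ^ n) (y ^ n)" for n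
  proof (induction n)
    case (Suc n)
    then show ?case using step[OF Suc] by (simp add: mult_ac)
  qed (use C in simp)
  moreover have "M \<ge> 0" unfolding M_def using c by (intro sum_nonneg) auto
  ultimately show ?thesis unfolding house_le_def using fin
    by (intro exI[of _ M] conjI exI[of _ B] exI[of _ C] allI)
qed

text \<open>Replaces the argument that a nonzero norm is at least 1. A rational linear functional
  \<open>g\<close> on C with \<open>g 1 = 1\<close> has bounded denominators on the powers of
  \<open>S\<close>, by the monic recurrence, while its values there tend to 0; so they vanish from
  some exponent \<open>n0\<close> on. If \<open>S\<close> is nonzero, then
  \<open>1 = S ^ n0 * h(S)\<close> is a rational combination of such powers, contradicting
  \<open>g 1 = 1\<close>.\<close>

lemma integral_house_less_1:
  assumes S: "alg_int S" "house_le S M" and M: "0 \<le> M" "M < 1"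
  shows "S = 0"
proof (rule ccontr)
  assume S0: "S \<noteq> 0"
  obtain B C where BC: "finite B" "C \<ge> 0" "\<And>n. rat_bounded B (C * M ^ n) (S ^ n)"
    using S(2) by (rule house_leE) blast
  define E where "E = Q.extend_basis {1}"
  have ind1: "Q.independent {1}" by (simp add: Q.dependent_single)
  have E: "Q.independent E" "Q.span E = UNIV" "1 \<in> E"
    using Q.independent_extend_basis[OF ind1] Q.span_extend_basis[OF ind1] Q.extend_basis_superset[OF ind1]
    by (auto simp: E_def)
  define g where "g x = Q.representation E x 1" for x
  have g_add: "g (x + y) = g x + g y" for x y
    unfolding g_def using Q.representation_add[OF E(1), of x y] E(2) by (simp add: add.commute)
  have g_scale: "g (of_rat r * x) = r * g x" for r x
    unfolding g_def using Q.representation_scale[OF E(1), of x r] E(2) by simp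
  have g1: "g 1 = 1" unfolding g_def using Q.representation_basis[OF E(1,3)] by simp
  have g0: "g 0 = 0" using g_scale[of 0 0] by simp
  have g_sum: "g (sum f I) = (\<Sum>i\<in>I. g (f i))" for f :: "'i \<Rightarrow> complex" and I
    by (induction I rule: infinite_finite_induct) (auto simp: g0 g_add)
  obtain p :: "int poly" where p: "lead_coeff p = 1" "poly (map_poly of_int p) S = 0"
    using S(1) by (auto simp: alg_int_def)
  define d where "d = degree p"
  have dm: "degree (map_poly (of_int :: int \<Rightarrow> complex) p) = d" by (simp add: d_def degree_map_poly)
  have "(\<Sum>i<d. of_int (coeff p i) * S ^ i) + S ^ d = 0"
    using p unfolding poly_altdef dm by (simp add: lessThan_Suc_atMost[symmetric] coeff_map_poly d_def)
  then have "S ^ d = - (\<Sum>i<d. of_int (coeff p i) * S ^ i)" by (simp add: eq_neg_iff_add_eq_0 add.commute)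
  then have Sd: "S ^ d = (\<Sum>i<d. of_rat (of_int (- coeff p i)) * S ^ i)" by (simp add: sum_negf)
  have rec: "g (S ^ (n + d)) = (\<Sum>i<d. of_int (- coeff p i) * g (S ^ (n + i)))" for n
  proof -
    have "S ^ (n + d) = (\<Sum>i<d. of_rat (of_int (- coeff p i)) * S ^ (n + i))"
      unfolding power_add Sd sum_distrib_left by (intro sum.cong) (auto simp: mult_ac)
    then show ?thesis by (simp only: g_sum g_scale)
  qed
  have "\<exists>N::int. N > 0 \<and> (\<forall>i<n. of_int N * g (S ^ i) \<in> \<int>)" for n
  proof (induction n)
    case 0
    show ?case by (intro exI[of _ 1]) auto
  next
    case (Suc n)
    then obtain N :: int where N: "N > 0" "\<forall>i<n. of_int N * g (S ^ i) \<in> \<int>" by blast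
    obtain u v :: int where uv: "v > 0" "g (S ^ n) = of_int u / of_int v"
      using quotient_of_div[of "g (S ^ n)"] quotient_of_denom_pos[of "g (S ^ n)"] by (metis surj_pair)
    have "of_int (N * v) * g (S ^ i) \<in> \<int>" if "i < Suc n" for i
    proof (cases "i = n")
      case True
      then have "of_int (N * v) * g (S ^ i) = of_int (N * u)" using uv by simp
      then show ?thesis by (simp only: Ints_of_int)
    next
      case False
      have "of_int (N * v) * g (S ^ i) = of_int v * (of_int N * g (S ^ i))" by simp
      moreover have "of_int N * g (S ^ i) \<in> \<int>" using N(2) that False by simp
      ultimately show ?thesis using Ints_mult[OF Ints_of_int] by metis
    qed
    then show ?case using N(1) uv(1) by (intro exI[of _ "N * v"]) auto
  qed
  then obtain N :: int where N: "N > 0" "\<And>i. i < d \<Longrightarrow> of_int N * g (S ^ i) \<in> \<int>" by blast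
  have int: "of_int N * g (S ^ n) \<in> \<int>" for n
  proof (induction n rule: less_induct)
    case (less n)
    show ?case
    proof (cases "n < d")
      case False
      then have "of_int N * g (S ^ n) = (\<Sum>i<d. of_int (- coeff p i) * (of_int N * g (S ^ (n - d + i))))"
        using rec[of "n - d"] by (simp add: sum_distrib_left mult_ac)
      moreover have "of_int (- coeff p i) * (of_int N * g (S ^ (n - d + i))) \<in> \<int>" if "i < d" for i
      proof -
        have "of_int N * g (S ^ (n - d + i)) \<in> \<int>" using that False by (intro less) auto
        then show ?thesis by (rule Ints_mult[OF Ints_of_int])
      qed
      ultimately show ?thesis by (simp only:) (rule Ints_sum, simp only: lessThan_iff)
    qed (use N in simp)
  qed
  define G where "G = (\<Sum>b\<in>B. \<bar>of_rat (g b)\<bar> :: real)"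
  have bound: "\<bar>of_rat (g (S ^ n))\<bar> \<le> C * G * M ^ n" for n
  proof -
    obtain k where k: "S ^ n = (\<Sum>b\<in>B. of_rat (k b) * b)" "\<And>b. b \<in> B \<Longrightarrow> \<bar>of_rat (k b)\<bar> \<le> C * M ^ n"
      using BC(3)[of n] unfolding rat_bounded_def by blast
    have "\<bar>of_rat (g (S ^ n))\<bar> = \<bar>\<Sum>b\<in>B. of_rat (k b) * of_rat (g b) :: real\<bar>"
      unfolding k(1) g_sum g_scale by (simp add: of_rat_sum of_rat_mult)
    also have "\<dots> \<le> (\<Sum>b\<in>B. (C * M ^ n) * \<bar>of_rat (g b)\<bar>)"
      using k(2) by (intro order_trans[OF sum_abs] sum_mono) (auto simp: abs_mult intro: mult_right_mono)
    finally show ?thesis by (simp add: G_def sum_distrib_left mult_ac)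
  qed
  have "(\<lambda>n. real_of_int N * (C * G) * M ^ n) \<longlonglongrightarrow> real_of_int N * (C * G) * 0"
    using M by (intro tendsto_mult tendsto_const LIMSEQ_power_zero) auto
  then have "\<forall>\<^sub>F n in sequentially. real_of_int N * (C * G) * M ^ n < 1"
    by (intro order_tendstoD(2)[of _ 0]) auto
  then obtain n0 where n0: "\<And>n. n \<ge> n0 \<Longrightarrow> real_of_int N * (C * G) * M ^ n < 1"
    unfolding eventually_sequentially by blast
  have van: "g (S ^ n) = 0" if "n \<ge> n0" for n
  proof -
    obtain z where z: "of_int N * g (S ^ n) = of_int z" using int[of n] by (auto elim: Ints_cases)
    have "real_of_int \<bar>z\<bar> = \<bar>of_rat (of_int N * g (S ^ n))\<bar>" unfolding z by simp
    also have "\<dots> \<le> of_int N * (C * G * M ^ n)"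
      using bound[of n] N(1) by (simp add: of_rat_mult abs_mult)
    also have "\<dots> < 1" using n0[OF that] by (simp add: mult_ac)
    finally have "z = 0" by simp
    then show ?thesis using z N(1) by simp
  qed
  have "\<rat> \<subseteq> adjoin \<rat> S" "S ^ n0 \<in> adjoin \<rat> S"
    using adjoin_subset[OF subring_Rats] subring_power[OF subring_adjoin[OF subring_Rats] adjoin_self[OF subring_Rats]] by auto
  moreover have "algebraic_number (S ^ n0)"
  proof -
    have "poly_over \<rat> (map_poly of_int p)" by (auto simp: poly_over_def coeff_map_poly)
    moreover have "map_poly (of_int :: int \<Rightarrow> complex) p \<noteq> 0" using p(1) by (auto simp: map_poly_eq_0_iff)
    ultimately have "algebraic_number S" using p(2) unfolding algebraic_number_def by blast
    then obtain f where "poly_over \<rat> f" "lead_coeff f = 1" "poly f S = 0" using algebraic_monic by metis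
    then have nf: "number_field (adjoin \<rat> S)" using number_field_adjoin[OF number_field_Rats] by blast
    show ?thesis using number_field_algebraic[OF nf \<open>S ^ n0 \<in> adjoin \<rat> S\<close>] .
  qed
  ultimately have "inverse (S ^ n0) \<in> adjoin \<rat> S"
    using algebraic_inverse[OF _ subring_adjoin[OF subring_Rats]] by blast
  then obtain h where h: "poly_over \<rat> h" "inverse (S ^ n0) = poly h S" by (auto simp: adjoin_def)
  have "coeff h i \<in> \<rat>" for i using poly_over_coeff[OF h(1)] .
  then have "\<exists>r. coeff h i = of_rat r" for i by (metis Rats_cases)
  then obtain r where r: "\<And>i. coeff h i = of_rat (r i)" by metis
  have "1 = S ^ n0 * poly h S" using S0 by (simp flip: h(2))
  also have "\<dots> = (\<Sum>i\<le>degree h. of_rat (r i) * S ^ (n0 + i))"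
    unfolding poly_altdef sum_distrib_left r by (intro sum.cong) (auto simp: power_add mult_ac)
  finally have "g 1 = g (\<Sum>i\<le>degree h. of_rat (r i) * S ^ (n0 + i))" by (rule arg_cong)
  then have "g 1 = (\<Sum>i\<le>degree h. r i * g (S ^ (n0 + i)))" by (simp only: g_sum g_scale)
  then show False using van g1 by simp
qed

section \<open>Cyclotomic extensions\<close>

definition zeta :: "nat \<Rightarrow> complex" where
  "zeta N = cis (2 * pi / real N)"

lemma zeta_mult_power: "m > 0 \<Longrightarrow> zeta (m * n) ^ m = zeta n"
  by (simp add: zeta_def Complex.DeMoivre)

lemma zeta_power_self: "N > 0 \<Longrightarrow> zeta N ^ N = 1"
  using zeta_mult_power[of N 1] by (simp add: zeta_def)

lemma roots_of_unity_power: "N > 0 \<Longrightarrow> z ^ N = 1 \<Longrightarrow> \<exists>k. z = zeta N ^ k"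
proof -
  assume N: "N > 0" "z ^ N = 1"
  then have "z \<in> (\<lambda>k. cis (2 * pi * real k / real N)) ` {..<N}"
    using bij_betw_imp_surj_on[OF Complex.bij_betw_roots_unity[OF N(1)]] by auto
  then obtain k where "z = cis (2 * pi * real k / real N)" by blast
  then show ?thesis by (intro exI[of _ k]) (simp add: zeta_def Complex.DeMoivre mult.commute)
qed

lemma zeta_neq_1: "N > 1 \<Longrightarrow> zeta N \<noteq> 1"
proof
  assume N: "N > 1" "zeta N = 1"
  then have "inj_on (\<lambda>k. cis (2 * pi * real k / real N)) {..<N}"
    using bij_betw_imp_inj_on[OF Complex.bij_betw_roots_unity[of N]] by simp
  then have "(0::nat) = 1" using N by (elim inj_onD) (auto simp: zeta_def)
  then show False by simp
qed

context
  fixes K assumes K: "number_field K"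
begin

lemma cyclotomic_adjoin:
  assumes "N > 0"
  shows "cyclotomic_ext K N = adjoin K (zeta N)" "number_field (cyclotomic_ext K N)"
proof -
  note KR = number_field_subring[OF K]
  let ?f = "monom 1 N - 1 :: complex poly"
  have "degree ?f \<le> N" by (intro degree_diff_le degree_monom_le) auto
  moreover have "coeff ?f N = 1" using assms by (cases N) auto
  ultimately have "lead_coeff ?f = 1" using le_degree[of ?f N] by (metis le_antisym zero_neq_one)
  moreover have "poly_over K ?f" using KR by (intro poly_over_diff poly_over_monom poly_over_1 subring_one)
  moreover have "poly ?f (zeta N) = 0" using zeta_power_self[OF assms] by (simp add: poly_monom)
  ultimately have nf: "number_field (adjoin K (zeta N))" using number_field_adjoin[OF K] by blast
  show "cyclotomic_ext K N = adjoin K (zeta N)"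
    unfolding cyclotomic_ext_def zeta_def[symmetric]
    using gen_field_insert_subset[OF number_field_subfield[OF nf] KR] .
  then show "number_field (cyclotomic_ext K N)" using nf by simp
qed

lemma cyclotomic_subset: "N > 0 \<Longrightarrow> K \<subseteq> cyclotomic_ext K N"
  using cyclotomic_adjoin(1) adjoin_subset[OF number_field_subring[OF K]] by simp

lemma zeta_mem_cyclotomic:
  assumes "N > 0" "M dvd N" shows "zeta M \<in> cyclotomic_ext K N"
proof -
  obtain m where m: "N = m * M" using assms(2) by (metis dvd_def mult.commute)
  then have "zeta M = zeta N ^ m" using assms(1) zeta_mult_power[of m M] by (cases m) auto
  moreover have "zeta N \<in> cyclotomic_ext K N"
    using cyclotomic_adjoin(1)[OF assms(1)] adjoin_self[OF number_field_subring[OF K]] by simp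
  ultimately show ?thesis
    using subring_power[OF number_field_subring[OF cyclotomic_adjoin(2)[OF assms(1)]]] by simp
qed

lemma cyclotomic_least:
  assumes "subring_C F" "K \<subseteq> F" "N > 0" "zeta N \<in> F"
  shows "cyclotomic_ext K N \<subseteq> F"
  using adjoin_least[OF assms(1,2,4)] cyclotomic_adjoin(1)[OF assms(3)] by simp

lemma cyclotomic_mono:
  assumes "M > 0" "N > 0" "M dvd N" shows "cyclotomic_ext K M \<subseteq> cyclotomic_ext K N"
  using cyclotomic_least[OF number_field_subring[OF cyclotomic_adjoin(2)[OF assms(2)]] cyclotomic_subset[OF assms(2)] assms(1)]
    zeta_mem_cyclotomic[OF assms(2,3)] by blast

end

lemma number_field_adjoin_root_of_unity:
  assumes "number_field F" "N > 0" shows "number_field (adjoin F (zeta N))"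
  using cyclotomic_adjoin[OF assms] by simp

lemma zeta_coprime_split:
  assumes F: "subfield_C F" "zeta m \<in> F" "zeta n \<in> F" and "coprime m n" "m > 0" "n > 0"
  shows "zeta (m * n) \<in> F"
proof -
  obtain u v where "u * int m + v * int n = 1"
    using \<open>coprime m n\<close> bezout_int[of "int m" "int n"] by auto
  then have "real_of_int (u * int m + v * int n) = 1" by simp
  then have uv: "real_of_int u * real m + real_of_int v * real n = 1" by simp
  have "2 * pi / real (m * n) = real_of_int u * (2 * pi / real n) + real_of_int v * (2 * pi / real m)"
  proof -
    have "real_of_int u * (2 * pi / real n) + real_of_int v * (2 * pi / real m)
        = 2 * pi * (real_of_int u * real m + real_of_int v * real n) / real (m * n)"
      using assms(5,6) by (simp add: field_simps)
    then show ?thesis unfolding uv by simp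
  qed
  then have "zeta (m * n) = zeta n powi u * zeta m powi v"
    by (simp add: zeta_def cis_power_int cis_mult)
  moreover have "x powi k \<in> F" if "x \<in> F" for x k
    using that subring_power[OF subfield_subring[OF F(1)]] subfield_inverse[OF F(1)]
    by (auto simp: power_int_def)
  ultimately show ?thesis using F subring_mult[OF subfield_subring[OF F(1)]] by simp
qed

section \<open>Paths in the backward orbit\<close>

text \<open>Paths run against the direction of \<open>phi\<close>, with the base point at index 0.
  Values at indices beyond \<open>n\<close> are arbitrary.\<close>

definition backward_path :: "complex \<Rightarrow> complex \<Rightarrow> complex \<Rightarrow> nat \<Rightarrow> (nat \<Rightarrow> complex) \<Rightarrow> bool" where
  "backward_path a c \<alpha> n x \<longleftrightarrow> x 0 = \<alpha> \<and> (\<forall>i<n. x (Suc i) \<noteq> 0 \<and> phi a c (x (Suc i)) = x i)"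

lemma preimg_path: "\<gamma> \<in> preimg a c \<alpha> n \<Longrightarrow> \<exists>x. backward_path a c \<alpha> n x \<and> x n = \<gamma>"
proof (induction n arbitrary: \<gamma>)
  case 0
  then show ?case by (intro exI[of _ "\<lambda>_. \<alpha>"]) (auto simp: backward_path_def)
next
  case (Suc n)
  then obtain x where x: "backward_path a c \<alpha> n x" "x n = phi a c \<gamma>" by auto
  then show ?case using Suc.prems
    by (intro exI[of _ "x(Suc n := \<gamma>)"]) (auto simp: backward_path_def less_Suc_eq)
qed

lemma backward_path_mem:
  assumes "backward_path a c \<alpha> n x" "subfield_C F" "a \<in> F" "c \<in> F" "x n \<in> F" "i \<le> n"
  shows "x i \<in> F"
proof -
  note FR = subfield_subring[OF assms(2)]
  have "x (n - j) \<in> F" if "j \<le> n" for j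
    using that
  proof (induction j)
    case (Suc j)
    have "x (n - Suc j) = phi a c (x (n - j))"
      using assms(1) Suc.prems unfolding backward_path_def by (metis Suc_diff_Suc Suc_le_eq diff_less zero_less_Suc less_le_trans)
    then show ?case using Suc assms subfield_divide[OF assms(2)] FR
      by (auto simp: phi_def intro!: subring_add subring_mult)
  qed (use assms in simp)
  from this[of "n - i"] show ?thesis using assms(6) by simp
qed

lemma backward_step:
  assumes "backward_path a c \<alpha> n x" "i < n" "a \<noteq> 0"
  shows "(x (Suc i) - (x i - c) / (2 * a))\<^sup>2 = ((x i - c) / (2 * a))\<^sup>2 - 1"
    and "x (Suc i) \<noteq> 0" and "x i - c = a * (x (Suc i) + 1 / x (Suc i))"
proof -
  show nz: "x (Suc i) \<noteq> 0" and u: "x i - c = a * (x (Suc i) + 1 / x (Suc i))"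
    using assms unfolding backward_path_def phi_def by (auto simp: field_simps)
  have A: "(x i - c) / (2 * a) = (x (Suc i) + 1 / x (Suc i)) / 2" unfolding u using assms(3) by simp
  show "(x (Suc i) - (x i - c) / (2 * a))\<^sup>2 = ((x i - c) / (2 * a))\<^sup>2 - 1"
    unfolding A using nz by (simp add: field_simps power2_eq_square)
qed

text \<open>Separates the path from the field theory. All points lie in \<open>L\<close> because
  \<open>phi\<close> leads back from the last one; they then descend to \<open>F\<close> one after
  the other, as \<open>x (Suc i) - A\<close> is a square root in \<open>L\<close> of an element of
  \<open>F\<close>.\<close>

lemma backward_path_descent:
  assumes path: "backward_path a c \<alpha> n x" and F: "subfield_C F" "subfield_C L" "F \<subseteq> L"
    and mem: "a \<in> F" "c \<in> F" "\<alpha> \<in> F" "a \<noteq> 0" and xn: "x n \<in> L"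
    and sqrt: "\<And>i A s. i < n \<Longrightarrow> x i \<in> F \<Longrightarrow> A = (x i - c) / (2 * a) \<Longrightarrow> A \<in> F \<Longrightarrow> s \<in> L \<Longrightarrow> s\<^sup>2 = A\<^sup>2 - 1 \<Longrightarrow> s \<in> F"
  shows "x n \<in> F"
proof -
  note FR = subfield_subring[OF F(1)] and LR = subfield_subring[OF F(2)]
  have "i \<le> n \<Longrightarrow> x i \<in> F" for i
  proof (induction i)
    case 0
    then show ?case using path mem by (simp add: backward_path_def)
  next
    case (Suc i)
    define A where "A = (x i - c) / (2 * a)"
    have "2 * a \<in> F" using mem subring_add[OF FR mem(1) mem(1)] by simp
    then have A: "A \<in> F"
      unfolding A_def using Suc mem by (intro subfield_divide[OF F(1)] subring_diff[OF FR]) auto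
    have "x (Suc i) \<in> L" using backward_path_mem[OF path F(2) _ _ xn] mem F(3) Suc.prems by blast
    then have "x (Suc i) - A \<in> L" using A F(3) subring_diff[OF LR] by blast
    then have "x (Suc i) - A \<in> F"
      using sqrt[of i A "x (Suc i) - A"] Suc A backward_step(1)[OF path, of i] mem(4) by (simp add: A_def)
    then show ?case using subring_add[OF FR _ A] by fastforce
  qed
  then show ?thesis by simp
qed

subsection \<open>Removing odd primes from the conductor\<close>

context
  fixes K a c \<alpha> assumes K: "number_field K" and mem: "a \<in> K" "c \<in> K" "\<alpha> \<in> K" "a \<noteq> 0"
begin

text \<open>Because \<open>q dvd M\<close>, the smaller field contains the \<open>q\<close>-th roots
  of unity, and the larger one arises from it by adjoining the \<open>q\<close>-th root
  \<open>zeta (q * M)\<close> of \<open>zeta M\<close>: the situation of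
  \<open>kummer_descent\<close>.\<close>

lemma odd_prime_power_descent:
  assumes q: "prime q" "odd q" "q dvd M" and M: "M > 0"
    and path: "backward_path a c \<alpha> n x" "x n \<in> cyclotomic_ext K (q * M)"
  shows "x n \<in> cyclotomic_ext K M"
proof (rule backward_path_descent[OF path(1) _ _ _ _ _ _ mem(4) path(2)])
  have qM: "q * M > 0" using q M prime_gt_0_nat by simp
  note E = cyclotomic_adjoin(2)[OF K M] and L = cyclotomic_adjoin(2)[OF K qM]
  show "subfield_C (cyclotomic_ext K M)" "subfield_C (cyclotomic_ext K (q * M))"
    using E L number_field_subfield by auto
  show "cyclotomic_ext K M \<subseteq> cyclotomic_ext K (q * M)" using cyclotomic_mono[OF K M qM] by simp
  show "a \<in> cyclotomic_ext K M" "c \<in> cyclotomic_ext K M" "\<alpha> \<in> cyclotomic_ext K M"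
    using cyclotomic_subset[OF K M] mem by auto
  fix i A s assume A: "A \<in> cyclotomic_ext K M" and s: "s \<in> cyclotomic_ext K (q * M)" "s\<^sup>2 = A\<^sup>2 - 1"
  note ER = number_field_subring[OF E]
  show "s \<in> cyclotomic_ext K M"
  proof (rule kummer_descent[OF number_field_subfield[OF E] q(1,2)])
    show "zeta (q * M) ^ q \<in> cyclotomic_ext K M"
      using zeta_mult_power[of q M] prime_gt_0_nat[OF q(1)] zeta_mem_cyclotomic[OF K M, of M] by simp
    show "zeta (q * M) \<noteq> 0" by (simp add: zeta_def)
    show "z \<in> cyclotomic_ext K M" if "z ^ q = 1" for z
      using roots_of_unity_power[OF prime_gt_0_nat[OF q(1)] that] zeta_mem_cyclotomic[OF K M q(3)]
        subring_power[OF ER] by auto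
    show "s\<^sup>2 \<in> cyclotomic_ext K M" unfolding s(2)
      using A ER by (intro subring_diff subring_power subring_one)
    have "cyclotomic_ext K (q * M) \<subseteq> adjoin (cyclotomic_ext K M) (zeta (q * M))"
      using adjoin_subset[OF ER] cyclotomic_subset[OF K M] adjoin_self[OF ER] qM
      by (intro cyclotomic_least[OF K subring_adjoin[OF ER]]) auto
    then show "s \<in> adjoin (cyclotomic_ext K M) (zeta (q * M))" using s(1) by blast
  qed
qed

end

text \<open>Checked in each valuation ring. If \<open>w\<close> is integral there, both claims are
  clear; otherwise \<open>poly p w = 0\<close> replaces the part of degree at least \<open>j\<close>
  by the part below \<open>j\<close>, which leaves only powers of \<open>inverse w\<close>.\<close>

lemma horner_integral:
  assumes p: "poly_over \<int> p" "poly p w = 0" and j: "j > 0"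
  shows "alg_int (\<Sum>i\<in>{j..degree p}. coeff p i * w ^ (i - j))" (is "alg_int ?b")
    and "alg_int ((\<Sum>i\<in>{j..degree p}. coeff p i * w ^ (i - j)) * w)"
proof -
  have "?b \<in> V \<and> ?b * w \<in> V" if "valuation_ring V" for V
  proof -
    interpret valuation_ring V by fact
    have cV: "coeff p i \<in> V" for i using poly_over_coeff[OF p(1)] Ints_subset by blast
    show ?thesis
    proof (cases "w \<in> V")
      case True
      then have "?b \<in> V" using cV by (intro sum_mem mult_mem power_mem)
      then show ?thesis using True mult_mem by blast
    next
      case False
      then have w: "inverse w \<in> V" "w \<noteq> 0" using total zero_mem by auto
      show ?thesis
      proof (cases "j \<le> degree p")
        case True
        have "{..degree p} = {..<j} \<union> {j..degree p}" using True by auto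
        then have "(\<Sum>i<j. coeff p i * w ^ i) + (\<Sum>i\<in>{j..degree p}. coeff p i * w ^ i) = 0"
          using p(2) unfolding poly_altdef by (subst sum.union_disjoint[symmetric]) auto
        moreover have "(\<Sum>i\<in>{j..degree p}. coeff p i * w ^ i) = ?b * w ^ j"
          unfolding sum_distrib_right by (intro sum.cong) (auto simp: mult.assoc simp flip: power_add)
        ultimately have bw: "?b * w ^ j = - (\<Sum>i<j. coeff p i * w ^ i)"
          by (simp add: eq_neg_iff_add_eq_0 add.commute)
        have 1: "w ^ i * inverse w ^ j = inverse w ^ (j - i)" if "i \<le> j" for i
          using that w(2) by (simp add: power_diff field_simps)
        have "?b = (?b * w ^ j) * inverse w ^ j" using w(2) by (simp add: field_simps)
        also have "\<dots> = - (\<Sum>i<j. coeff p i * (w ^ i * inverse w ^ j))"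
          unfolding bw by (simp add: sum_distrib_right mult.assoc)
        also have "\<dots> = - (\<Sum>i<j. coeff p i * inverse w ^ (j - i))"
          using 1 by simp
        finally have b: "?b = - (\<Sum>i<j. coeff p i * inverse w ^ (j - i))" .
        have "?b * w = - (\<Sum>i<j. coeff p i * (inverse w ^ (j - i) * w))"
          unfolding b by (simp add: sum_distrib_right mult.assoc)
        also have "\<dots> = - (\<Sum>i<j. coeff p i * inverse w ^ (j - i - 1))"
        proof -
          have "inverse w ^ (j - i) * w = inverse w ^ (j - i - 1)" if "i < j" for i
          proof -
            obtain m where m: "j - i = Suc m" using \<open>i < j\<close> by (cases "j - i") auto
            show ?thesis unfolding m using w(2) by simp
          qed
          then show ?thesis by simp
        qed
        finally have b': "?b * w = - (\<Sum>i<j. coeff p i * inverse w ^ (j - i - 1))" .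
        have "- (\<Sum>i<j. coeff p i * inverse w ^ (j - i)) \<in> V" "- (\<Sum>i<j. coeff p i * inverse w ^ (j - i - 1)) \<in> V"
          using cV w by (auto intro!: uminus_mem sum_mem mult_mem power_mem)
        then show ?thesis unfolding b' by (simp only: b)
      qed (use zero_mem in simp)
    qed
  qed
  then show "alg_int ?b" "alg_int (?b * w)" using alg_intI by auto
qed

lemma integral_multiple:
  assumes "algebraic_number y" shows "\<exists>l>0. alg_int (of_nat l * y)"
proof (cases "y = 0")
  case True
  then show ?thesis by (intro exI[of _ 1]) (auto simp: alg_int_iff valuation_ring.zero_mem)
next
  case False
  obtain p where p: "poly_over \<int> p" "coeff p 0 \<noteq> 0" "poly p y = 0"
    using algebraic_integer_poly[OF assms False] .
  have "lead_coeff p \<in> \<int>" "lead_coeff p \<noteq> 0" using p poly_over_coeff by auto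
  then obtain n where n: "lead_coeff p = of_int n" "n \<noteq> 0" by (metis Ints_cases of_int_0)
  have "degree p > 0" using p by (metis degree_eq_zeroE gr0I mult_zero_right poly_0 poly_pCons add_0_right coeff_pCons_0)
  then have i: "alg_int (of_int n * y)" using horner_integral(2)[OF p(1,3), of "degree p"] n by simp
  have "of_nat (nat \<bar>n\<bar>) * y \<in> V" if V: "valuation_ring V" for V
    using alg_int_mem[OF V i] valuation_ring.uminus_mem[OF V] by (cases "n \<ge> 0") fastforce+
  then show ?thesis using n(2) by (intro exI[of _ "nat \<bar>n\<bar>"]) (auto simp: alg_int_iff)
qed

section \<open>Common denominators, and control of two numbers by their product and sum of
  squares\<close>

lemma alg_int_ring:
  shows alg_int_diff: "alg_int x \<Longrightarrow> alg_int y \<Longrightarrow> alg_int (x - y)"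
    and alg_int_mult: "alg_int x \<Longrightarrow> alg_int y \<Longrightarrow> alg_int (x * y)"
    and alg_int_of_int: "alg_int (of_int k)"
    and alg_int_of_nat: "alg_int (of_nat n)"
  by (auto simp: alg_int_iff valuation_ring.diff_mem
      valuation_ring.mult_mem valuation_ring.of_int_mem valuation_ring.of_nat_mem)

lemma alg_int_common_multiple:
  assumes "finite S" "\<And>y. y \<in> S \<Longrightarrow> algebraic_number y"
  shows "\<exists>l>0. \<forall>y\<in>S. alg_int (of_nat l * y)"
  using assms
proof (induction S rule: finite_induct)
  case empty
  show ?case by (intro exI[of _ 1]) auto
next
  case (insert y S)
  then obtain l where l: "l > 0" "\<forall>y\<in>S. alg_int (of_nat l * y)" by auto
  obtain m where m: "m > 0" "alg_int (of_nat m * y)" using integral_multiple insert by blast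
  have "alg_int (of_nat (l * m) * z)" if "z \<in> insert y S" for z
  proof (cases "z = y")
    case True
    have "of_nat (l * m) * z = of_nat l * (of_nat m * y)" using True by simp
    then show ?thesis using m alg_int_mult alg_int_of_nat by metis
  next
    case False
    have "of_nat (l * m) * z = of_nat m * (of_nat l * z)" by simp
    then show ?thesis using l that False alg_int_mult alg_int_of_nat by (metis insertE)
  qed
  then show ?case using l m by (intro exI[of _ "l * m"]) auto
qed

text \<open>\<open>x\<close> is a root of
  \<open>X^4 - (x^2 + y^2) * X^2 + (x * y)^2\<close>.\<close>

lemma alg_int_sum_prod:
  assumes "alg_int (x\<^sup>2 + y\<^sup>2)" "alg_int (x * y)" shows "alg_int x"
proof (rule alg_intI)
  fix V assume V: "valuation_ring V"
  interpret valuation_ring V by fact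
  have m: "x\<^sup>2 + y\<^sup>2 \<in> V" "x * y \<in> V" using assms alg_int_mem[OF V] by auto
  show "x \<in> V"
  proof (rule integral_mem)
    let ?f = "[:(x * y)\<^sup>2, 0, - (x\<^sup>2 + y\<^sup>2), 0, 1:] :: complex poly"
    show "poly_over V ?f"
      by (intro poly_over_pCons[OF subring] poly_over_0[OF subring] power_mem uminus_mem m zero_mem one_mem)
    show "poly ?f x = 0" by (simp add: power2_eq_square algebra_simps)
  qed simp
qed

text \<open>The squares of \<open>x + y\<close> and \<open>x - y\<close> are
  \<open>x^2 + y^2\<close> plus or minus \<open>2 * x * y\<close>, so \<open>house_sqrt\<close>
  bounds both, and \<open>x\<close> is their mean.\<close>

lemma house_sum_prod:
  assumes "house_le (x\<^sup>2 + y\<^sup>2) S" "house_le (x * y) P" "0 \<le> S" "0 \<le> P" and M: "S + 2 * P \<le> M\<^sup>2" "M > 0"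
  shows "house_le x M"
proof -
  have 2: "house_le (2 * (x * y)) (2 * P)"
    using house_mult[OF house_rat[of 2] assms(2)] by simp
  have "house_le ((x + y)\<^sup>2) (S + 2 * P)"
    using house_add[OF assms(1) 2 assms(3)] by (simp add: power2_sum add.assoc mult.assoc)
  then have p: "house_le (x + y) M"
    using house_sqrt[OF house_mono[OF _ _ M(1)] M(2)] assms(3,4) by simp
  have "house_le ((x - y)\<^sup>2) (S + 2 * P)"
    using house_diff[OF assms(1) 2 assms(3)] by (simp add: power2_diff mult.assoc)
  then have m: "house_le (x - y) M"
    using house_sqrt[OF house_mono[OF _ _ M(1)] M(2)] assms(3,4) by simp
  have "house_le (of_rat (1 / 2) * ((x + y) + (x - y))) (\<bar>of_rat (1 / 2)\<bar> * (M + M))"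
    using house_mult[OF house_rat[of "1 / 2"] house_add[OF p m]] M(2) by auto
  moreover have "of_rat (1 / 2) * ((x + y) + (x - y)) = x" by (simp add: of_rat_divide)
  moreover have "\<bar>of_rat (1 / 2)\<bar> * (M + M) = M" by (simp add: of_rat_divide)
  ultimately show ?thesis by metis
qed

subsection \<open>Bounded integral representations of the backward orbit\<close>

text \<open>If \<open>x = X/Y\<close> then a preimage \<open>X'/Y'\<close> of \<open>x\<close> can be normalised by \<open>X' Y' = l a Y\<close> and
  \<open>X'\<^sup>2 + Y'\<^sup>2 = l (X - c Y)\<close>; a square root is taken in each step, hence the uniform house bound.\<close>

lemma backward_path_integral_model:
  assumes K: "number_field K" and mem: "a \<in> K" "c \<in> K" "\<alpha> \<in> K" "a \<noteq> 0"
  shows "\<exists>l>0. \<exists>M>0. alg_int (of_nat l * a) \<and> alg_int (of_nat l * c) \<and>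
     (\<forall>n x i. backward_path a c \<alpha> n x \<longrightarrow> i \<le> n \<longrightarrow>
        (\<exists>X Y. alg_int X \<and> alg_int Y \<and> Y \<noteq> 0 \<and> x i = X / Y \<and> house_le X M \<and> house_le Y M))"
proof -
  obtain l where l: "l > 0" "\<forall>y\<in>{a, c, \<alpha>}. alg_int (of_nat l * y)"
    using alg_int_common_multiple[of "{a, c, \<alpha>}"] number_field_algebraic[OF K] mem by auto
  obtain ha hc h\<alpha> where h: "ha \<ge> 0" "house_le a ha" "hc \<ge> 0" "house_le c hc" "h\<alpha> \<ge> 0" "house_le \<alpha> h\<alpha>"
    using house_exists[OF K] mem by metis
  \<comment> \<open>If \<open>X\<close> and \<open>Y\<close> have house at most \<open>M\<close>,
    then the quantity \<open>S + 2 * P\<close> of \<open>house_sum_prod\<close> is at most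
    \<open>k * M\<close>. Choosing \<open>M \<ge> k\<close> makes this at most \<open>M^2\<close>,
    so the bound \<open>M\<close> reproduces itself.\<close>
  define k where "k = real l * (1 + hc) + 2 * (real l * ha)"
  define M where "M = max 1 (max k (max (real l) (real l * h\<alpha>)))"
  have M: "M \<ge> 1" "k \<le> M" "real l \<le> M" "real l * h\<alpha> \<le> M" by (auto simp: M_def)
  have hl: "house_le (of_nat l) (real l)" using house_rat[of "of_nat l"] by simp
  have "\<exists>X Y. alg_int X \<and> alg_int Y \<and> Y \<noteq> 0 \<and> x i = X / Y \<and> house_le X M \<and> house_le Y M"
    if path: "backward_path a c \<alpha> n x" and i: "i \<le> n" for n x i
    using i
  proof (induction i)
    case 0
    have "house_le (of_nat l * \<alpha>) M" using house_mult[OF hl h(6)] h M by (intro house_mono[OF _ _ M(4)]) auto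
    moreover have "house_le (of_nat l) M" using hl M by (intro house_mono[OF _ _ M(3)]) auto
    ultimately show ?case using l path alg_int_of_nat
      by (intro exI[of _ "of_nat l * \<alpha>"] exI[of _ "of_nat l"]) (auto simp: backward_path_def)
  next
    case (Suc i)
    then obtain X Y where XY: "alg_int X" "alg_int Y" "Y \<noteq> 0" "x i = X / Y" "house_le X M" "house_le Y M"
      by auto
    define y where "y = x (Suc i)"
    have y: "y \<noteq> 0" "x i - c = a * (y + 1 / y)"
      using backward_step[OF path, of i] Suc.prems mem(4) by (auto simp: y_def)
    \<comment> \<open>This root may leave the field of the path. That is harmless, since integrality
      and house do not refer to a field.\<close>
    define Y' where "Y' = csqrt (of_nat l * a * Y / y)"
    define X' where "X' = y * Y'"
    have Y'2: "Y'\<^sup>2 = of_nat l * a * Y / y" by (simp add: Y'_def)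
    have Y'0: "Y' \<noteq> 0" using Y'2 l mem(4) XY(3) y(1) by auto
    have "X' * Y' = y * Y'\<^sup>2" by (simp add: X'_def power2_eq_square)
    then have prod: "X' * Y' = of_nat l * a * Y" unfolding Y'2 using y(1) by simp
    have "X - c * Y = a * (y + 1 / y) * Y" using y(2) XY(3,4) by (simp add: field_simps)
    moreover have "X'\<^sup>2 + Y'\<^sup>2 = (y + 1 / y) * (y * Y'\<^sup>2)"
      using y(1) by (simp add: X'_def power2_eq_square field_simps)
    moreover have "y * Y'\<^sup>2 = of_nat l * a * Y" unfolding Y'2 using y(1) by simp
    ultimately have sum: "X'\<^sup>2 + Y'\<^sup>2 = of_nat l * (X - c * Y)" by (simp only: mult_ac)
    have "of_nat l * (X - c * Y) = of_nat l * X - (of_nat l * c) * Y" "of_nat l * a * Y = (of_nat l * a) * Y"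
      by (simp_all add: algebra_simps)
    then have int: "alg_int (of_nat l * (X - c * Y))" "alg_int (of_nat l * a * Y)"
      using l XY alg_int_diff alg_int_mult alg_int_of_nat by auto
    have h1: "house_le (of_nat l * (X - c * Y)) (real l * (M + hc * M))"
      using XY h M by (intro house_mult hl house_diff) auto
    have h2: "house_le (of_nat l * a * Y) (real l * ha * M)"
      using XY h M by (intro house_mult hl) auto
    have "real l * (M + hc * M) + 2 * (real l * ha * M) = k * M" by (simp add: k_def algebra_simps)
    also have "\<dots> \<le> M\<^sup>2" using M by (simp add: power2_eq_square)
    finally have bound: "real l * (M + hc * M) + 2 * (real l * ha * M) \<le> M\<^sup>2" .
    have nn: "0 \<le> real l * (M + hc * M)" "0 \<le> real l * ha * M" "M > 0" using h M by auto
    have "house_le X' M" "house_le Y' M"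
      using house_sum_prod[of X' Y', unfolded sum prod, OF h1 h2 nn(1,2) bound nn(3)]
        house_sum_prod[of Y' X', unfolded add.commute[of "Y'\<^sup>2"] mult.commute[of Y'] sum prod, OF h1 h2 nn(1,2) bound nn(3)]
      by auto
    moreover have "alg_int X'" "alg_int Y'"
      using alg_int_sum_prod[of X' Y', unfolded sum prod] int
        alg_int_sum_prod[of Y' X', unfolded add.commute[of "Y'\<^sup>2"] mult.commute[of Y'] sum prod] by auto
    moreover have "x (Suc i) = X' / Y'" using Y'0 by (simp add: X'_def y_def)
    ultimately show ?case using Y'0 by blast
  qed
  then show ?thesis using l M by (intro exI[of _ l] conjI exI[of _ M]) auto
qed

text \<open>For \<open>x i = X / Y\<close> in the integral model,
  \<open>T = (2 * l * a * Y)^2 * (A^2 - 1)\<close> is an algebraic integer whose house is bounded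
  independently of the path. If the step needs \<open>zeta q\<close>, then \<open>q\<close> divides
  \<open>A^2 - 1\<close> at every valuation ring above \<open>q\<close>, so \<open>T / q\<close> is
  an integer of house less than 1. Hence \<open>T = 0\<close>, and the square root to be taken is
  0.\<close>

lemma good_prime_descent:
  assumes K: "number_field K" and mem: "a \<in> K" "c \<in> K" "\<alpha> \<in> K" "a \<noteq> 0"
  shows "\<exists>N. \<forall>q M n x. prime q \<longrightarrow> q > N \<longrightarrow> M > 0 \<longrightarrow> \<not> q dvd M \<longrightarrow> backward_path a c \<alpha> n x \<longrightarrow>
     x n \<in> cyclotomic_ext K (q * M) \<longrightarrow> x n \<in> cyclotomic_ext K M"
proof -
  obtain l B where l: "l > 0" "alg_int (of_nat l * a)" "alg_int (of_nat l * c)" and B: "B > 0"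
    and model: "\<And>n x i. backward_path a c \<alpha> n x \<Longrightarrow> i \<le> n \<Longrightarrow>
        \<exists>X Y. alg_int X \<and> alg_int Y \<and> Y \<noteq> 0 \<and> x i = X / Y \<and> house_le X B \<and> house_le Y B"
    using backward_path_integral_model[OF K mem] by (elim exE conjE) (rule that; blast)
  obtain ha hc where h: "ha \<ge> 0" "house_le a ha" "hc \<ge> 0" "house_le c hc"
    using house_exists[OF K] mem by metis
  have hl: "house_le (of_nat l) (real l)" using house_rat[of "of_nat l"] by simp
  \<comment> \<open>Bounds the house of the number \<open>T\<close> below. The primes treated are
    odd, unramified in \<open>K\<close> and larger than \<open>H\<close>.\<close>
  define H where "H = (real l * (B + hc * B))\<^sup>2 + (2 * (real l * ha * B))\<^sup>2"
  obtain N where N: "\<And>q V. q \<ge> N \<Longrightarrow> residue_char V q \<Longrightarrow> residue_char.unramified V q K"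
    using almost_all_primes_unramified[OF K] unfolding eventually_sequentially by blast
  have main: "x n \<in> cyclotomic_ext K M"
    if q: "prime q" "q > max 2 (max N (nat \<lceil>H\<rceil>))" and M: "M > 0" "\<not> q dvd M"
      and path: "backward_path a c \<alpha> n x" and xn: "x n \<in> cyclotomic_ext K (q * M)" for q M n x
  proof -
    have q2: "q > 2" "q \<ge> N" "real q > H" using q(2) by (auto, linarith)
    then have odd: "odd q" using q(1) prime_odd_nat by blast
    have qM: "q * M > 0" using q M prime_gt_0_nat by simp
    define E where "E = cyclotomic_ext K M"
    have E: "number_field E" unfolding E_def using cyclotomic_adjoin(2)[OF K M(1)] .
    note ER = number_field_subring[OF E] and EF = number_field_subfield[OF E]
    have KE: "K \<subseteq> E" unfolding E_def using cyclotomic_subset[OF K M(1)] .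
    have L: "number_field (adjoin E (zeta q))"
      using number_field_adjoin_root_of_unity[OF E] prime_gt_0_nat[OF q(1)] by blast
    have EL: "E \<subseteq> adjoin E (zeta q)" using adjoin_subset[OF ER] .
    have "zeta M \<in> adjoin E (zeta q)" "zeta q \<in> adjoin E (zeta q)"
      using zeta_mem_cyclotomic[OF K M(1), of M] EL adjoin_self[OF ER] by (auto simp: E_def)
    moreover have "coprime q M" using prime_imp_coprime[OF q(1) M(2)] .
    ultimately have "zeta (q * M) \<in> adjoin E (zeta q)"
      using zeta_coprime_split[OF number_field_subfield[OF L], of q M] prime_gt_0_nat[OF q(1)] M(1) by blast
    then have "cyclotomic_ext K (q * M) \<subseteq> adjoin E (zeta q)"
      using cyclotomic_least[OF K number_field_subring[OF L] _ qM] KE EL by blast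
    then have xnL: "x n \<in> adjoin E (zeta q)" using xn by blast
    have unr: "residue_char.unramified V q E" if "residue_char V q" for V
    proof -
      interpret residue_char V q by fact
      show ?thesis unfolding E_def cyclotomic_adjoin(1)[OF K M(1)]
        using unramified_root_of_unity[OF K N[OF q2(2) that] zeta_power_self[OF M(1)] M(1,2)] .
    qed
    have "x n \<in> E"
    proof (rule backward_path_descent[OF path EF number_field_subfield[OF L] EL _ _ _ mem(4) xnL])
      show "a \<in> E" "c \<in> E" "\<alpha> \<in> E" using mem KE by auto
      fix i A s assume i: "i < n" "A = (x i - c) / (2 * a)" and A: "A \<in> E"
        and s: "s \<in> adjoin E (zeta q)" "s\<^sup>2 = A\<^sup>2 - 1"
      show "s \<in> E"
      proof (rule ccontr)
        assume sE: "s \<notin> E"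
        obtain X Y where XY: "alg_int X" "alg_int Y" "Y \<noteq> 0" "x i = X / Y" "house_le X B" "house_le Y B"
          using model[OF path, of i] i by auto
        define T where "T = (of_nat l * (X - c * Y))\<^sup>2 - (of_rat 2 * (of_nat l * a * Y))\<^sup>2"
        have TD: "T = 4 * (of_nat l * a * Y)\<^sup>2 * (A\<^sup>2 - 1)"
          unfolding T_def i(2) XY(4) using XY(3) mem(4) by (simp add: field_simps power2_eq_square)
        have "T / of_nat q \<in> V" if V: "valuation_ring V" for V
        proof -
          interpret valuation_ring V by fact
          have memV: "X \<in> V" "Y \<in> V" "of_nat l * a \<in> V" "of_nat l * c \<in> V"
            using XY l alg_int_mem[OF V] by auto
          show ?thesis
          proof (cases "vlt (of_nat q) 1")
            case True
            then have rc: "residue_char V q" using q(1) by unfold_locales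
            interpret residue_char V q by fact
            have "vle (A\<^sup>2 - 1) (of_nat q)"
              using sqrt_step_descent[OF E unr[OF rc] odd zeta_power_self zeta_neq_1 A s sE] q2 by simp
            then have "(A\<^sup>2 - 1) / of_nat q \<in> V" using vle_iff_divide[OF q_nonzero] by blast
            then have "4 * (of_nat l * a * Y)\<^sup>2 * ((A\<^sup>2 - 1) / of_nat q) \<in> V"
              using mult_mem[OF mult_mem[OF numeral_mem power_mem[OF mult_mem[OF memV(3,2)]]]] by blast
            then show ?thesis unfolding TD by simp
          next
            case False
            then have "inverse (of_nat q) \<in> V" using vlt_one_iff by blast
            moreover have "T = (of_nat l * X - (of_nat l * c) * Y)\<^sup>2 - (2 * ((of_nat l * a) * Y))\<^sup>2"
              unfolding T_def by (simp add: algebra_simps)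
            then have "T \<in> V" using memV by (simp add: diff_mem power_mem mult_mem)
            ultimately show ?thesis unfolding divide_inverse using mult_mem by blast
          qed
        qed
        then have int: "alg_int (T / of_nat q)" by (rule alg_intI)
        have nn: "0 \<le> real l * (B + hc * B)" "0 \<le> real l * ha * B" using h B by auto
        have h1: "house_le (of_nat l * (X - c * Y)) (real l * (B + hc * B))"
          using XY h B by (intro house_mult hl house_diff) auto
        have h2: "house_le (of_rat 2 * (of_nat l * a * Y)) (2 * (real l * ha * B))"
          using house_mult[OF house_rat[of 2] house_mult[OF house_mult[OF hl h(2)] XY(6)]] h B by simp
        have "house_le T H"
          unfolding T_def H_def power2_eq_square
          by (rule house_diff[OF house_mult[OF h1 h1 nn(1)] house_mult[OF h2 h2]]) (use nn in auto)
        then have "house_le (of_rat (1 / of_nat q) * T) (\<bar>of_rat (1 / of_nat q)\<bar> * H)"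
          by (intro house_mult house_rat) auto
        moreover have "of_rat (1 / of_nat q) * T = T / of_nat q" by (simp add: of_rat_divide)
        moreover have "\<bar>of_rat (1 / of_nat q)\<bar> * H = H / real q" by (simp add: of_rat_divide)
        ultimately have "house_le (T / of_nat q) (H / real q)" by metis
        moreover have "H \<ge> 0" "H / real q < 1" using q2 by (auto simp: H_def)
        ultimately have "T / of_nat q = 0" using integral_house_less_1[OF int] by simp
        then have "A\<^sup>2 - 1 = 0" unfolding TD using l(1) mem(4) XY(3) q2 by simp
        then have "s = 0" using s(2) by simp
        then show False using sE subring_zero[OF ER] by simp
      qed
    qed
    then show ?thesis by (simp add: E_def)
  qed
  then show ?thesis by blast
qed

section \<open>Ramification at 2 in the cyclotomic tower\<close>

text \<open>The nontrivial automorphism of the quadratic extension \<open>F(s)\<close>; the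
  description determines it only if \<open>s \<notin> F\<close>.\<close>

definition qconj :: "complex set \<Rightarrow> complex \<Rightarrow> complex \<Rightarrow> complex" where
  "qconj F s x = (THE y. \<exists>p\<in>F. \<exists>q\<in>F. x = p + q * s \<and> y = p - q * s)"

context
  fixes F s assumes F: "subfield_C F" and s: "s^2 \<in> F" "s \<notin> F"
begin

lemma qconj_eq:
  assumes "p \<in> F" "q \<in> F" shows "qconj F s (p + q * s) = p - q * s"
  unfolding qconj_def
proof (rule the_equality)
  show "\<exists>p'\<in>F. \<exists>q'\<in>F. p + q * s = p' + q' * s \<and> p - q * s = p' - q' * s" using assms by blast
  fix y assume "\<exists>p'\<in>F. \<exists>q'\<in>F. p + q * s = p' + q' * s \<and> y = p' - q' * s"
  then obtain p' q' where "p' \<in> F" "q' \<in> F" "p + q * s = p' + q' * s" "y = p' - q' * s" by blast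
  then show "y = p - q * s" using quadratic_unique[OF F s(2) assms] by auto
qed

lemma qconj_base: "x \<in> F \<Longrightarrow> qconj F s x = x"
  using qconj_eq[of x 0] subring_zero[OF subfield_subring[OF F]] by simp

lemma qconj_gen: "qconj F s s = - s"
  using qconj_eq[of 0 1] subring_zero[OF subfield_subring[OF F]] subring_one[OF subfield_subring[OF F]] by simp

lemma qconj_ring:
  assumes x: "x \<in> adjoin F s" and y: "y \<in> adjoin F s"
  shows "qconj F s (x + y) = qconj F s x + qconj F s y"
    and "qconj F s (x * y) = qconj F s x * qconj F s y"
    and "qconj F s x \<in> adjoin F s" and "x + qconj F s x \<in> F" and "x * qconj F s x \<in> F"
proof -
  note FR = subfield_subring[OF F]
  obtain p q where m: "p \<in> F" "q \<in> F" "x = p + q * s" using adjoin_quadratic[OF FR s(1) x] .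
  obtain p' q' where m': "p' \<in> F" "q' \<in> F" "y = p' + q' * s" using adjoin_quadratic[OF FR s(1) y] .
  have cx: "qconj F s x = p - q * s" and cy: "qconj F s y = p' - q' * s"
    using qconj_eq m m' by auto
  have "x + y = (p + p') + (q + q') * s" by (simp add: m m' algebra_simps)
  then have "qconj F s (x + y) = (p + p') - (q + q') * s"
    by (simp only: qconj_eq[OF subring_add[OF FR m(1) m'(1)] subring_add[OF FR m(2) m'(2)]])
  then show "qconj F s (x + y) = qconj F s x + qconj F s y" by (simp add: cx cy algebra_simps)
  have mem: "p * p' + q * q' * s^2 \<in> F" "p * q' + q * p' \<in> F"
    using m m' s(1) subring_add[OF FR] subring_mult[OF FR] by simp_all
  have "x * y = (p * p' + q * q' * s^2) + (p * q' + q * p') * s"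
    by (simp add: m m' power2_eq_square algebra_simps)
  then have "qconj F s (x * y) = (p * p' + q * q' * s^2) - (p * q' + q * p') * s"
    by (simp only: qconj_eq[OF mem])
  then show "qconj F s (x * y) = qconj F s x * qconj F s y"
    by (simp add: cx cy power2_eq_square algebra_simps)
  have eq: "x + qconj F s x = p + p" "x * qconj F s x = p * p - q * q * s^2"
    unfolding cx by (simp_all add: m power2_eq_square algebra_simps)
  show "x + qconj F s x \<in> F" "x * qconj F s x \<in> F"
    unfolding eq by (intro subring_add[OF FR] subring_diff[OF FR] subring_mult[OF FR] m(1,2) s(1))+
  show "qconj F s x \<in> adjoin F s"
    using adjoinI_quadratic[OF FR m(1) subring_uminus[OF FR m(2)], of s] by (simp add: cx)
qed

end

text \<open>In the square of \<open>p + q * s\<close> the mixed term must vanish, so only the class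
  of \<open>s\<close> itself becomes a square.\<close>

lemma quadratic_square:
  assumes F: "subfield_C F" and s: "s^2 \<in> F" "s \<notin> F" and x: "x \<in> adjoin F s" "x^2 \<in> F" "x \<notin> F"
  obtains q where "q \<in> F" "q \<noteq> 0" "x = q * s"
proof -
  note FR = subfield_subring[OF F]
  obtain p q where pq: "p \<in> F" "q \<in> F" "x = p + q * s" using adjoin_quadratic[OF FR s(1) x(1)] .
  have mem: "p^2 + q^2 * s^2 \<in> F" "2 * p * q \<in> F"
    using pq(1,2) s(1) subring_add[OF FR] subring_mult[OF FR] subring_power[OF FR] subring_of_nat[OF FR, of 2] by simp_all
  have "(p^2 + q^2 * s^2) + (2 * p * q) * s = x^2 + 0 * s"
    by (simp add: pq power2_eq_square algebra_simps)
  then have "2 * p * q = 0"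
    using quadratic_unique(2)[OF F s(2) mem x(2) subring_zero[OF FR]] by blast
  moreover have "q \<noteq> 0" using pq x(3) by auto
  ultimately show ?thesis using that[of q] pq by simp
qed

section \<open>The tower of roots of unity of 2-power order, seen at a place above 2\<close>

locale dyadic_tower = residue_char V 2 for V +
  fixes F0 :: "complex set"
  assumes F0: "number_field F0"
begin

definition tower :: "nat \<Rightarrow> complex set" where
  "tower e = cyclotomic_ext F0 (2 ^ e)"

definition z :: "nat \<Rightarrow> complex" where
  "z e = zeta (2 ^ e)"

lemma two_small: "vlt 2 1"
  using q_small by simp

lemma tower_nf: "number_field (tower e)"
  using cyclotomic_adjoin(2)[OF F0] by (simp add: tower_def)

lemmas tower_ring = number_field_subring[OF tower_nf]
lemmas tower_field = number_field_subfield[OF tower_nf]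

lemma z_mem: "z e \<in> tower e"
  using zeta_mem_cyclotomic[OF F0] by (simp add: z_def tower_def)

lemma z_square: "(z (Suc e))^2 = z e"
  using zeta_mult_power[of 2 "2 ^ e"] by (simp add: z_def)

lemma z_nonzero: "z e \<noteq> 0"
  by (simp add: z_def zeta_def)

lemma tower_mono: "e \<le> f \<Longrightarrow> tower e \<subseteq> tower f"
  using cyclotomic_mono[OF F0] by (simp add: tower_def le_imp_power_dvd)

lemma tower_base: "F0 \<subseteq> tower e"
  using cyclotomic_subset[OF F0] by (simp add: tower_def)

lemma tower_Suc: "tower (Suc e) = adjoin (tower e) (z (Suc e))"
proof
  show "tower (Suc e) \<subseteq> adjoin (tower e) (z (Suc e))"
    unfolding tower_def[of "Suc e"]
  proof (rule cyclotomic_least[OF F0 subring_adjoin[OF tower_ring]])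
    show "F0 \<subseteq> adjoin (tower e) (z (Suc e))" using adjoin_subset[OF tower_ring] tower_base by blast
    show "zeta (2 ^ Suc e) \<in> adjoin (tower e) (z (Suc e))"
      using adjoin_self[OF tower_ring] by (simp add: z_def)
  qed simp
  show "adjoin (tower e) (z (Suc e)) \<subseteq> tower (Suc e)"
    using tower_mono[of e "Suc e"] z_mem by (intro adjoin_least[OF tower_ring]) auto
qed

lemma imaginary_unit: "e \<ge> 2 \<Longrightarrow> z 2 \<in> tower e" "(z 2)^2 = - 1"
proof -
  show "e \<ge> 2 \<Longrightarrow> z 2 \<in> tower e" using tower_mono z_mem by blast
  have "(z 2)^2 = z 1" using z_square[of 1] by (simp add: numeral_2_eq_2)
  then show "(z 2)^2 = - 1" by (simp add: z_def zeta_def)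
qed

text \<open>Both notions say that \<open>z e\<close> is not a square up to a factor \<open>1 + t\<close> with small \<open>t\<close>; for
  \<open>t \<in> 4V\<close> such a factor would make the next step of the tower unramified or split at \<open>V\<close>.\<close>

definition ramified :: "nat \<Rightarrow> nat \<Rightarrow> bool" where
  "ramified m e \<longleftrightarrow> (\<forall>b\<in>tower e. \<forall>t\<in>tower e. z e = b^2 * (1 + t) \<longrightarrow> 2 * (t / 4) ^ m \<notin> V)"

definition weakly_ramified :: "nat \<Rightarrow> bool" where
  "weakly_ramified e \<longleftrightarrow> (\<forall>b\<in>tower e. \<forall>t\<in>tower e. z e = b^2 * (1 + t) \<longrightarrow> t / 4 \<notin> V)"

lemma ramified_weakly: "ramified m e \<Longrightarrow> weakly_ramified e"
  unfolding ramified_def weakly_ramified_def using mult_mem[OF numeral_mem power_mem] by blast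

lemma weakly_ramified_not_mem:
  assumes "weakly_ramified e" shows "z (Suc e) \<notin> tower e"
proof
  assume "z (Suc e) \<in> tower e"
  moreover have "z e = (z (Suc e))^2 * (1 + 0)" using z_square by simp
  ultimately show False using assms subring_zero[OF tower_ring] zero_mem
    unfolding weakly_ramified_def by (metis div_0)
qed

text \<open>Only one place lies above \<open>V\<close> in a ramified layer. If
  \<open>y1 \<in> V\<close> had a conjugate \<open>y2 \<notin> V\<close>, then
  \<open>y1 + y2 = 2 * p\<close> would have the value of \<open>y2\<close>, and
  \<open>z e = (p / q)^2 * (1 + t)\<close> for \<open>t = - (y1 * y2) / p^2\<close> with
  \<open>t / 4\<close> integral, contrary to weak ramification.\<close>

lemma conjugate_mem:
  assumes ram: "weakly_ramified e" and p: "p \<in> tower e" "q \<in> tower e" and y: "p + q * z (Suc e) \<in> V"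
  shows "p - q * z (Suc e) \<in> V"
proof (rule ccontr)
  define w where "w = z (Suc e)"
  define y1 where "y1 = p + q * w"
  define y2 where "y2 = p - q * w"
  assume "p - q * z (Suc e) \<notin> V"
  then have "vlt 1 y2" by (simp add: y2_def w_def vlt_def vle_one_iff)
  moreover have "vle y1 1" using y by (simp add: y1_def w_def vle_one_iff)
  ultimately have lt: "vlt y1 y2" and y2: "y2 \<noteq> 0" using vle_vlt_trans by auto
  have "q \<noteq> 0" using lt by (auto simp: y1_def y2_def)
  have sum: "y1 + y2 = 2 * p" and diff: "y1 - y2 = 2 * q * w" by (auto simp: y1_def y2_def)
  have "veq (y2 + y1) y2" using veq_add[OF lt] .
  then have e: "veq (2 * p) y2" using sum by (simp add: add.commute)
  then have "p \<noteq> 0" using y2 by auto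
  define t where "t = - (y1 * y2) / p^2"
  have w2: "w^2 = z e" using z_square by (simp add: w_def)
  have "1 + t = (q * w)^2 / p^2"
    using \<open>p \<noteq> 0\<close> by (simp add: t_def y1_def y2_def field_simps power2_eq_square)
  then have "z e = (p / q)^2 * (1 + t)"
    using \<open>p \<noteq> 0\<close> \<open>q \<noteq> 0\<close> w2 by (simp add: power_divide power_mult_distrib)
  moreover have "p / q \<in> tower e" using p subfield_divide[OF tower_field] by blast
  moreover have "y1 * y2 = p^2 - q^2 * z e"
    using w2 by (simp add: y1_def y2_def power2_eq_square algebra_simps)
  then have "t \<in> tower e" unfolding t_def
    using p z_mem subfield_divide[OF tower_field] subring_uminus[OF tower_ring] subring_diff[OF tower_ring]
      subring_mult[OF tower_ring] subring_power[OF tower_ring] by simp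
  moreover have "t / 4 \<in> V"
  proof -
    have "vle (y1 * y2) (y2 * y2)" using vlt_imp_vle[OF lt] by (intro vle_mult) auto
    moreover have "veq ((2 * p)^2) (y2 * y2)" using veq_power[OF e, of 2] by (simp add: power2_eq_square)
    ultimately have "vle (y1 * y2) ((2 * p)^2)" using veq_vle2 by blast
    then have "y1 * y2 / (2 * p)^2 \<in> V" using vle_iff_divide[of "(2 * p)^2"] \<open>p \<noteq> 0\<close> by simp
    moreover have "t / 4 = - (y1 * y2 / (2 * p)^2)" by (simp add: t_def power2_eq_square)
    ultimately show ?thesis using uminus_mem by metis
  qed
  ultimately show False using ram unfolding weakly_ramified_def by blast
qed

text \<open>Take norms: \<open>z (Suc e) = b^2 * (1 + t)\<close> gives
  \<open>- z e = (b * \<sigma> b)^2 * (1 + t')\<close>, and \<open>- 1\<close> is the square of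
  \<open>z 2\<close> at level \<open>e \<ge> 2\<close>. By \<open>conjugate_mem\<close> the bound
  assumed for \<open>t\<close> holds for \<open>\<sigma> t\<close> and so passes to
  \<open>t'\<close>, against ramification one level below. The exponent \<open>m\<close> is
  unchanged.\<close>

lemma ramified_Suc:
  assumes ram: "ramified m e" and m: "m > 0" and e: "e \<ge> 2"
  shows "ramified m (Suc e)"
  unfolding ramified_def
proof (intro ballI impI notI)
  note weak = ramified_weakly[OF ram]
  define w where "w = z (Suc e)"
  have w2: "w^2 = z e" using z_square by (simp add: w_def)
  have wE: "w \<notin> tower e" using weakly_ramified_not_mem[OF weak] by (simp add: w_def)
  have T: "tower (Suc e) = adjoin (tower e) w" using tower_Suc by (simp add: w_def)
  have "w^2 \<in> tower e" using w2 z_mem by simp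
  note cc = tower_field this wE
  define \<sigma> where "\<sigma> = qconj (tower e) w"
  have \<sigma>: "\<And>x. x \<in> tower e \<Longrightarrow> \<sigma> x = x" "\<sigma> w = - w"
    "\<And>p q. p \<in> tower e \<Longrightarrow> q \<in> tower e \<Longrightarrow> \<sigma> (p + q * w) = p - q * w"
    "\<And>x y. x \<in> tower (Suc e) \<Longrightarrow> y \<in> tower (Suc e) \<Longrightarrow> \<sigma> (x + y) = \<sigma> x + \<sigma> y"
    "\<And>x y. x \<in> tower (Suc e) \<Longrightarrow> y \<in> tower (Suc e) \<Longrightarrow> \<sigma> (x * y) = \<sigma> x * \<sigma> y"
    "\<And>x. x \<in> tower (Suc e) \<Longrightarrow> \<sigma> x \<in> tower (Suc e) \<and> x + \<sigma> x \<in> tower e \<and> x * \<sigma> x \<in> tower e"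
    unfolding T \<sigma>_def
    using qconj_base[OF cc] qconj_gen[OF cc] qconj_eq[OF cc] qconj_ring[OF cc] by auto
  have \<sigma>V: "\<sigma> x \<in> V" if x: "x \<in> tower (Suc e)" "x \<in> V" for x
  proof -
    obtain p q where pq: "p \<in> tower e" "q \<in> tower e" "x = p + q * w"
      using adjoin_quadratic[OF tower_ring \<open>w^2 \<in> tower e\<close>] x(1) unfolding T by metis
    then show ?thesis using conjugate_mem[OF weak pq(1,2)] x(2) \<sigma>(3) by (simp add: w_def)
  qed
  have sub: "tower e \<subseteq> tower (Suc e)" using tower_mono by simp
  have of_nat: "of_nat n \<in> tower e" for n using subring_of_nat[OF tower_ring] .
  fix b t assume b: "b \<in> tower (Suc e)" and t: "t \<in> tower (Suc e)"
    and eq: "z (Suc e) = b^2 * (1 + t)" and tV: "2 * (t / 4) ^ m \<in> V"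
  have one: "1 \<in> tower e" using subring_one[OF tower_ring] .
  have b2: "b^2 \<in> tower (Suc e)" using b subring_power[OF tower_ring] by blast
  have t1: "1 + t \<in> tower (Suc e)" using t one sub subring_add[OF tower_ring] by blast
  have s1: "\<sigma> (1 + t) = 1 + \<sigma> t" using \<sigma>(4)[of 1 t] \<sigma>(1)[OF one] one sub t by auto
  have "- w = \<sigma> (b^2) * (1 + \<sigma> t)" using \<sigma>(2) \<sigma>(5)[OF b2 t1] s1 eq by (simp add: w_def)
  also have "\<sigma> (b^2) = (\<sigma> b)^2" using \<sigma>(5)[OF b b] by (simp add: power2_eq_square)
  finally have eq': "- w = (\<sigma> b)^2 * (1 + \<sigma> t)" .
  define t' where "t' = t + \<sigma> t + t * \<sigma> t"
  have "- z e = w * (- w)" using w2 by (simp add: power2_eq_square)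
  also have "\<dots> = b^2 * (1 + t) * ((\<sigma> b)^2 * (1 + \<sigma> t))" using eq eq' by (simp add: w_def)
  also have "\<dots> = (b * \<sigma> b)^2 * (1 + t')" by (simp add: t'_def power2_eq_square algebra_simps)
  finally have "z e = (z 2)^2 * ((b * \<sigma> b)^2 * (1 + t'))"
    unfolding imaginary_unit(2) by (metis minus_minus mult_minus1)
  then have ze: "z e = (z 2 * (b * \<sigma> b))^2 * (1 + t')" by (simp add: power_mult_distrib mult.assoc)
  have "z 2 * (b * \<sigma> b) \<in> tower e" "t' \<in> tower e"
    unfolding t'_def using \<sigma>(6) b t imaginary_unit(1)[OF e] subring_mult[OF tower_ring] subring_add[OF tower_ring]
    by auto
  then have notV: "2 * (t' / 4) ^ m \<notin> V" using ram ze unfolding ramified_def by blast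
  define \<tau> where "\<tau> = t / 4"
  have \<tau>: "\<tau> \<in> tower (Suc e)" unfolding \<tau>_def
    using subfield_divide[OF tower_field t] of_nat[of 4] sub by auto
  have four: "4 \<in> tower e" "2 \<in> tower e" using of_nat[of 4] of_nat[of 2] by auto
  have "\<sigma> t = \<sigma> (4 * \<tau>)" by (simp add: \<tau>_def)
  also have "\<dots> = 4 * \<sigma> \<tau>" using \<sigma>(5)[of 4 \<tau>] \<sigma>(1)[of 4] four \<tau> sub by auto
  finally have \<sigma>t: "\<sigma> t = 4 * \<sigma> \<tau>" .
  have pow: "\<tau> ^ n \<in> tower (Suc e) \<and> \<sigma> (\<tau> ^ n) = (\<sigma> \<tau>) ^ n" for n
  proof (induction n)
    case 0
    then show ?case using \<sigma>(1)[OF one] one sub by auto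
  next
    case (Suc n)
    then show ?case using \<sigma>(5)[OF \<tau>, of "\<tau> ^ n"] subring_mult[OF tower_ring \<tau>] by auto
  qed
  have "\<sigma> (2 * \<tau> ^ m) \<in> V"
    using \<sigma>V[of "2 * \<tau> ^ m"] tV pow[of m] four sub subring_mult[OF tower_ring, of 2 "Suc e" "\<tau> ^ m"] by (auto simp: \<tau>_def)
  then have \<sigma>\<tau>V: "2 * (\<sigma> \<tau>) ^ m \<in> V"
    using \<sigma>(5)[of 2 "\<tau> ^ m"] \<sigma>(1)[of 2] four sub pow[of m] by auto
  have t'4: "t' / 4 = \<tau> + \<sigma> \<tau> + (4 * \<tau>) * \<sigma> \<tau>" unfolding t'_def \<sigma>t by (simp add: \<tau>_def)
  \<comment> \<open>Integrality of \<open>4 * \<tau>\<close> makes the product term of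
    \<open>t' / 4\<close> no larger than \<open>\<sigma> \<tau>\<close>, so \<open>t' / 4\<close> is
    bounded by the larger of \<open>\<tau>\<close> and \<open>\<sigma> \<tau>\<close>.\<close>
  have "(4 * \<tau>) ^ m = (2 * \<tau> ^ m) * (2 * 4 ^ (m - 1))"
    using m by (cases m) (auto simp: power_mult_distrib)
  then have "(4 * \<tau>) ^ m \<in> V"
    using mult_mem[OF tV[folded \<tau>_def] mult_mem[OF numeral_mem power_mem[OF numeral_mem]]] by metis
  then have "vle ((4 * \<tau>) ^ m) (1 ^ m)" by (simp add: vle_one_iff)
  then have "4 * \<tau> \<in> V" using vle_power_iff[OF m] vle_one_iff by blast
  then have third: "vle ((4 * \<tau>) * \<sigma> \<tau>) (\<sigma> \<tau>)" by (intro vle_mult_left) auto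
  have bound: "2 * (t' / 4) ^ m \<in> V" if "vle \<tau> x" "vle (\<sigma> \<tau>) x" "2 * x ^ m \<in> V" for x
  proof -
    have "vle (t' / 4) x" unfolding t'4 using that third vle_trans by (intro vle_add) blast+
    then have "vle (2 * (t' / 4) ^ m) (2 * x ^ m)" by (intro vle_mult vle_power) auto
    then show ?thesis using that(3) vle_trans vle_one_iff by blast
  qed
  show False
    using vle_total[of \<tau> "\<sigma> \<tau>"] bound[of \<tau>] bound[of "\<sigma> \<tau>"] tV \<sigma>\<tau>V notV by (auto simp: \<tau>_def)
qed

text \<open>With \<open>p' = 1 - z (Suc (Suc e))\<close> the number one level lower is
  \<open>p = p' * (2 - p')\<close>. Since 2 is smaller than \<open>p'\<close>, the value of
  \<open>p\<close> is that of \<open>p'\<close> squared.\<close>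

lemma one_minus_z: "veq ((1 - z (Suc e)) ^ (2 ^ e)) 2"
proof (induction e)
  case 0
  have "z (Suc 0) = - 1" by (simp add: z_def zeta_def)
  then show ?case by simp
next
  case (Suc e)
  define p where "p = 1 - z (Suc e)"
  define p' where "p' = 1 - z (Suc (Suc e))"
  have pp': "p = p' * (2 - p')"
    unfolding p_def p'_def z_square[of "Suc e", symmetric] by (simp add: power2_eq_square algebra_simps)
  have IH: "veq (p ^ (2 ^ e)) 2" using Suc by (simp add: p_def)
  then have "vlt (p ^ (2 ^ e)) (1 ^ (2 ^ e))" using veq_vlt1 two_small by simp
  then have p1: "vlt p 1" using vlt_power_iff[of "2 ^ e" p 1] by simp
  have "p ^ (2 ^ e) = p * p ^ (2 ^ e - 1)" by (metis mult.commute power_minus_mult zero_less_numeral zero_less_power)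
  then have "vle (p ^ (2 ^ e)) p" using vle_mult_right[of p p "p ^ (2 ^ e - 1)"] power_mem[OF vlt_one_mem[OF p1]] by simp
  then have two_p: "vle 2 p" using veq_vle1[OF IH] by blast
  have "vlt 2 p'"
  proof (rule ccontr)
    assume "\<not> vlt 2 p'"
    then have "vle p' 2" by (simp add: not_vlt)
    then have "vle p (2 * 2)" unfolding pp' by (intro vle_mult vle_diff) auto
    then have "vle 2 (2 * 2)" using two_p vle_trans by blast
    moreover have "vlt (2 * 2) (1 * 2)" using two_small by (intro vlt_mult) auto
    ultimately show False by (simp add: vlt_def)
  qed
  then have "veq (- p' + 2) (- p')" by (intro veq_add) (simp add: vlt_def)
  then have "veq (2 - p') p'" using veq_minus veq_sym by (metis add.commute diff_conv_add_uminus)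
  then have "veq p (p' * p')" unfolding pp' by (intro veq_mult) auto
  then have "veq (p ^ (2 ^ e)) (p' ^ (2 ^ Suc e))"
    using veq_power[of p "p' * p'" "2 ^ e"] by (simp add: power_mult power2_eq_square)
  then show ?case using IH veq_trans veq_sym unfolding p'_def by blast
qed

text \<open>If no step were ramified then the value group would be constant along the tower, whereas
  the values of \<open>1 - z e\<close> tend to 1.\<close>

lemma exists_weakly_ramified: "\<exists>e\<ge>2. weakly_ramified e"
proof (rule ccontr)
  assume contr: "\<not> ?thesis"
  have same: "\<exists>c\<in>tower 2. veq y c" if "y \<in> tower (2 + k)" for y k
    using that
  proof (induction k arbitrary: y)
    case 0
    then show ?case by (intro bexI[of _ y]) auto
  next
    case (Suc k)
    define e where "e = 2 + k"
    have "\<not> weakly_ramified e" using contr by (simp add: e_def)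
    then obtain b t where bt: "b \<in> tower e" "t \<in> tower e" "z e = b^2 * (1 + t)" "t / 4 \<in> V"
      unfolding weakly_ramified_def by blast
    have b0: "b \<noteq> 0" using bt(3) z_nonzero[of e] by auto
    define w where "w = z (Suc e)"
    \<comment> \<open>\<open>\<theta>\<close> is a root of \<open>X^2 - X - t/4\<close>, the
      integral form of adjoining a square root of \<open>1 + t\<close>. The derivative there is
      \<open>w / b\<close>, a unit, so the layer does not enlarge the value group.\<close>
    define \<theta> where "\<theta> = (1 + w / b) / 2"
    have wb: "(w / b)^2 = 1 + t" using z_square[of e] bt(3) b0 by (simp add: w_def power_divide)
    let ?f = "[:- (t / 4), - 1, 1:] :: complex poly"
    have four: "4 \<in> tower e" using subring_of_nat[OF tower_ring, of 4] by simp
    have sub: "subring_C (tower e \<inter> V)" using tower_ring[of e] subring by (auto simp: subring_C_def)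
    have "t / 4 \<in> tower e \<inter> V" using bt subfield_divide[OF tower_field _ four] by blast
    then have f1: "poly_over (tower e \<inter> V) ?f"
      using sub by (intro poly_over_pCons poly_over_0 subring_uminus subring_one)
    have f2: "poly ?f \<theta> = 0"
    proof -
      have "4 * (\<theta>^2 - \<theta>) = (w / b)^2 - 1"
      proof -
        have "4 * (((1 + v) / 2)^2 - (1 + v) / 2) = v^2 - 1" for v :: complex
          by (simp add: power2_eq_square field_simps)
        then show ?thesis by (simp only: \<theta>_def)
      qed
      then have "\<theta>^2 - \<theta> = ((w / b)^2 - 1) / 4" by (metis nonzero_mult_div_cancel_left zero_neq_numeral)
      then have "\<theta>^2 - \<theta> = t / 4" using wb by simp
      moreover have "poly ?f \<theta> = (\<theta>^2 - \<theta>) - t / 4" by (simp add: power2_eq_square algebra_simps)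
      ultimately show ?thesis by simp
    qed
    have "poly (pderiv ?f) \<theta> = 2 * \<theta> - 1" by (simp add: pderiv_pCons)
    moreover have th: "2 * \<theta> = 1 + w / b" by (simp add: \<theta>_def)
    ultimately have "poly (pderiv ?f) \<theta> = w / b" by simp
    moreover have "veq (w / b) 1"
    proof -
      have "vlt (2 * 2) 1" using two_small by (intro vlt_mult_right) auto
      then have "vlt (2 * 2 * (t / 4)) 1" using bt(4) by (rule vlt_mult_right)
      then have "veq (1 + t) 1" by (intro veq_add) simp
      then show ?thesis using veq_power_iff[of 2 "w / b" 1] wb by simp
    qed
    ultimately have f3: "veq (poly (pderiv ?f) \<theta>) 1" by simp
    have "w = b * (2 * \<theta> - 1)" unfolding th using b0 by simp
    moreover have "b * (2 * \<theta> - 1) \<in> adjoin (tower e) \<theta>"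
    proof -
      note R = subring_adjoin[OF tower_ring, of e \<theta>]
      have "b \<in> adjoin (tower e) \<theta>" "2 \<in> adjoin (tower e) \<theta>" "1 \<in> adjoin (tower e) \<theta>"
        using bt(1) adjoin_subset[OF tower_ring] subring_of_nat[OF R, of 2] subring_one[OF R] by auto
      then show ?thesis using adjoin_self[OF tower_ring, of \<theta> e]
        by (intro subring_mult[OF R] subring_diff[OF R])
    qed
    ultimately have "tower (Suc e) \<subseteq> adjoin (tower e) \<theta>"
      unfolding tower_Suc w_def[symmetric]
      using adjoin_subset[OF tower_ring] by (intro adjoin_least[OF subring_adjoin[OF tower_ring]]) auto
    then have "y \<in> adjoin (tower e) \<theta>" using Suc.prems by (auto simp: e_def)
    then obtain c where "c \<in> tower e" "veq y c"
      using etale_same_values[OF tower_nf f1 _ f2 f3] by auto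
    then show ?case using Suc.IH[of c] veq_trans by (auto simp: e_def)
  qed
  obtain n where n: "n > 0" "\<And>g. g \<in> tower 2 \<Longrightarrow> vlt g 1 \<Longrightarrow> vle (g ^ n) (of_nat 2)"
    using nonunit_power[OF tower_nf] by blast
  \<comment> \<open>Chosen so that \<open>n < 2 ^ e\<close>: with a constant value group already
    \<open>p ^ n\<close> is at most 2 in value, whereas it is \<open>p ^ (2 ^ e)\<close> that has
    exactly the value of 2.\<close>
  define e where "e = Suc n"
  define p where "p = 1 - z (Suc e)"
  have p2: "veq (p ^ (2 ^ e)) 2" using one_minus_z by (simp add: p_def)
  have p1: "vlt p 1"
    using vlt_power_iff[of "2 ^ e" p 1] veq_vlt1[OF p2] two_small by simp
  have "p \<in> tower (2 + n)" unfolding p_def e_def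
    using z_mem[of "Suc (Suc n)"] by (intro subring_diff[OF tower_ring] subring_one[OF tower_ring]) simp
  then obtain c where c: "c \<in> tower 2" "veq p c" using same by blast
  then have "vle (c ^ n) 2" using n(2)[of c] veq_vlt1[OF c(2)] p1 by simp
  then have pn: "vle (p ^ n) 2" using veq_vle1[OF veq_power[OF c(2)]] by blast
  have ne: "n < 2 ^ e" unfolding e_def using less_exp[of "Suc n"] by linarith
  have "vlt (p ^ (2 ^ e - n)) 1" using vlt_power[OF p1, of "2 ^ e - n"] ne by simp
  moreover have "p \<noteq> 0"
  proof
    assume "p = 0"
    then have "p ^ (2 ^ e) = 0" by (simp add: zero_power)
    then show False using p2 unfolding \<open>p ^ (2 ^ e) = 0\<close> by simp
  qed
  ultimately have "vlt (p ^ (2 ^ e - n) * p ^ n) (1 * p ^ n)" by (intro vlt_mult) auto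
  then have "vlt (p ^ (2 ^ e)) (p ^ n)" using ne by (simp flip: power_add)
  then have "vlt 2 (p ^ n)" using veq_vlt1[OF p2] by blast
  then show False using pn by (simp add: vlt_def)
qed

text \<open>Weak ramification at \<open>e0\<close> says that \<open>4 / t\<close> is a nonunit, so
  discreteness of that one field gives \<open>vle ((4 / t) ^ n) 2\<close>. This is ramification with
  \<open>m = Suc n\<close>, which \<open>ramified_Suc\<close> passes on to all higher
  levels.\<close>

lemma eventually_ramified: "\<exists>e0\<ge>2. \<exists>m>0. \<forall>e\<ge>e0. ramified m e"
proof -
  obtain e0 where e0: "e0 \<ge> 2" "weakly_ramified e0" using exists_weakly_ramified by blast
  obtain n where n: "n > 0" "\<And>g. g \<in> tower e0 \<Longrightarrow> vlt g 1 \<Longrightarrow> vle (g ^ n) (of_nat 2)"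
    using nonunit_power[OF tower_nf] by blast
  have "ramified (Suc n) e0"
    unfolding ramified_def
  proof (intro ballI impI notI)
    fix b t assume bt: "b \<in> tower e0" "t \<in> tower e0" "z e0 = b^2 * (1 + t)" and V: "2 * (t / 4) ^ Suc n \<in> V"
    have nV: "t / 4 \<notin> V" using e0(2) bt unfolding weakly_ramified_def by blast
    then have t0: "t \<noteq> 0" using zero_mem by auto
    have gt: "vlt 1 (t / 4)" using nV by (simp add: vlt_def vle_one_iff)
    then have lt: "vlt (4 / t) 1" using vlt_iff_divide[of "t / 4" 1] t0 by simp
    have "4 / t \<in> tower e0"
      using subfield_divide[OF tower_field _ bt(2)] subring_of_nat[OF tower_ring, of 4] by simp
    then have "vle ((4 / t) ^ n) 2" using n(2) lt by simp
    then have "vle ((4 / t) ^ n * (t / 4) ^ Suc n) (2 * (t / 4) ^ Suc n)" by (intro vle_mult) auto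
    moreover have "(4 / t) ^ n * (t / 4) ^ Suc n = ((4 / t) * (t / 4)) ^ n * (t / 4)"
      unfolding power_mult_distrib by simp
    then have "(4 / t) ^ n * (t / 4) ^ Suc n = t / 4" using t0 by simp
    ultimately have "vle (t / 4) (2 * (t / 4) ^ Suc n)" by (simp only:)
    then have "vle (t / 4) 1" using V vle_trans vle_one_iff by blast
    then show False using gt by (simp add: vlt_def)
  qed
  moreover have "ramified (Suc n) (e0 + k)" if "ramified (Suc n) e0" for k
    by (induction k) (use that e0(1) ramified_Suc in auto)
  ultimately show ?thesis using e0(1) by (intro exI[of _ e0] conjI exI[of _ "Suc n"]) (auto simp: le_iff_add)
qed

text \<open>Suppose \<open>s\<close> first occurs at level \<open>Suc g\<close>, two or more levels
  above \<open>e\<close>. Then \<open>s = q * z (Suc g)\<close>, so \<open>s^2 = q^2 * z g\<close>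
  lies in \<open>tower h\<close> with \<open>g = Suc h\<close>. Multiplying with the conjugate over
  \<open>tower h\<close> shows that \<open>- z h\<close> is a square there, and so is
  \<open>z h\<close> because \<open>- 1\<close> is one; this contradicts ramification at
  \<open>h\<close>.\<close>

lemma sqrt_in_next_step:
  assumes ram: "\<And>e. e \<ge> e0 \<Longrightarrow> weakly_ramified e" and e: "e \<ge> e0" "e0 \<ge> 2"
    and s: "s^2 \<in> tower e"
  shows "s \<in> tower f \<Longrightarrow> s \<in> tower (Suc e)"
proof (induction f)
  case 0
  then show ?case using tower_mono[of 0 "Suc e"] by auto
next
  case (Suc g)
  show ?case
  proof (cases "g \<le> e")
    case True
    then show ?thesis using Suc.prems tower_mono[of "Suc g" "Suc e"] by auto
  next
    case False
    then obtain h where h: "g = Suc h" "e \<le> h" by (cases g) auto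
    have "s \<in> tower g"
    proof (rule ccontr)
      assume sg: "s \<notin> tower g"
      have s2: "s^2 \<in> tower h" "s^2 \<in> tower g" using s tower_mono[of e h] tower_mono[of e g] h by auto
      have wg: "z (Suc g) \<notin> tower g" "(z (Suc g))^2 \<in> tower g"
        using weakly_ramified_not_mem[OF ram] e h z_square z_mem by auto
      obtain q where q: "q \<in> tower g" "q \<noteq> 0" "s = q * z (Suc g)"
        using quadratic_square[OF tower_field wg(2,1) _ s2(2) sg] Suc.prems tower_Suc by metis
      then have sq: "s^2 = q^2 * z g" using z_square by (simp add: power_mult_distrib)
      have wh: "z g \<notin> tower h" "(z g)^2 \<in> tower h" "tower g = adjoin (tower h) (z g)"
        using weakly_ramified_not_mem[OF ram] e h z_square z_mem tower_Suc by auto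
      note cc = tower_field wh(2,1)
      define \<sigma> where "\<sigma> = qconj (tower h) (z g)"
      have \<sigma>: "\<And>x. x \<in> tower h \<Longrightarrow> \<sigma> x = x" "\<sigma> (z g) = - z g"
          "\<And>x y. x \<in> tower g \<Longrightarrow> y \<in> tower g \<Longrightarrow> \<sigma> (x * y) = \<sigma> x * \<sigma> y"
          "\<And>x. x \<in> tower g \<Longrightarrow> x * \<sigma> x \<in> tower h"
        unfolding wh(3) \<sigma>_def
        using qconj_base[OF cc] qconj_gen[OF cc] qconj_ring[OF cc] by auto
      have q2: "q * q \<in> tower g" using subring_mult[OF tower_ring q(1) q(1)] .
      have "s^2 = \<sigma> (q * q * z g)" using \<sigma>(1)[OF s2(1)] sq by (simp add: power2_eq_square)
      then have eqA: "s^2 = - (\<sigma> q * \<sigma> q * z g)" using \<sigma>(3)[OF q2 z_mem] \<sigma>(3)[OF q(1) q(1)] \<sigma>(2) by simp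
      have "s^2 * s^2 = (q^2 * z g) * (- (\<sigma> q * \<sigma> q * z g))" using sq eqA by (rule arg_cong2)
      then have "s^2 * s^2 = - ((q * \<sigma> q)^2) * (z g)^2" by (simp add: power2_eq_square mult_ac)
      then have eq: "(s^2)^2 = - ((q * \<sigma> q)^2 * z h)" using z_square[of h] h by (simp add: power2_eq_square)
      have "s \<noteq> 0" using sg subring_zero[OF tower_ring] by auto
      then have nz: "q * \<sigma> q \<noteq> 0" using eq by auto
      then have "z h = - ((s^2 / (q * \<sigma> q))^2)"
        using eq by (simp add: power_divide field_simps)
      then have "z h = (z 2 * (s^2 / (q * \<sigma> q)))^2 * (1 + 0)"
        unfolding power_mult_distrib imaginary_unit(2) by simp
      moreover have "z 2 * (s^2 / (q * \<sigma> q)) \<in> tower h"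
        using subring_mult[OF tower_ring imaginary_unit(1)[of h] subfield_divide[OF tower_field s2(1) \<sigma>(4)[OF q(1)]]] e h
        by simp
      ultimately show False using ram[of h] e h subring_zero[OF tower_ring] zero_mem
        unfolding weakly_ramified_def by (metis div_0 le_trans)
    qed
    then show ?thesis using Suc.IH h by simp
  qed
qed

text \<open>With \<open>u = x + 1/x\<close> and \<open>s = x - u/2\<close>, a new \<open>x\<close> makes \<open>z e\<close> equal to \<open>1 - 4/u\<^sup>2\<close> up to squares.\<close>

lemma new_step_small:
  assumes ram: "ramified m e" and m: "m > 0" and x: "x \<in> tower (Suc e)" "x \<notin> tower e" "x \<noteq> 0"
    and u: "u \<in> tower e" "u = x + 1 / x"
  shows "vle (u ^ (2 * m)) 2"
proof (cases "u = 0")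
  case False
  define A where "A = u / 2"
  define s where "s = x - A"
  have two: "2 \<in> tower e" "4 \<in> tower e" using subring_of_nat[OF tower_ring, of 2] subring_of_nat[OF tower_ring, of 4] by auto
  have A: "A \<in> tower e" unfolding A_def using subfield_divide[OF tower_field u(1) two(1)] .
  have s2: "s^2 = A^2 - 1" unfolding s_def A_def u(2) using x(3) by (simp add: field_simps power2_eq_square)
  have sE: "s^2 \<in> tower e" unfolding s2
    using subring_diff[OF tower_ring subring_power[OF tower_ring A] subring_one[OF tower_ring]] .
  have sn: "s \<notin> tower e"
  proof
    assume "s \<in> tower e"
    then have "s + A \<in> tower e" using subring_add[OF tower_ring _ A] by blast
    then show False using x(2) by (simp add: s_def)
  qed
  have "A \<in> tower (Suc e)" using A tower_mono[of e "Suc e"] by auto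
  then have sS: "s \<in> adjoin (tower e) (z (Suc e))"
    unfolding s_def tower_Suc[symmetric] using x(1) subring_diff[OF tower_ring] by blast
  have w: "z (Suc e) \<notin> tower e" "(z (Suc e))^2 \<in> tower e"
    using weakly_ramified_not_mem[OF ramified_weakly[OF ram]] z_square z_mem by auto
  obtain q where q: "q \<in> tower e" "q \<noteq> 0" "s = q * z (Suc e)"
    by (rule quadratic_square[OF tower_field w(2,1) sS sE sn])
  define t where "t = - (4 / u^2)"
  have "s^2 = q^2 * z e" unfolding q(3) power_mult_distrib z_square ..
  then have "z e = (A^2 - 1) / q^2" using q(2) s2 by simp
  also have "\<dots> = (A / q)^2 * (1 + t)"
    using False q(2) by (simp add: t_def A_def field_simps power2_eq_square)
  finally have ze: "z e = (A / q)^2 * (1 + t)" .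
  have "A / q \<in> tower e" "t \<in> tower e"
    unfolding t_def using A q(1) u(1) two subfield_divide[OF tower_field] subring_uminus[OF tower_ring]
      subring_power[OF tower_ring] by simp_all
  then have "2 * (t / 4) ^ m \<notin> V" using ram ze unfolding ramified_def by blast
  moreover have "2 * (t / 4) ^ m = (- 1) ^ m * (2 / u ^ (2 * m))"
  proof -
    have "t / 4 = (- 1) * inverse (u^2)" using False by (simp add: t_def field_simps)
    then have "(t / 4) ^ m = (- 1) ^ m * inverse (u^2) ^ m" by (simp only: power_mult_distrib)
    also have "inverse (u^2) ^ m = inverse (u ^ (2 * m))" unfolding power_mult power_inverse ..
    finally show ?thesis unfolding divide_inverse by (simp only: mult.left_commute)
  qed
  ultimately have "2 / u ^ (2 * m) \<notin> V"
    using mult_mem[OF power_mem[OF uminus_mem[OF one_mem]], of "2 / u ^ (2 * m)" m] by auto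
  then have "\<not> vle 2 (u ^ (2 * m))" using vle_iff_divide[of "u ^ (2 * m)" 2] False by simp
  then show ?thesis using vle_total by blast
qed (use m in \<open>simp add: zero_power\<close>)

text \<open>A step raises the level by at most one (\<open>sqrt_in_next_step\<close>), and only if
  its \<open>u\<close> is small (\<open>new_step_small\<close>), so the level is controlled by the
  number of small steps.\<close>

lemma path_level:
  assumes K: "K \<subseteq> F0" "a \<in> K" "c \<in> K" "\<alpha> \<in> K" "a \<noteq> 0"
    and ram: "e0 \<ge> 2" "m > 0" "\<And>e. e \<ge> e0 \<Longrightarrow> ramified m e"
    and path: "backward_path a c \<alpha> n x" "x n \<in> tower f"
  shows "x n \<in> tower (e0 + card {i. i < n \<and> vle (((x i - c) / a) ^ (2 * m)) 2})"
proof -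
  have aE: "a \<in> tower e" "c \<in> tower e" "\<alpha> \<in> tower e" for e using K tower_base by auto
  have xf: "x i \<in> tower f" if "i \<le> n" for i
    using backward_path_mem[OF path(1) tower_field aE(1,2) path(2) that] .
  have "j \<le> n \<Longrightarrow> x j \<in> tower (e0 + card {i. i < j \<and> vle (((x i - c) / a) ^ (2 * m)) 2})" for j
  proof (induction j)
    case 0
    then show ?case using path aE by (simp add: backward_path_def)
  next
    case (Suc j)
    define S where "S j = {i. i < j \<and> vle (((x i - c) / a) ^ (2 * m)) 2}" for j
    define e where "e = e0 + card (S j)"
    have xj: "x j \<in> tower e" using Suc by (simp add: e_def S_def)
    have fin: "finite (S j)" by (simp add: S_def)
    have step: "(x (Suc j) - (x j - c) / (2 * a))\<^sup>2 = ((x j - c) / (2 * a))\<^sup>2 - 1"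
      and nz: "x (Suc j) \<noteq> 0" and u: "x j - c = a * (x (Suc j) + 1 / x (Suc j))"
      using backward_step[OF path(1), of j] Suc.prems K(5) by auto
    define A where "A = (x j - c) / (2 * a)"
    have two: "2 \<in> tower e" using subring_of_nat[OF tower_ring, of 2] by simp
    have A: "A \<in> tower e" unfolding A_def
      using subfield_divide[OF tower_field subring_diff[OF tower_ring xj aE(2)] subring_mult[OF tower_ring two aE(1)]] .
    have "x (Suc j) - A \<in> tower (Suc e)"
    proof (rule sqrt_in_next_step[OF ramified_weakly[OF ram(3)]])
      show "(x (Suc j) - A)\<^sup>2 \<in> tower e" unfolding A_def step
        using subring_diff[OF tower_ring subring_power[OF tower_ring A] subring_one[OF tower_ring]] by (simp add: A_def)
      show "x (Suc j) - A \<in> tower (max e f)"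
        using xf[OF Suc.prems] A tower_mono[of e "max e f"] tower_mono[of f "max e f"] subring_diff[OF tower_ring, of _ "max e f"] by auto
    qed (use ram in \<open>auto simp: e_def\<close>)
    moreover have "A \<in> tower (Suc e)" using A tower_mono[of e "Suc e"] by auto
    ultimately have xS: "x (Suc j) \<in> tower (Suc e)" using subring_add[OF tower_ring] by fastforce
    show ?case
    proof (cases "x (Suc j) \<in> tower e")
      case True
      have "S j \<subseteq> S (Suc j)" "finite (S (Suc j))" by (auto simp: S_def)
      then have "e \<le> e0 + card (S (Suc j))" unfolding e_def by (simp add: card_mono)
      then show ?thesis using True tower_mono unfolding S_def by blast
    next
      case False
      have "(x j - c) / a = x (Suc j) + 1 / x (Suc j)" using u K(5) by simp
      moreover have "(x j - c) / a \<in> tower e"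
        using subfield_divide[OF tower_field subring_diff[OF tower_ring xj aE(2)] aE(1)] .
      ultimately have "vle (((x j - c) / a) ^ (2 * m)) 2"
        using new_step_small[OF ram(3) ram(2) xS False nz, of "(x j - c) / a"] by (simp add: e_def)
      then have "S (Suc j) = insert j (S j)" by (auto simp: S_def less_Suc_eq)
      then have "card (S (Suc j)) = Suc (card (S j))" using fin by (simp add: S_def)
      then show ?thesis using xS unfolding e_def S_def by simp
    qed
  qed
  then show ?thesis by simp
qed

end

section \<open>Bounding the level of the backward orbit\<close>

context valuation_ring
begin

text \<open>Both \<open>y\<close> and \<open>inverse y\<close> are roots of
  \<open>X^2 - (y + 1/y) * X + 1\<close>.\<close>

lemma sum_inverse_unit:
  assumes "y \<noteq> 0" "y + 1 / y \<in> V" shows "veq y 1"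
proof -
  have root: "x \<in> V" if "x \<noteq> 0" "x + 1 / x = y + 1 / y" for x
  proof (rule integral_mem)
    let ?f = "[:1, - (y + 1 / y), 1:] :: complex poly"
    show "poly_over V ?f"
      using assms(2) by (intro poly_over_pCons[OF subring] poly_over_0[OF subring] uminus_mem one_mem)
    show "poly ?f x = 0" using that unfolding that(2)[symmetric] by (simp add: field_simps)
  qed simp
  have "y \<in> V" "inverse y \<in> V" using root[of y] root[of "inverse y"] assms(1) by (auto simp: field_simps)
  then show ?thesis using assms(1) by (simp add: veq_one_iff vlt_one_iff)
qed

end

context dyadic_tower
begin

text \<open>Once \<open>u i\<close> is integral, \<open>x (Suc i)\<close> is a unit by
  \<open>sum_inverse_unit\<close>. Since \<open>c\<close> is small and \<open>a\<close> a unit,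
  \<open>u (Suc i)\<close> is a unit as well, and this repeats up to the end of the path; a unit is
  not small.\<close>

lemma small_steps_case_1:
  assumes a: "veq a 1" and c: "vlt c 1" and path: "backward_path a c \<alpha> n x" and m: "m > 0"
  shows "card {i. i < n \<and> vle (((x i - c) / a) ^ (2 * m)) 2} \<le> 1"
proof -
  have a0: "a \<noteq> 0" using a by auto
  define u where "u i = (x i - c) / a" for i
  have xu: "x i = a * u i + c" for i using a0 by (simp add: u_def)
  have nz: "x (Suc i) \<noteq> 0" and ux: "u i = x (Suc i) + 1 / x (Suc i)" if "i < n" for i
    using backward_step[OF path that a0] a0 by (auto simp: u_def)
  have aV: "a \<in> V" using a by (simp add: veq_one_iff)
  have step: "veq (u i) 1" if "veq (x i) 1" for i
  proof -
    have "veq (x i + (- c)) (x i)" using veq_vlt2[OF that] c by (intro veq_add) simp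
    then have 1: "veq (x i - c) 1" using veq_trans[OF _ that] by simp
    have "veq ((x i - c) * inverse a) (1 * inverse 1)" using 1 a by (intro veq_mult veq_inverse)
    then show ?thesis by (simp add: u_def divide_inverse)
  qed
  have unit: "veq (x (Suc i + k)) 1" if "u i \<in> V" "Suc i + k \<le> n" for i k
    using that(2)
  proof (induction k)
    case 0
    then show ?case using sum_inverse_unit[OF nz, of i] ux[of i] that(1) by simp
  next
    case (Suc k)
    then have "veq (u (Suc i + k)) 1" using step by simp
    then show ?case using sum_inverse_unit[OF nz, of "Suc i + k"] ux[of "Suc i + k"] Suc.prems
      by (simp add: veq_one_iff)
  qed
  have small: "vlt (u i) 1" if "vle (u i ^ (2 * m)) 2" for i
  proof -
    have "vlt (u i ^ (2 * m)) (1 ^ (2 * m))" using vle_vlt_trans[OF that two_small] by simp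
    then show ?thesis using vlt_power_iff[of "2 * m" "u i" 1] m by simp
  qed
  have no: False if "i < j" "j < n" "vle (u i ^ (2 * m)) 2" "vle (u j ^ (2 * m)) 2" for i j
  proof -
    obtain k where k: "j = Suc i + k" using \<open>i < j\<close> less_iff_Suc_add by auto
    have "veq (x j) 1" unfolding k using unit[of i k] small[OF that(3)] vlt_one_mem that(2) k by simp
    then show False using step[of j] small[OF that(4)] vlt_not_veq by blast
  qed
  have "finite {i. i < n \<and> vle (u i ^ (2 * m)) 2}" by simp
  moreover have "i = j" if "i \<in> {i. i < n \<and> vle (u i ^ (2 * m)) 2}" "j \<in> {i. i < n \<and> vle (u i ^ (2 * m)) 2}" for i j
    using no[of i j] no[of j i] that by (cases i j rule: linorder_cases) auto
  ultimately have "card {i. i < n \<and> vle (u i ^ (2 * m)) 2} \<le> Suc 0"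
    by (simp only: card_le_Suc0_iff_eq) blast
  then show ?thesis by (simp add: u_def)
qed

text \<open>Both claims are identities for \<open>phi\<close>, applied while the index decreases.
  From \<open>phi(y) - 1 = a * ((y - 1)^2 / y + 2) + (c - 1)\<close> the ball of radius
  \<open>w\<close> around 1 is mapped into itself, and
  \<open>phi(y) - phi(y') = a * (y - y') * (y * y' - 1) / (y * y')\<close> gains a factor
  \<open>w\<close> there.\<close>

lemma contraction:
  assumes a: "veq a 1" and c: "vle (c - 1) w" and w: "vle 2 w" "vlt w 1"
    and path: "backward_path a c \<alpha> n x" and k: "k < n" and u: "vle ((x k - c) / a) w"
  shows "j \<le> k \<Longrightarrow> vle (x (k - j) - 1) w"
    and "j < k \<Longrightarrow> vle (x (k - Suc j) - x (k - j)) (w ^ j)"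
proof -
  have a0: "a \<noteq> 0" using a by auto
  have aV: "a \<in> V" using a by (simp add: veq_one_iff)
  have nz: "x (Suc i) \<noteq> 0" and ux: "x i - c = a * (x (Suc i) + 1 / x (Suc i))" if "i < n" for i
    using backward_step[OF path that a0] by auto
  have unit: "veq y 1" if "vle (y - 1) w" for y
    using veq_add[of "y - 1" 1] vle_vlt_trans[OF that w(2)] by simp
  have xk: "vle (x k - 1) w"
  proof -
    have "x k - 1 = a * ((x k - c) / a) + (c - 1)" using a0 by simp
    then show ?thesis using u c aV by (simp only:) (intro vle_add vle_mult_left)
  qed
  show near: "vle (x (k - j) - 1) w" if "j \<le> k" for j
    using that
  proof (induction j)
    case (Suc j)
    define y where "y = x (k - j)"
    have i: "k - j = Suc (k - Suc j)" "k - Suc j < n" using Suc.prems k by auto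
    have y: "vle (y - 1) w" "veq y 1" using Suc unit by (auto simp: y_def)
    have "y \<noteq> 0" using y(2) by auto
    moreover have "inverse y \<in> V" using veq_inverse[OF y(2)] by (simp add: veq_one_iff)
    ultimately have y0: "y \<noteq> 0" "inverse y \<in> V" by auto
    have "x (k - Suc j) - c = a * (y + 1 / y)" using ux[OF i(2)] i(1) by (simp add: y_def)
    then have "x (k - Suc j) - 1 = a * ((y - 1) * ((y - 1) * inverse y) + 2) + (c - 1)"
      using y0 by (simp add: field_simps)
    moreover have "(y - 1) * inverse y \<in> V"
      using mult_mem[OF vlt_one_mem[OF vle_vlt_trans[OF y(1) w(2)]] y0(2)] .
    then have "vle (a * ((y - 1) * ((y - 1) * inverse y) + 2) + (c - 1)) w"
      using y(1) w(1) c aV by (intro vle_add vle_mult_left vle_mult_right)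
    ultimately show ?case by (simp only:)
  qed (use xk in simp)
  show "vle (x (k - Suc j) - x (k - j)) (w ^ j)" if "j < k" for j
    using that
  proof (induction j)
    case 0
    have "vle ((x (k - Suc 0) - 1) - (x k - 1)) 1"
      using vle_trans[OF near vlt_imp_vle[OF w(2)], of "Suc 0"] vle_trans[OF near vlt_imp_vle[OF w(2)], of 0] 0
      by (intro vle_diff[of "x (k - Suc 0) - 1"]) auto
    then show ?case by simp
  next
    case (Suc j)
    define y y' where "y = x (k - Suc j)" and "y' = x (k - j)"
    have i: "k - Suc j = Suc (k - Suc (Suc j))" "k - j = Suc (k - Suc j)" "k - Suc j < n" "k - Suc (Suc j) < n"
      using Suc.prems k by auto
    have y: "vle (y - 1) w" "vle (y' - 1) w" using near[of j] near[of "Suc j"] Suc.prems by (auto simp: y_def y'_def)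
    have un: "veq y 1" "veq y' 1" using unit y by auto
    have nz0: "y \<noteq> 0" "y' \<noteq> 0" using un by auto
    have inv: "inverse (y * y') \<in> V" using veq_inverse[OF veq_mult[OF un]] by (simp add: veq_one_iff)
    have "x (k - Suc (Suc j)) - c = a * (y + 1 / y)" "y - c = a * (y' + 1 / y')"
      using ux[OF i(4)] ux[OF i(3)] i(1,2) by (simp_all add: y_def y'_def)
    then have "x (k - Suc (Suc j)) - y = a * (y + 1 / y) - a * (y' + 1 / y')" by (simp add: algebra_simps)
    also have "\<dots> = a * (((y * (y' - 1) + (y - 1)) * inverse (y * y')) * (y - y'))"
      using nz0 by (simp add: field_simps)
    finally have eq: "x (k - Suc (Suc j)) - y = a * (((y * (y' - 1) + (y - 1)) * inverse (y * y')) * (y - y'))" .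
    have IH: "vle (y - y') (w ^ j)" using Suc by (simp add: y_def y'_def)
    have "y \<in> V" using un by (simp add: veq_one_iff)
    then have "vle ((y * (y' - 1) + (y - 1)) * inverse (y * y')) w"
      using y inv by (intro vle_mult_right vle_add vle_mult_left)
    from vle_mult_left[OF vle_mult[OF this IH] aV]
    have "vle (a * (((y * (y' - 1) + (y - 1)) * inverse (y * y')) * (y - y'))) (w * w ^ j)" .
    then show ?case using eq by (simp add: y_def)
  qed
qed

text \<open>A small step at index \<open>i\<close> puts \<open>x i\<close> close to 1, and
  \<open>contraction\<close> down to index 0 bounds \<open>\<alpha> - x 1\<close> by
  \<open>w ^ (i - 1)\<close>. But \<open>x 1\<close> is one of finitely many preimages of
  \<open>\<alpha>\<close> and differs from \<open>\<alpha>\<close>, so \<open>i\<close> is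
  bounded.\<close>

lemma small_steps_case_2:
  assumes K: "number_field K" "a \<in> K" "c \<in> K" "\<alpha> \<in> K"
    and a: "veq a 1" and c: "vlt (c - 1) 1" and m: "m > 0"
  shows "\<exists>R. \<forall>n x. backward_path a c \<alpha> n x \<longrightarrow> (n > 0 \<longrightarrow> x 1 \<noteq> \<alpha>) \<longrightarrow>
    card {i. i < n \<and> vle (((x i - c) / a) ^ (2 * m)) 2} \<le> R"
proof -
  note KR = number_field_subring[OF K(1)] and KF = number_field_subfield[OF K(1)]
  have a0: "a \<noteq> 0" using a by auto
  obtain r where r: "r > 0" "\<And>g. g \<in> K \<Longrightarrow> vlt g 1 \<Longrightarrow> vle (g ^ r) (of_nat 2)"
    using nonunit_power[OF K(1)] by blast
  have c1: "vle ((c - 1) ^ r) 2" using r(2)[OF subring_diff[OF KR K(3) subring_one[OF KR]] c] by simp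
  \<comment> \<open>A common multiple of the exponents 1, \<open>r\<close> and \<open>2 * m\<close>
    whose powers of 2, \<open>c - 1\<close> and a small \<open>u\<close> are at most 2 in value. So
    one radius \<open>w\<close> with \<open>w ^ N = 2\<close> works for all three.\<close>
  define N where "N = 2 * m * r"
  have N: "N > 0" using m r(1) by (simp add: N_def)
  obtain w :: complex where w: "w ^ N = 2" using nth_root_exists[OF N, of 2] by blast
  have small: "vle g w" if "vle (g ^ d) 2" "d * e = N" "e > 0" for g d e
  proof -
    have "vle ((g ^ d) ^ e) (2 ^ e)" using that(1) by (rule vle_power)
    moreover have "vle (2 ^ e) 2"
      using that(3) power_mem[of 2 "e - 1"] vle_mult_right[of 2 2 "2 ^ (e - 1)"] by (cases e) auto
    ultimately have "vle ((g ^ d) ^ e) 2" by (rule vle_trans)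
    moreover have "(g ^ d) ^ e = g ^ N" by (simp only: power_mult[symmetric] that(2))
    ultimately have "vle (g ^ N) (w ^ N)" by (simp only: w)
    then show ?thesis using vle_power_iff[OF N] by blast
  qed
  have w1: "vlt w 1" using vlt_power_iff[OF N, of w 1] w two_small by simp
  have w2: "vle 2 w" using small[of 2 1 N] N by simp
  have cw: "vle (c - 1) w" using small[OF c1, of "2 * m"] m by (simp add: N_def)
  \<comment> \<open>Contains every possible \<open>x 1\<close>: the equation
    \<open>phi a c y = \<alpha>\<close> after multiplication by \<open>y\<close>. Below,
    \<open>2 ^ JJ\<close> bounds from below the distance of \<open>\<alpha>\<close> to all other
    elements of \<open>Z\<close>.\<close>
  define Z where "Z = {y. poly [:a, c - \<alpha>, a:] y = 0}"
  have "finite Z" unfolding Z_def using a0 by (intro poly_roots_finite) simp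
  have alg: "algebraic_number (\<alpha> - y)" if "y \<in> Z" for y
  proof -
    let ?f = "[:1, (c - \<alpha>) / a, 1:] :: complex poly"
    have "poly_over K ?f"
      using K KR by (intro poly_over_pCons poly_over_0 subring_one subfield_divide[OF KF] subring_diff)
    moreover have "poly ?f y = 0" using that a0 by (simp add: Z_def field_simps)
    ultimately have nf: "number_field (adjoin K y)" using number_field_adjoin[OF K(1), of ?f y] by simp
    then show ?thesis using number_field_algebraic[OF nf] adjoin_self[OF KR] adjoin_subset[OF KR] K(4)
      subring_diff[OF subring_adjoin[OF KR]] by blast
  qed
  have "\<exists>j. vlt (2 ^ j) (\<alpha> - y)" if "y \<in> Z - {\<alpha>}" for y
    using algebraic_archimedean[OF alg, of y] that by auto
  then obtain J where J: "\<And>y. y \<in> Z - {\<alpha>} \<Longrightarrow> vlt (2 ^ J y) (\<alpha> - y)" by metis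
  define JJ where "JJ = Max (insert 0 (J ` (Z - {\<alpha>})))"
  have JJ: "J y \<le> JJ" if "y \<in> Z - {\<alpha>}" for y
    unfolding JJ_def using that \<open>finite Z\<close> by (intro Max_ge) auto
  have bound: "i \<le> N * JJ" if path: "backward_path a c \<alpha> n x" and x1: "x 1 \<noteq> \<alpha>" and i: "i < n"
    and sm: "vle (((x i - c) / a) ^ (2 * m)) 2" for n x i
  proof (rule ccontr)
    assume big: "\<not> i \<le> N * JJ"
    have x0: "x 0 = \<alpha>" using path by (simp add: backward_path_def)
    have "x 1 \<noteq> 0" "\<alpha> - c = a * (x 1 + 1 / x 1)" using backward_step[OF path _ a0, of 0] i x0 by auto
    then have "x 1 \<in> Z" unfolding Z_def by (simp add: field_simps)
    then have Z: "x 1 \<in> Z - {\<alpha>}" using x1 by simp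
    have "vle ((x i - c) / a) w" using small[OF sm, of r] r(1) by (simp add: N_def)
    then have "vle (x (i - Suc (i - 1)) - x (i - (i - 1))) (w ^ (i - 1))"
      using big by (intro contraction(2)[OF a cw w2 w1 path i]) auto
    moreover have "i - Suc (i - 1) = 0" "i - (i - 1) = 1" using big by auto
    ultimately have 1: "vle (\<alpha> - x 1) (w ^ (i - 1))" using x0 by simp
    have "N * JJ \<le> i - 1" using big by simp
    then obtain d where d: "i - 1 = N * JJ + d" using le_Suc_ex by blast
    have "w ^ (i - 1) = 2 ^ JJ * w ^ d" unfolding d power_add power_mult w ..
    then have "vle (w ^ (i - 1)) (2 ^ JJ)" using vle_mult_right[of "2 ^ JJ" "2 ^ JJ"] power_mem[OF vlt_one_mem[OF w1]] by simp
    moreover have "vle (2 ^ JJ) (2 ^ J (x 1))"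
    proof -
      obtain d where "JJ = J (x 1) + d" using JJ[OF Z] le_Suc_ex by blast
      then show ?thesis using vle_mult_right[of "2 ^ J (x 1)" "2 ^ J (x 1)" "2 ^ d"] power_mem[of 2 d]
        by (simp add: power_add)
    qed
    ultimately have "vle (\<alpha> - x 1) (2 ^ J (x 1))" using 1 vle_trans by blast
    then show False using J[OF Z] by (simp add: vlt_def)
  qed
  show ?thesis
  proof (intro exI[of _ "Suc (N * JJ)"] allI impI)
    fix n x assume path: "backward_path a c \<alpha> n x" and x1: "n > 0 \<longrightarrow> x 1 \<noteq> \<alpha>"
    have "{i. i < n \<and> vle (((x i - c) / a) ^ (2 * m)) 2} \<subseteq> {..N * JJ}"
      using bound[OF path] x1 by auto
    then have "card {i. i < n \<and> vle (((x i - c) / a) ^ (2 * m)) 2} \<le> card {..N * JJ}"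
      by (intro card_mono) auto
    then show "card {i. i < n \<and> vle (((x i - c) / a) ^ (2 * m)) 2} \<le> Suc (N * JJ)" by simp
  qed
qed

lemma backward_path_shift:
  "backward_path a c \<alpha> (Suc n) x \<Longrightarrow> x 1 = \<alpha> \<Longrightarrow> backward_path a c \<alpha> n (\<lambda>i. x (Suc i))"
  by (auto simp: backward_path_def)

theorem tower_bounded:
  assumes K: "number_field K" "K \<subseteq> F0" "a \<in> K" "c \<in> K" "\<alpha> \<in> K"
    and a: "veq a 1" and c: "vlt c 1 \<or> vlt (c - 1) 1"
  shows "\<exists>R. \<forall>\<gamma> f. \<gamma> \<in> backward_orbit a c \<alpha> \<longrightarrow> \<gamma> \<in> tower f \<longrightarrow> \<gamma> \<in> tower R"
proof -
  have a0: "a \<noteq> 0" using a by auto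
  obtain e0 m where e0: "e0 \<ge> 2" "m > 0" "\<And>e. e \<ge> e0 \<Longrightarrow> ramified m e" using eventually_ramified by blast
  have "\<exists>R. \<forall>n x. backward_path a c \<alpha> n x \<longrightarrow> (n > 0 \<longrightarrow> x 1 \<noteq> \<alpha>) \<longrightarrow>
      card {i. i < n \<and> vle (((x i - c) / a) ^ (2 * m)) 2} \<le> R"
    using c
  proof
    assume "vlt c 1"
    from small_steps_case_1[OF a this _ e0(2)] show ?thesis by (intro exI[of _ 1] allI impI)
  next
    assume "vlt (c - 1) 1"
    from small_steps_case_2[OF K(1,3-5) a this e0(2)] show ?thesis .
  qed
  then obtain R where R: "\<And>n x. backward_path a c \<alpha> n x \<Longrightarrow> n > 0 \<longrightarrow> x 1 \<noteq> \<alpha> \<Longrightarrow>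
      card {i. i < n \<and> vle (((x i - c) / a) ^ (2 * m)) 2} \<le> R" by blast
  \<comment> \<open>If \<open>\<alpha>\<close> is fixed by \<open>phi\<close>, a path can stay at
    \<open>\<alpha>\<close> for any number of steps. Dropping these steps keeps the endpoint and
    gives \<open>x 1 \<noteq> \<alpha>\<close>.\<close>
  have main: "\<exists>x n. backward_path a c \<alpha> n x \<and> x n = \<gamma> \<and> (n > 0 \<longrightarrow> x 1 \<noteq> \<alpha>)"
    if "backward_path a c \<alpha> n x" "x n = \<gamma>" for n x \<gamma>
    using that
  proof (induction n arbitrary: x)
    case 0
    then show ?case by (intro exI[of _ x] exI[of _ 0]) auto
  next
    case (Suc n)
    show ?case
    proof (cases "x 1 = \<alpha>")
      case True
      then show ?thesis using Suc.IH[OF backward_path_shift[OF Suc.prems(1) True]] Suc.prems(2) by simp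
    next
      case False
      then show ?thesis using Suc.prems by blast
    qed
  qed
  show ?thesis
  proof (intro exI[of _ "e0 + R"] allI impI)
    fix \<gamma> f assume "\<gamma> \<in> backward_orbit a c \<alpha>" and f: "\<gamma> \<in> tower f"
    then obtain n' where "\<gamma> \<in> preimg a c \<alpha> n'" by (auto simp: backward_orbit_def)
    then obtain x' where x': "backward_path a c \<alpha> n' x'" "x' n' = \<gamma>" using preimg_path by blast
    obtain x n where x: "backward_path a c \<alpha> n x" "x n = \<gamma>" "n > 0 \<longrightarrow> x 1 \<noteq> \<alpha>"
      using main[OF x'] by blast
    have "\<gamma> \<in> tower (e0 + card {i. i < n \<and> vle (((x i - c) / a) ^ (2 * m)) 2})"
      using path_level[OF K(2-5) a0 e0 x(1), of f] f x(2) by blast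
    then show "\<gamma> \<in> tower (e0 + R)" using R[OF x(1)] x(3) tower_mono by (meson add_le_cancel_left subsetD)
  qed
qed

end

section \<open>The valuation attached to a prime ideal\<close>

lemma subring_ring_of_integers: "number_field K \<Longrightarrow> subring_C (ring_of_integers K)"
  using alg_int_of_int[of 1]
  by (auto simp: subring_C_def ring_of_integers_def intro: alg_int_diff alg_int_mult
      subring_diff[OF number_field_subring] subring_mult[OF number_field_subring] subring_one[OF number_field_subring])

text \<open>Primitivity at 2 only. Coefficients are halved as long as all are even, which ends
  because the leading one shrinks. An odd coefficient is then a unit modulo any prime above
  2.\<close>

lemma primitive_polynomial:
  assumes "algebraic_number w"
  shows "\<exists>p. poly_over \<int> p \<and> poly p w = 0 \<and> (\<exists>i. coeff p i / 2 \<notin> \<int>)"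
proof -
  have descent: "\<exists>p. poly_over \<int> p \<and> poly p w = 0 \<and> (\<exists>i. coeff p i / 2 \<notin> \<int>)"
    if "poly_over \<int> p" "p \<noteq> 0" "poly p w = 0" "lead_coeff p = of_int k" for p k
    using that
  proof (induction "nat \<bar>k\<bar>" arbitrary: p k rule: less_induct)
    case less
    show ?case
    proof (cases "\<exists>i. coeff p i / 2 \<notin> \<int>")
      case False
      then have all: "coeff p i / 2 \<in> \<int>" for i by blast
      have "lead_coeff p / 2 \<in> \<int>" using all .
      then obtain l where l: "lead_coeff p / 2 = of_int l" by (elim Ints_cases)
      let ?p = "smult (1 / 2) p"
      have "(of_int k :: complex) = of_int (2 * l)" using l less.prems(4) by (simp add: field_simps)
      then have "k = 2 * l" by (simp only: of_int_eq_iff)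
      moreover have "k \<noteq> 0" using less.prems by auto
      ultimately have "nat \<bar>l\<bar> < nat \<bar>k\<bar>" by auto
      moreover have "poly_over \<int> ?p" using all by (simp add: poly_over_def)
      moreover have "lead_coeff ?p = of_int l" using l by simp
      ultimately show ?thesis using less.hyps[of l ?p] less.prems by simp
    qed (use less.prems in blast)
  qed
  obtain q where q: "poly_over \<rat> q" "q \<noteq> 0" "poly q w = 0" using assms by (auto simp: algebraic_number_def)
  obtain N where N: "N > 0" "poly_over \<int> (smult (of_nat N) q)" using clear_denominators[OF q(1)] by blast
  have "lead_coeff (smult (of_nat N) q) \<in> \<int>" using poly_over_coeff[OF N(2)] .
  then obtain k where "lead_coeff (smult (of_nat N) q) = of_int k" by (elim Ints_cases)
  then show ?thesis using descent[OF N(2)] N(1) q by simp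
qed

section \<open>Products of ideals as sets of finite sums\<close>

lemma ideal_prod_single: "x \<in> I \<Longrightarrow> y \<in> J \<Longrightarrow> x * y \<in> ideal_prod I J"
  unfolding ideal_prod_def by (intro CollectI exI[of _ 1] exI[of _ "\<lambda>_. x"] exI[of _ "\<lambda>_. y"]) auto

lemma ideal_prod_add:
  assumes "x \<in> ideal_prod I J" "y \<in> ideal_prod I J" shows "x + y \<in> ideal_prod I J"
proof -
  obtain n :: nat and f g where x: "\<forall>i<n. f i \<in> I \<and> g i \<in> J" "x = (\<Sum>i<n. f i * g i)"
    using assms(1) unfolding ideal_prod_def mem_Collect_eq by blast
  obtain m :: nat and f' g' where y: "\<forall>i<m. f' i \<in> I \<and> g' i \<in> J" "y = (\<Sum>i<m. f' i * g' i)"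
    using assms(2) unfolding ideal_prod_def mem_Collect_eq by blast
  let ?f = "\<lambda>i. if i < n then f i else f' (i - n)" and ?g = "\<lambda>i. if i < n then g i else g' (i - n)"
  have "(\<Sum>i<n + k. ?f i * ?g i) = x + (\<Sum>i<k. f' i * g' i)" for k
    by (induction k) (auto simp: x(2))
  then have eq: "x + y = (\<Sum>i<n + m. ?f i * ?g i)" by (simp only: y(2))
  have mem: "\<forall>i<n + m. ?f i \<in> I \<and> ?g i \<in> J" using x(1) y(1) by auto
  show ?thesis unfolding ideal_prod_def mem_Collect_eq
    by (rule exI[of _ "n + m"], rule exI[of _ ?f], rule exI[of _ ?g], rule conjI[OF mem eq])
qed

lemma ideal_prod_mult:
  assumes "\<And>y. y \<in> J \<Longrightarrow> r * y \<in> J" "x \<in> ideal_prod I J" shows "r * x \<in> ideal_prod I J"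
proof -
  obtain n :: nat and f g where x: "\<forall>i<n. f i \<in> I \<and> g i \<in> J" "x = (\<Sum>i<n. f i * g i)"
    using assms(2) unfolding ideal_prod_def mem_Collect_eq by blast
  have "r * x = (\<Sum>i<n. f i * (r * g i))" unfolding x(2) sum_distrib_left by (simp add: mult_ac)
  then show ?thesis unfolding ideal_prod_def using x(1) assms(1)
    by (intro CollectI exI[of _ n] exI[of _ f] exI[of _ "\<lambda>i. r * g i"]) auto
qed

section \<open>A valuation ring dominating a prime above 2\<close>

context
  fixes K P
  assumes K: "number_field K" and P: "prime_of K P" and two: "2 \<in> P"
begin

abbreviation "OK \<equiv> ring_of_integers K"

lemma OK_ring: "subring_C OK"
  using subring_ring_of_integers[OF K] .

lemma PD:
  shows P_sub: "x \<in> P \<Longrightarrow> x \<in> OK" and P_add: "x \<in> P \<Longrightarrow> y \<in> P \<Longrightarrow> x + y \<in> P"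
    and P_mult: "x \<in> P \<Longrightarrow> r \<in> OK \<Longrightarrow> r * x \<in> P"
    and P_prime: "x \<in> OK \<Longrightarrow> y \<in> OK \<Longrightarrow> x * y \<in> P \<Longrightarrow> x \<in> P \<or> y \<in> P"
    and P_zero: "0 \<in> P" and P_diff: "x \<in> P \<Longrightarrow> y \<in> P \<Longrightarrow> x - y \<in> P"
    and P_one: "1 \<notin> P"
proof -
  note p = P[unfolded prime_of_def Let_def]
  show "x \<in> P \<Longrightarrow> x \<in> OK" and a: "\<And>x y. x \<in> P \<Longrightarrow> y \<in> P \<Longrightarrow> x + y \<in> P"
    and m: "\<And>x r. x \<in> P \<Longrightarrow> r \<in> OK \<Longrightarrow> r * x \<in> P"
    and "x \<in> OK \<Longrightarrow> y \<in> OK \<Longrightarrow> x * y \<in> P \<Longrightarrow> x \<in> P \<or> y \<in> P" and "0 \<in> P"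
    using p by blast+
  show "x \<in> P \<Longrightarrow> y \<in> P \<Longrightarrow> x - y \<in> P"
    using a[of x "- y"] m[of y "- 1"] subring_uminus[OF OK_ring subring_one[OF OK_ring]] by simp
  show "1 \<notin> P"
  proof
    assume "1 \<in> P"
    then have "OK \<subseteq> P" using m[of 1] by auto
    then show False using p by blast
  qed
qed

lemma odd_int_mod_P: "odd k \<Longrightarrow> of_int k - 1 \<in> P"
proof -
  assume "odd k"
  then obtain l where "k = 2 * l + 1" by (elim oddE)
  then have "of_int k - 1 = of_int l * (2 :: complex)" by simp
  then show ?thesis using P_mult[OF two subring_of_int[OF OK_ring]] by simp
qed

text \<open>Uses an integer equation for \<open>y\<close> with some odd coefficient. An even
  constant term lies in \<open>P\<close>, so by primality the factor \<open>y\<close> can be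
  removed; the first odd constant term is 1 modulo \<open>P\<close> and exhibits an inverse of
  \<open>y\<close> modulo \<open>P\<close>.\<close>

lemma P_maximal:
  assumes y: "y \<in> OK" "y \<notin> P" shows "\<exists>r\<in>OK. 1 - r * y \<in> P"
proof -
  have *: "poly_over \<int> p \<Longrightarrow> poly p y \<in> P \<Longrightarrow> \<exists>i. coeff p i / 2 \<notin> \<int> \<Longrightarrow> \<exists>r\<in>OK. 1 - r * y \<in> P" for p
  proof (induction p)
    case (pCons a p)
    have p: "poly_over \<int> p"
      unfolding poly_over_def
    proof
      fix i show "coeff p i \<in> \<int>" using poly_over_coeff[OF pCons.prems(1), of "Suc i"] by simp
    qed
    have "\<int> \<subseteq> OK" using subring_of_int[OF OK_ring] by (auto elim: Ints_cases)
    then have ev: "poly p y \<in> OK" using poly_mem[OF OK_ring poly_over_mono[OF p]] y(1) by blast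
    have "a \<in> \<int>" using poly_over_coeff[OF pCons.prems(1), of 0] by simp
    then obtain k where k: "a = of_int k" by (elim Ints_cases)
    show ?case
    proof (cases "even k")
      case True
      then obtain l where l: "a = of_int l * 2" unfolding k by (auto elim!: evenE)
      then have aP: "a \<in> P" using P_mult[OF two subring_of_int[OF OK_ring]] by simp
      have "y * poly p y \<in> P" using P_diff[OF pCons.prems(2) aP] by simp
      then have "poly p y \<in> P" using P_prime[OF y(1) ev] y(2) by blast
      moreover have "\<exists>i. coeff p i / 2 \<notin> \<int>"
      proof -
        obtain i where "coeff (pCons a p) i / 2 \<notin> \<int>" using pCons.prems(3) by blast
        then show ?thesis using l by (cases i) auto
      qed
      ultimately show ?thesis using pCons.IH p by blast
    next
      case False
      have "poly (pCons a p) y - (of_int k - 1) \<in> P" using P_diff[OF pCons.prems(2) odd_int_mod_P[OF False]] .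
      then have "1 - (- poly p y) * y \<in> P" using k by (simp add: algebra_simps)
      then show ?thesis using subring_uminus[OF OK_ring ev] by blast
    qed
  qed auto
  have "y \<in> K" using y by (simp add: ring_of_integers_def)
  then obtain p where p: "poly_over \<int> p" "poly p y = 0" "\<exists>i. coeff p i / 2 \<notin> \<int>"
    using primitive_polynomial[OF number_field_algebraic[OF K]] by blast
  then show ?thesis using *[OF p(1)] P_zero by simp
qed

text \<open>\<open>chevalley\<close> makes the elements of \<open>P\<close> small. Conversely an
  element of the ring of integers outside \<open>P\<close> is invertible modulo \<open>P\<close>,
  hence not small.\<close>

lemma dominating_valuation:
  "\<exists>V. residue_char V 2 \<and> OK \<subseteq> V \<and> (\<forall>y\<in>OK. y \<in> P \<longleftrightarrow> valuation_ring.vlt V y 1)"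
proof -
  have "x \<in> P" if "x \<in> ideal_gen P OK" for x
    using that
  proof (induction rule: ideal_gen.induct)
    case (ideal_gen_step i b y)
    then show ?case using P_add P_mult[of i b] by (simp add: mult.commute)
  qed (rule P_zero)
  then have "1 \<notin> ideal_gen P OK" using P_one by blast
  moreover have "P \<subseteq> OK" using P_sub by blast
  ultimately obtain V where V: "valuation_ring V" "OK \<subseteq> V" "\<forall>x\<in>P. valuation_ring.vlt V x 1"
    using chevalley[OF OK_ring] by blast
  interpret valuation_ring V by fact
  have "residue_char V 2" using V two by unfold_locales auto
  moreover have "y \<in> P" if y: "y \<in> OK" "vlt y 1" for y
  proof (rule ccontr)
    assume "y \<notin> P"
    then obtain r where r: "r \<in> OK" "1 - r * y \<in> P" using P_maximal y by blast
    then have "vlt (1 - r * y) 1" "vlt (r * y) 1" using V y by (auto intro: vlt_mult_left)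
    then have "vlt ((1 - r * y) + r * y) 1" by (rule vlt_add)
    then show False by simp
  qed
  ultimately show ?thesis using V by blast
qed

end

section \<open>Agreement of the ideal-theoretic valuation with the valuation ring\<close>

locale dominating = residue_char V 2 for V +
  fixes K P
  assumes K: "number_field K" and P: "prime_of K P" and two: "2 \<in> P"
    and OV: "ring_of_integers K \<subseteq> V" and dom: "\<And>y. y \<in> ring_of_integers K \<Longrightarrow> y \<in> P \<longleftrightarrow> vlt y 1"
begin

abbreviation "R \<equiv> ring_of_integers K"

lemmas KR = number_field_subring[OF K] and KF = number_field_subfield[OF K]
lemmas RR = OK_ring[OF K P two]
lemmas P_rules = PD[OF K P two]

text \<open>\<open>K \<inter> V\<close> is the localization of \<open>R\<close> at \<open>P\<close>.
  For a 2-primitive equation of \<open>w\<close> the Horner sums satisfy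
  \<open>coeff p j = b j - b (Suc j) * w\<close>, where \<open>b j\<close>, \<open>b j * w\<close>
  and their analogues for \<open>Suc j\<close> lie in \<open>R\<close>. At an odd coefficient not
  both terms are in \<open>P\<close>, so \<open>b j\<close> or \<open>b (Suc j)\<close> serves as
  denominator.\<close>

lemma denominator:
  assumes w: "w \<in> K" "w \<in> V" shows "\<exists>s\<in>R. s \<notin> P \<and> s * w \<in> R"
proof -
  obtain p where p: "poly_over \<int> p" "poly p w = 0" and odd: "\<exists>i. coeff p i / 2 \<notin> \<int>"
    using primitive_polynomial[OF number_field_algebraic[OF K w(1)]] by blast
  define b where "b j = (\<Sum>i\<in>{j..degree p}. coeff p i * w ^ (i - j))" for j
  have cK: "coeff p i \<in> K" for i
    using poly_over_coeff[OF p(1), of i] subring_of_int[OF KR] by (auto elim!: Ints_cases)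
  have b0: "b 0 = 0" using p(2) by (simp add: b_def poly_altdef atMost_atLeast0)
  have bK1: "b j \<in> K" for j
    unfolding b_def by (intro subring_sum[OF KR] subring_mult[OF KR] subring_power[OF KR] cK w(1))
  have bK: "b j \<in> K" "b j * w \<in> K" for j using bK1 subring_mult[OF KR bK1 w(1)] by auto
  have bR: "b j \<in> R" "b j * w \<in> R" for j
    using bK[of j] horner_integral[OF p, of j] b0 alg_int_of_int[of 0]
    by (cases "j = 0"; simp add: ring_of_integers_def b_def)+
  obtain j where j: "coeff p j / 2 \<notin> \<int>" using odd by blast
  have jd: "j \<le> degree p" using j by (metis coeff_eq_0 div_0 Ints_0 not_le)
  have horner: "coeff p j = b j - b (Suc j) * w"
  proof -
    have "b j = coeff p j + (\<Sum>i\<in>{Suc j..degree p}. coeff p i * w ^ (i - j))"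
      unfolding b_def using jd by (simp add: sum.atLeast_Suc_atMost)
    also have "(\<Sum>i\<in>{Suc j..degree p}. coeff p i * w ^ (i - j)) = b (Suc j) * w"
      unfolding b_def sum_distrib_right
    proof (intro sum.cong refl)
      fix i assume "i \<in> {Suc j..degree p}"
      then have "i - j = Suc (i - Suc j)" by auto
      then show "coeff p i * w ^ (i - j) = coeff p i * w ^ (i - Suc j) * w" by simp
    qed
    finally show ?thesis by simp
  qed
  obtain k where k: "coeff p j = of_int k" using poly_over_coeff[OF p(1), of j] by (elim Ints_cases)
  have "odd k" using j k by (auto elim!: evenE)
  then have "coeff p j \<notin> P"
    using odd_int_mod_P[OF K P two, of k] P_rules(6)[of "of_int k" "of_int k - 1"] P_rules(7) k by auto
  then have "b j \<notin> P \<or> b (Suc j) * w \<notin> P" using horner P_rules(6) by metis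
  moreover have "b (Suc j) \<notin> P" if "b (Suc j) * w \<notin> P"
    using that dom bR[of "Suc j"] vlt_mult_right[OF _ w(2)] by blast
  ultimately show ?thesis using bR by blast
qed

lemma integral_uniformizer:
  "\<exists>p\<in>P. p \<noteq> 0 \<and> (\<forall>x\<in>K. vlt x 1 \<longrightarrow> vle x p)"
proof -
  obtain p where p: "p \<in> K" "p \<noteq> 0" "vlt p 1" "\<And>x. x \<in> K \<Longrightarrow> vlt x 1 \<Longrightarrow> vle x p"
    using uniformizer[OF K] by blast
  obtain s where s: "s \<in> R" "s \<notin> P" "s * p \<in> R" using denominator[OF p(1)] vlt_one_mem[OF p(3)] by blast
  have s1: "veq s 1" using s dom OV by (auto simp: veq_one_iff)
  have sp: "veq (s * p) p" using veq_one_mult[OF s1] .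
  then have "vlt (s * p) 1" using veq_vlt1 p(3) by blast
  then have "s * p \<in> P" using dom s(3) by blast
  moreover have "s * p \<noteq> 0" using sp p(2) by auto
  moreover have "vle x (s * p)" if "x \<in> K" "vlt x 1" for x using p(4)[OF that] veq_vle2[OF sp] by blast
  ultimately show ?thesis by blast
qed

lemma ideal_pow_rules:
  shows ideal_pow_R: "x \<in> ideal_pow R P n \<Longrightarrow> r \<in> R \<Longrightarrow> r * x \<in> ideal_pow R P n"
    and ideal_pow_add: "x \<in> ideal_pow R P n \<Longrightarrow> y \<in> ideal_pow R P n \<Longrightarrow> x + y \<in> ideal_pow R P n"
    and ideal_pow_power: "p \<in> P \<Longrightarrow> r \<in> R \<Longrightarrow> p ^ n * r \<in> ideal_pow R P n"
proof -
  show "x \<in> ideal_pow R P n \<Longrightarrow> r \<in> R \<Longrightarrow> r * x \<in> ideal_pow R P n" for x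
  proof (induction n arbitrary: x)
    case 0
    then show ?case using subring_mult[OF RR] by simp
  next
    case (Suc n)
    then show ?case using ideal_prod_mult[of "ideal_pow R P n" r x P] by simp
  qed
  show "x \<in> ideal_pow R P n \<Longrightarrow> y \<in> ideal_pow R P n \<Longrightarrow> x + y \<in> ideal_pow R P n"
    by (cases n) (auto intro: ideal_prod_add subring_add[OF RR])
  show "p \<in> P \<Longrightarrow> r \<in> R \<Longrightarrow> p ^ n * r \<in> ideal_pow R P n"
    by (induction n) (auto simp: mult.assoc intro: ideal_prod_single)
qed

text \<open>For the converse direction \<open>y / p ^ n\<close> has a denominator
  \<open>s \<notin> P\<close>, so \<open>s * y\<close> lies in the \<open>n\<close>-th power of
  \<open>P\<close>. As \<open>s\<close> is invertible modulo \<open>P\<close>, iteration gives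
  \<open>1 = s * q + d ^ n\<close> with \<open>d \<in> P\<close>; multiplying by \<open>y\<close>
  finishes.\<close>

lemma ideal_pow_iff:
  assumes p: "p \<in> P" "p \<noteq> 0" "\<And>x. x \<in> K \<Longrightarrow> vlt x 1 \<Longrightarrow> vle x p" and y: "y \<in> R"
  shows "y \<in> ideal_pow R P n \<longleftrightarrow> vle y (p ^ n)"
proof
  have le: "vle f p" if "f \<in> P" for f
    using p(3)[of f] dom[of f] P_rules(1)[OF that] that by (auto simp: ring_of_integers_def)
  show "y \<in> ideal_pow R P n \<Longrightarrow> vle y (p ^ n)"
  proof (induction n arbitrary: y)
    case 0
    then show ?case using OV by (auto simp: vle_one_iff)
  next
    case (Suc n)
    then obtain N :: nat and f g where fg: "\<forall>i<N. f i \<in> P \<and> g i \<in> ideal_pow R P n" "y = (\<Sum>i<N. f i * g i)"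
      by (auto simp: ideal_prod_def)
    have "vle (f i * g i) (p * p ^ n)" if "i < N" for i
      using fg(1) that Suc.IH le by (intro vle_mult) auto
    then show ?case unfolding fg(2) by (intro vle_sum) auto
  qed
next
  assume le: "vle y (p ^ n)"
  have pK: "p \<in> K" using P_rules(1)[OF p(1)] by (simp add: ring_of_integers_def)
  have yK: "y \<in> K" using y by (simp add: ring_of_integers_def)
  have "y / p ^ n \<in> V" using le vle_iff_divide[of "p ^ n" y] p(2) by simp
  moreover have "y / p ^ n \<in> K" using subfield_divide[OF KF yK subring_power[OF KR pK]] .
  ultimately obtain s where s: "s \<in> R" "s \<notin> P" "s * (y / p ^ n) \<in> R" using denominator by blast
  have "s * y = p ^ n * (s * (y / p ^ n))" using p(2) by simp
  then have sy: "s * y \<in> ideal_pow R P n" using ideal_pow_power[OF p(1) s(3), of n] by simp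
  obtain r where r: "r \<in> R" "1 - r * s \<in> P" using P_maximal[OF K P two s(1,2)] by blast
  define d where "d = 1 - r * s"
  have dR: "d \<in> R" using P_rules(1)[OF r(2)] by (simp add: d_def)
  have "\<exists>q\<in>R. 1 = s * q + d ^ k" for k
  proof (induction k)
    case 0
    then show ?case using subring_zero[OF RR] by (intro bexI[of _ 0]) auto
  next
    case (Suc k)
    then obtain q where q: "q \<in> R" "1 = s * q + d ^ k" by blast
    have "d ^ k = d ^ k * (d + r * s)" by (simp add: d_def)
    then have "d ^ k = d ^ Suc k + s * (d ^ k * r)" by (simp add: algebra_simps)
    then have "1 = s * (q + d ^ k * r) + d ^ Suc k" using q(2) by (simp add: algebra_simps)
    moreover have "q + d ^ k * r \<in> R"
      using subring_add[OF RR q(1) subring_mult[OF RR subring_power[OF RR dR] r(1)]] .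
    ultimately show ?case by blast
  qed
  then obtain q where q: "q \<in> R" "1 = s * q + d ^ n" by blast
  have "y = (s * q + d ^ n) * y" using q(2) by simp
  also have "\<dots> = q * (s * y) + d ^ n * y" by (simp add: algebra_simps)
  finally have eq: "y = q * (s * y) + d ^ n * y" .
  have "d ^ n * y \<in> ideal_pow R P n" using ideal_pow_power[OF r(2) y, of n] by (simp add: d_def)
  then show "y \<in> ideal_pow R P n" using ideal_pow_add[OF ideal_pow_R[OF sy q(1)], of "d ^ n * y"] eq by simp
qed

text \<open>An element of \<open>R\<close> has the value of \<open>p ^ N\<close> for a uniformizer
  \<open>p \<in> P\<close>, and by \<open>ideal_pow_iff\<close> this \<open>N\<close> is the order
  defined through ideal powers. So the sign of \<open>val\<close> can be read off in
  \<open>V\<close>.\<close>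

lemma val_residue:
  assumes x: "x \<in> K" "x \<noteq> 0"
  shows "val K P x = 0 \<Longrightarrow> veq x 1" and "val K P x > 0 \<Longrightarrow> vlt x 1"
proof -
  obtain p where p: "p \<in> P" "p \<noteq> 0" "\<And>x. x \<in> K \<Longrightarrow> vlt x 1 \<Longrightarrow> vle x p"
    using integral_uniformizer by blast
  have pR: "p \<in> R" using P_rules(1)[OF p(1)] .
  have pK: "p \<in> K" using pR by (simp add: ring_of_integers_def)
  have p1: "vlt p 1" using dom[OF pR] p(1) by blast
  have ord: "\<exists>N. ord_int K P y = int N \<and> veq y (p ^ N)" if y: "y \<in> R" "y \<noteq> 0" for y
  proof -
    have yK: "y \<in> K" using y by (simp add: ring_of_integers_def)
    define Q where "Q n \<longleftrightarrow> vle y (p ^ n)" for n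
    define N where "N = (GREATEST n. Q n)"
    have Q0: "Q 0" using y OV by (auto simp: Q_def vle_one_iff)
    obtain j where j: "vlt (2 ^ j) y" using algebraic_archimedean[OF number_field_algebraic[OF K yK] y(2)] by auto
    obtain t where t: "t > 0" "vle (p ^ t) 2" using nonunit_power[OF K] pK p1 by auto
    \<comment> \<open>The maximum in \<open>ord_int\<close> exists: the powers of \<open>p\<close>
      eventually fall below the value of \<open>y\<close>.\<close>
    have bound: "n \<le> t * j" if "Q n" for n
    proof (rule ccontr)
      assume "\<not> n \<le> t * j"
      then obtain d where d: "n = t * j + d" using le_Suc_ex by (metis nat_le_linear)
      have "vle (p ^ n) ((p ^ t) ^ j)"
        unfolding d power_add power_mult using power_mem[OF vlt_one_mem[OF p1]] by (intro vle_mult_right) auto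
      moreover have "vle ((p ^ t) ^ j) (2 ^ j)" using t(2) by (rule vle_power)
      ultimately have "vle y (2 ^ j)" using that vle_trans unfolding Q_def by blast
      then show False using j by (simp add: vlt_def)
    qed
    have QN: "Q N" unfolding N_def using GreatestI_nat[of Q 0 "t * j"] Q0 bound by blast
    have nQ: "\<not> Q (Suc N)" using Greatest_le_nat[of Q "Suc N" "t * j"] bound unfolding N_def by force
    have "veq y (p ^ N)"
    proof (rule ccontr)
      assume "\<not> veq y (p ^ N)"
      then have "vlt y (p ^ N)" using QN by (simp add: Q_def veq_def vlt_def)
      then have "vlt (y / p ^ N) 1" using vlt_iff_divide[of "p ^ N" y] p(2) by simp
      then have "vle (y / p ^ N) p" using p(3) subfield_divide[OF KF yK subring_power[OF KR pK]] by blast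
      then have "Q (Suc N)" using p(2) by (simp add: Q_def vle_divide_iff mult.commute)
      then show False using nQ by simp
    qed
    moreover have "ord_int K P y = int N"
      unfolding ord_int_def N_def Q_def using ideal_pow_iff[OF p y(1)] by simp
    ultimately show ?thesis by blast
  qed
  \<comment> \<open>\<open>val\<close> is an arbitrary choice among quotient representations of
    \<open>x\<close>, so one has to be exhibited first; the conclusion is then drawn from whichever
    one was chosen.\<close>
  let ?S = "\<lambda>n. \<exists>y z. y \<in> R \<and> z \<in> R \<and> y \<noteq> 0 \<and> z \<noteq> 0 \<and> x = y / z \<and> n = ord_int K P y - ord_int K P z"
  obtain l where l: "l > 0" "alg_int (of_nat l * x)"
    using integral_multiple[OF number_field_algebraic[OF K x(1)]] by blast
  have "of_nat l * x \<in> R" "of_nat l \<in> R"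
    using l(2) alg_int_of_nat x(1) subring_mult[OF KR] subring_of_nat[OF KR] by (auto simp: ring_of_integers_def)
  then have "?S (ord_int K P (of_nat l * x) - ord_int K P (of_nat l))"
    using l(1) x(2) by (intro exI[of _ "of_nat l * x"] exI[of _ "of_nat l"]) auto
  then have "?S (val K P x)" unfolding val_def by (rule someI)
  then obtain y z where yz: "y \<in> R" "z \<in> R" "y \<noteq> 0" "z \<noteq> 0" "x = y / z" "val K P x = ord_int K P y - ord_int K P z"
    by blast
  obtain N where N: "ord_int K P y = int N" "veq y (p ^ N)" using ord yz by blast
  obtain M where M: "ord_int K P z = int M" "veq z (p ^ M)" using ord yz by blast
  have xyz: "veq x (p ^ N * inverse (p ^ M))"
    unfolding yz(5) divide_inverse using N M by (intro veq_mult veq_inverse)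
  show "veq x 1" if "val K P x = 0"
  proof -
    have "N = M" using that yz(6) N M by simp
    then show ?thesis using xyz p(2) by simp
  qed
  show "vlt x 1" if "val K P x > 0"
  proof -
    have "M < N" using that yz(6) N M by simp
    then obtain d where d: "N = M + Suc d" using less_iff_Suc_add by auto
    have "p ^ N * inverse (p ^ M) = p ^ Suc d" unfolding d power_add using p(2) by simp
    moreover have "vlt (p ^ Suc d) 1" using vlt_power[OF p1, of "Suc d"] by simp
    ultimately show ?thesis using xyz veq_vlt1 by simp
  qed
qed

end

section \<open>Bounding the odd part of the conductor\<close>

text \<open>For the least conductor \<open>N\<close> of a point, the two descents exclude odd primes
  above \<open>B\<close> and squares of odd primes as divisors. So the odd part of \<open>N\<close>
  divides one fixed number, and only the power of 2 is left open.\<close>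

lemma odd_conductor_bounded:
  assumes K: "number_field K" and mem: "a \<in> K" "c \<in> K" "\<alpha> \<in> K" "a \<noteq> 0"
  shows "\<exists>Q>0. \<forall>\<gamma> N. \<gamma> \<in> backward_orbit a c \<alpha> \<longrightarrow> N \<ge> 1 \<longrightarrow> \<gamma> \<in> cyclotomic_ext K N \<longrightarrow>
    (\<exists>e. \<gamma> \<in> cyclotomic_ext (cyclotomic_ext K Q) (2 ^ e))"
proof -
  obtain B where B: "\<And>q M n x. prime q \<Longrightarrow> q > B \<Longrightarrow> M > 0 \<Longrightarrow> \<not> q dvd M \<Longrightarrow> backward_path a c \<alpha> n x \<Longrightarrow>
     x n \<in> cyclotomic_ext K (q * M) \<Longrightarrow> x n \<in> cyclotomic_ext K M"
    using good_prime_descent[OF K mem] by blast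
  \<comment> \<open>Divisible by every product of distinct primes up to \<open>B\<close>.\<close>
  define Q :: nat where "Q = fact B"
  have Q: "Q > 0" by (simp add: Q_def)
  have "\<exists>e. \<gamma> \<in> cyclotomic_ext (cyclotomic_ext K Q) (2 ^ e)"
    if \<gamma>: "\<gamma> \<in> backward_orbit a c \<alpha>" and N0: "N0 \<ge> 1" "\<gamma> \<in> cyclotomic_ext K N0" for \<gamma> N0
  proof -
    obtain n where "\<gamma> \<in> preimg a c \<alpha> n" using \<gamma> by (auto simp: backward_orbit_def)
    then obtain x where x: "backward_path a c \<alpha> n x" "x n = \<gamma>" using preimg_path by blast
    define N where "N = (LEAST N. N \<ge> 1 \<and> \<gamma> \<in> cyclotomic_ext K N)"
    have N: "N \<ge> 1" "\<gamma> \<in> cyclotomic_ext K N"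
      using LeastI[of "\<lambda>N. N \<ge> 1 \<and> \<gamma> \<in> cyclotomic_ext K N" N0] N0 by (auto simp: N_def)
    have min: "N \<le> M" if "M \<ge> 1" "\<gamma> \<in> cyclotomic_ext K M" for M
      unfolding N_def by (rule Least_le) (use that in simp)
    have prime_factor: "q \<le> B \<and> \<not> q * q dvd N" if q: "prime q" "odd q" "q dvd N" for q
    proof -
      obtain M where M: "N = q * M" using q(3) by blast
      have M0: "M > 0" "M < N" using N(1) prime_gt_1_nat[OF q(1)] unfolding M by auto
      have \<gamma>M: "\<gamma> \<notin> cyclotomic_ext K M" using min[of M] M0 by auto
      have "\<not> q dvd M"
        using odd_prime_power_descent[OF K mem q(1,2) _ M0(1) x(1)] x(2) N(2) \<gamma>M by (auto simp: M)
      moreover have "\<not> q > B"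
        using B[OF q(1) _ M0(1) \<open>\<not> q dvd M\<close> x(1)] x(2) N(2) \<gamma>M by (auto simp: M)
      ultimately show ?thesis using prime_gt_0_nat[OF q(1)] by (simp add: M)
    qed
    obtain N' where N': "N = 2 ^ multiplicity 2 N * N'" "\<not> 2 dvd N'"
      using multiplicity_decompose'[of N 2] N(1) by auto
    have N0': "N' \<noteq> 0" using N'(2) by (metis dvd_0_right)
    define e where "e = multiplicity 2 N"
    have "N' dvd Q"
    proof (rule multiplicity_le_imp_dvd)
      show "N' \<noteq> 0" using N0' .
      fix q :: nat assume q: "prime q"
      show "multiplicity q N' \<le> multiplicity q Q"
      proof (cases "q dvd N'")
        case True
        then have "odd q" using N'(2) q by (metis dvd_trans)
        have dN: "d dvd N" if "d dvd N'" for d using that N'(1) by (metis dvd_mult)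
        have qq: "q \<le> B" "\<not> q * q dvd N'" using prime_factor[OF q \<open>odd q\<close> dN[OF True]] dN by auto
        have "multiplicity q N' < 2"
          using qq(2) q N0' by (intro multiplicity_lessI) (auto simp: power2_eq_square prime_gt_1_nat)
        moreover have "q dvd Q" unfolding Q_def using qq(1) prime_gt_0_nat[OF q] by (intro dvd_fact) auto
        then have "multiplicity q Q \<ge> 1"
          using Q q by (intro multiplicity_geI) (auto simp: prime_gt_1_nat)
        ultimately show ?thesis by simp
      qed (simp add: not_dvd_imp_multiplicity_0)
    qed
    let ?F = "cyclotomic_ext K Q"
    note F = cyclotomic_adjoin(2)[OF K Q]
    have E: "number_field (cyclotomic_ext ?F (2 ^ e))" using cyclotomic_adjoin(2)[OF F] by simp
    have FE: "?F \<subseteq> cyclotomic_ext ?F (2 ^ e)" using cyclotomic_subset[OF F] by simp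
    have "zeta N' \<in> cyclotomic_ext ?F (2 ^ e)" using zeta_mem_cyclotomic[OF K Q \<open>N' dvd Q\<close>] FE by blast
    moreover have "zeta (2 ^ e) \<in> cyclotomic_ext ?F (2 ^ e)" using zeta_mem_cyclotomic[OF F] by simp
    moreover have "coprime (2 ^ e) N'" using N'(2) by (simp add: coprime_power_left_iff)
    ultimately have "zeta N \<in> cyclotomic_ext ?F (2 ^ e)"
      using zeta_coprime_split[OF number_field_subfield[OF E], of "2 ^ e" N'] N'(1) N(1) by (auto simp: e_def)
    moreover have "K \<subseteq> cyclotomic_ext ?F (2 ^ e)" using cyclotomic_subset[OF K Q] FE by blast
    ultimately have "cyclotomic_ext K N \<subseteq> cyclotomic_ext ?F (2 ^ e)"
      using cyclotomic_least[OF K number_field_subring[OF E]] N(1) by auto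
    then show ?thesis using N(2) by blast
  qed
  then show ?thesis using Q by (intro exI[of _ Q]) blast
qed

theorem theorem3p10:
  fixes K :: "complex set" and a c \<alpha> :: complex
  assumes "number_field K"
    and "a \<in> K" and "c \<in> K" and "a \<noteq> 0" and "\<alpha> \<in> K"
    and "\<exists>P. prime_of K P \<and> lies_above P 2 \<and>
           ((val K P a = 0 \<and> (c \<noteq> 0 \<longrightarrow> val K P c > 0)) \<or>
            (val K P a = 0 \<and> weil_height K a > ln 4 \<and> (c \<noteq> 1 \<longrightarrow> val K P (c - 1) > 0)))"
  shows "fin_dim_over K (Kc_infty K a c \<alpha>)"
proof -
  note K = assms(1) and mem = assms(2,3,5) and a0 = assms(4)
  obtain P where prime: "prime_of K P" "lies_above P 2" "val K P a = 0"
    and c: "(c \<noteq> 0 \<longrightarrow> val K P c > 0) \<or> (c \<noteq> 1 \<longrightarrow> val K P (c - 1) > 0)"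
    using assms(6) by blast
  have two: "2 \<in> P" using prime(2) by (simp add: lies_above_def)
  obtain V where V: "residue_char V 2" "ring_of_integers K \<subseteq> V"
      "\<forall>y\<in>ring_of_integers K. y \<in> P \<longleftrightarrow> valuation_ring.vlt V y 1"
    using dominating_valuation[OF K prime(1) two] by blast
  obtain Q where Q: "Q > 0" "\<And>\<gamma> N. \<gamma> \<in> backward_orbit a c \<alpha> \<Longrightarrow> N \<ge> 1 \<Longrightarrow> \<gamma> \<in> cyclotomic_ext K N \<Longrightarrow>
      \<exists>e. \<gamma> \<in> cyclotomic_ext (cyclotomic_ext K Q) (2 ^ e)"
    using odd_conductor_bounded[OF K mem a0] by blast
  interpret residue_char V 2 by fact
  interpret dominating V K P
    using K prime(1) two V(2,3) by unfold_locales auto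
  \<comment> \<open>The odd part of all conductors is absorbed into the base field of the 2-power
    tower.\<close>
  interpret dyadic_tower V "cyclotomic_ext K Q"
    using cyclotomic_adjoin(2)[OF K Q(1)] by unfold_locales
  have a: "veq a 1" using val_residue(1)[OF mem(1) a0 prime(3)] .
  have "c - 1 \<in> K" using subring_diff[OF KR mem(2) subring_one[OF KR]] .
  \<comment> \<open>The valuation is not evaluated at 0: for \<open>c = 0\<close> or
    \<open>c = 1\<close> the element in question is 0 and small anyway.\<close>
  then have "vlt c 1 \<or> vlt (c - 1) 1"
    using c val_residue(2)[OF mem(2)] val_residue(2)[of "c - 1"]
    by (cases "c = 0"; cases "c = 1") (auto simp: vlt_zero_iff)
  then obtain r where r: "\<And>\<gamma> f. \<gamma> \<in> backward_orbit a c \<alpha> \<Longrightarrow> \<gamma> \<in> tower f \<Longrightarrow> \<gamma> \<in> tower r"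
    using tower_bounded[OF K cyclotomic_subset[OF K Q(1)] mem a] by blast
  have "K \<subseteq> tower r" using cyclotomic_subset[OF K Q(1)] tower_base by blast
  moreover have "\<gamma> \<in> tower r" if "\<gamma> \<in> backward_orbit a c \<alpha>" "N \<ge> 1" "\<gamma> \<in> cyclotomic_ext K N" for \<gamma> N
    using Q(2)[OF that] r[OF that(1)] unfolding tower_def by blast
  ultimately have "Kc_infty K a c \<alpha> \<subseteq> tower r"
    unfolding Kc_infty_def by (intro gen_field_least[OF tower_field]) blast
  then show ?thesis using fin_dim_over_subset[OF tower_nf KF] by blast
qed

end
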